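(* Suppose $B=B(G,\underline g,\underline\chi)$ has rank $\theta$ and that $B$ acts linearly and inner faithfully on the quantum affine space $A=\Bbbk_{\mathbf p}[u_1,\dots,u_t]$, $t\ge 2$. Assume $m_i\ge 3$ for all $i$ and $\operatorname{ord}(p_{ij})\ge 3$ for all $i\ne j$. Then $\theta\le 2(t-1)$.
   Context: $\Bbbk$ is an algebraically closed field of characteristic zero; $\operatorname{ord}$ denotes multiplicative order. Standing assumption: the parameters $p_{ij}$ ($i\neq j$) are roots of unity. Quantum affine space: for $\mathbf p=(p_{ij})\in M_t(\Bbbk^\times)$ with $p_{ii}=1$ and $p_{ij}=p_{ji}^{-1}$, $\Bbbk_{\mathbf p}[u_1,\dots,u_t]$ is generated by $u_1,\dots,u_t$ with relations $u_iu_j=p_{ij}u_ju_i$, graded with $\deg u_i=1$. Bosonization: let $\theta\in\mathbb N$, $G$ a finite abelian group, $\underline g=(g_1,\dots,g_\theta)$ with $g_i\in G$, and $\underline\chi=(\chi_1,\dots,\chi_\theta)$ with $\chi_i\in\widehat G=\operatorname{Hom}(G,\Bbbk^\times)$, such that $\chi_i(g_j)=\chi_j(g_i)^{-1}$ for $i\ne j$ and $m_i:=\operatorname{ord}(\chi_i(g_i))\ge 2$. Then $B(G,\underline g,\underline\chi)$ (the bosonization of a quantum linear space) is the Hopf algebra generated by $G$ and $x_1,\dots,x_\theta$ with the relations of $G$ and $x_i^{m_i}=0$, $x_ix_j=\chi_j(g_i)x_jx_i$ ($i\ne j$), $hx_i=\chi_i(h)x_ih$ ($h\in G$), where elements of $G$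 are grouplike and $\Delta(x_i)=g_i\otimes x_i+x_i\otimes 1$. Its rank is $\theta$. Actions: a Hopf algebra $H$ acts on $A$ if $A$ is a left $H$-module algebra; the action is inner faithful if no nonzero Hopf ideal of $H$ annihilates $A$; an action of $B$ is linear if the $g_i$ and $x_i$ map $A_{(1)}=\operatorname{Span}_\Bbbk\{u_1,\dots,u_t\}$ into itself. *)

theory Defs
  imports "HOL-Algebra.Algebraic_Closure_Type" "HOL-Algebra.QuotRing"
    "HOL-Algebra.Multiplicative_Group" "HOL-Algebra.Module"
begin

section \<open>Algebras over a field\<close>

text \<open>The ground field is a type \<open>'k\<close> of class field; \<open>ground\<close> is the same field as a record.\<close>

abbreviation ground :: "'k::field ring"
  where "ground \<equiv> ring_of_type_algebra"

text \<open>The library locale \<^locale>\<open>algebra\<close> requires commutativity, hence the following variant.\<close>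

locale assoc_algebra = module + ring M +
  assumes smult_mult_left:
      "\<lbrakk>a \<in> carrier R; x \<in> carrier M; y \<in> carrier M\<rbrakk> \<Longrightarrow>
        (a \<odot>\<^bsub>M\<^esub> x) \<otimes>\<^bsub>M\<^esub> y = a \<odot>\<^bsub>M\<^esub> (x \<otimes>\<^bsub>M\<^esub> y)"
    and smult_mult_right:
      "\<lbrakk>a \<in> carrier R; x \<in> carrier M; y \<in> carrier M\<rbrakk> \<Longrightarrow>
        x \<otimes>\<^bsub>M\<^esub> (a \<odot>\<^bsub>M\<^esub> y) = a \<odot>\<^bsub>M\<^esub> (x \<otimes>\<^bsub>M\<^esub> y)"

definition linear_maps ::
  "('k::field, 'v, 'm) module_scheme \<Rightarrow> ('k, 'w, 'n) module_scheme \<Rightarrow> ('v \<Rightarrow> 'w) set"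
  where "linear_maps V W =
    {f. f \<in> carrier V \<rightarrow> carrier W \<and>
        (\<forall>x\<in>carrier V. \<forall>y\<in>carrier V. f (x \<oplus>\<^bsub>V\<^esub> y) = f x \<oplus>\<^bsub>W\<^esub> f y) \<and>
        (\<forall>c. \<forall>x\<in>carrier V. f (c \<odot>\<^bsub>V\<^esub> x) = c \<odot>\<^bsub>W\<^esub> f x)}"

definition lin_span :: "('k::field, 'v, 'm) module_scheme \<Rightarrow> 'v set \<Rightarrow> 'v set"
  where "lin_span V S = (\<lambda>U. submodule U ground V) hull S"

text \<open>The quotient by \<open>I\<close>, with the scalar multiplication that \<^const>\<open>FactRing\<close> forgets.\<close>

definition quotient_algebra ::
  "('k::field, 'a, 'm) module_scheme \<Rightarrow> 'a set \<Rightarrow> ('k, 'a set) module"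
  where "quotient_algebra A I =
    \<lparr>carrier = carrier (A Quot I), monoid.mult = monoid.mult (A Quot I), one = \<one>\<^bsub>A Quot I\<^esub>,
     zero = \<zero>\<^bsub>A Quot I\<^esub>, add = add (A Quot I),
     module.smult = (\<lambda>c C. \<Union>x\<in>C. I +>\<^bsub>A\<^esub> (c \<odot>\<^bsub>A\<^esub> x))\<rparr>"


section \<open>Monoid algebras, free algebras, presentations\<close>

text \<open>Elements of the monoid algebra are the finitely supported functions on the monoid.\<close>

definition monoid_algebra :: "('m, 'x) monoid_scheme \<Rightarrow> ('k::field, 'm \<Rightarrow> 'k) module"
  where "monoid_algebra M =
    \<lparr>carrier = {f. finite {m. f m \<noteq> 0} \<and> {m. f m \<noteq> 0} \<subseteq> carrier M},
     monoid.mult = (\<lambda>f g m. \<Sum>a | f a \<noteq> 0. \<Sum>b | g b \<noteq> 0 \<and> a \<otimes>\<^bsub>M\<^esub> b = m. f a * g b),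
     one = (\<lambda>m. if m = \<one>\<^bsub>M\<^esub> then 1 else 0),
     zero = (\<lambda>m. 0),
     add = (\<lambda>f g m. f m + g m),
     module.smult = (\<lambda>c f m. c * f m)\<rparr>"

definition basis_vec :: "'m \<Rightarrow> 'm \<Rightarrow> 'k::field"
  where "basis_vec m = (\<lambda>m'. if m' = m then 1 else 0)"

definition free_algebra :: "'x set \<Rightarrow> ('k::field, 'x list \<Rightarrow> 'k) module"
  where "free_algebra S = monoid_algebra \<lparr>carrier = lists S, monoid.mult = (@), one = []\<rparr>"

definition presented_algebra ::
  "'x set \<Rightarrow> ('x list \<Rightarrow> 'k::field) set \<Rightarrow> ('k, ('x list \<Rightarrow> 'k) set) module"
  where "presented_algebra S R = quotient_algebra (free_algebra S) (Idl\<^bsub>free_algebra S\<^esub> R)"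

definition presented_gen :: "'x set \<Rightarrow> ('x list \<Rightarrow> 'k::field) set \<Rightarrow> 'x \<Rightarrow> ('x list \<Rightarrow> 'k) set"
  where "presented_gen S R x =
    (Idl\<^bsub>free_algebra S\<^esub> R) +>\<^bsub>free_algebra S\<^esub> basis_vec [x]"


section \<open>Tensor products\<close>

text \<open>\<open>V \<otimes> W\<close> is the vector space with basis \<open>carrier V \<times> carrier W\<close> modulo the span of the
  bilinearity relations.  Taking the basis as the monoid \<open>V \<times>\<times> W\<close> also provides the product
  \<open>(a \<otimes> b)(c \<otimes> d) = ac \<otimes> bd\<close>, since this span is an ideal of the monoid algebra.\<close>

definition tensor_relations ::
  "('k::field, 'v, 'm) module_scheme \<Rightarrow> ('k, 'w, 'n) module_scheme \<Rightarrow> ('v \<times> 'w \<Rightarrow> 'k) set"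
  where "tensor_relations V W =
    (let F = monoid_algebra (V \<times>\<times> W) in
      {basis_vec (v \<oplus>\<^bsub>V\<^esub> v', w) \<ominus>\<^bsub>F\<^esub> (basis_vec (v, w) \<oplus>\<^bsub>F\<^esub> basis_vec (v', w)) | v v' w.
        v \<in> carrier V \<and> v' \<in> carrier V \<and> w \<in> carrier W} \<union>
      {basis_vec (v, w \<oplus>\<^bsub>W\<^esub> w') \<ominus>\<^bsub>F\<^esub> (basis_vec (v, w) \<oplus>\<^bsub>F\<^esub> basis_vec (v, w')) | v w w'.
        v \<in> carrier V \<and> w \<in> carrier W \<and> w' \<in> carrier W} \<union>
      {basis_vec (c \<odot>\<^bsub>V\<^esub> v, w) \<ominus>\<^bsub>F\<^esub> c \<odot>\<^bsub>F\<^esub> basis_vec (v, w) | c v w.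
        v \<in> carrier V \<and> w \<in> carrier W} \<union>
      {basis_vec (v, c \<odot>\<^bsub>W\<^esub> w) \<ominus>\<^bsub>F\<^esub> c \<odot>\<^bsub>F\<^esub> basis_vec (v, w) | c v w.
        v \<in> carrier V \<and> w \<in> carrier W})"

definition tensor_null ::
  "('k::field, 'v, 'm) module_scheme \<Rightarrow> ('k, 'w, 'n) module_scheme \<Rightarrow> ('v \<times> 'w \<Rightarrow> 'k) set"
  where "tensor_null V W = lin_span (monoid_algebra (V \<times>\<times> W)) (tensor_relations V W)"

definition tensor_product ::
  "('k::field, 'v, 'm) module_scheme \<Rightarrow> ('k, 'w, 'n) module_scheme \<Rightarrow>
    ('k, ('v \<times> 'w \<Rightarrow> 'k) set) module"
  where "tensor_product V W = quotient_algebra (monoid_algebra (V \<times>\<times> W)) (tensor_null V W)"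

definition tensor ::
  "('k::field, 'v, 'm) module_scheme \<Rightarrow> ('k, 'w, 'n) module_scheme \<Rightarrow>
    'v \<Rightarrow> 'w \<Rightarrow> ('v \<times> 'w \<Rightarrow> 'k) set"
  where "tensor V W v w = tensor_null V W +>\<^bsub>monoid_algebra (V \<times>\<times> W)\<^esub> basis_vec (v, w)"

text \<open>The linear map \<open>V \<otimes> W \<rightarrow> U\<close>, \<open>v \<otimes> w \<mapsto> \<beta> v w\<close>, induced by a bilinear map \<open>\<beta>\<close>;
  for bilinear \<open>\<beta>\<close> the result does not depend on the chosen representative of the coset.\<close>

definition tensor_lift ::
  "('k::field, 'u, 'm) module_scheme \<Rightarrow> ('v \<Rightarrow> 'w \<Rightarrow> 'u) \<Rightarrow> ('v \<times> 'w \<Rightarrow> 'k) set \<Rightarrow> 'u"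
  where "tensor_lift U \<beta> T =
    (let f = SOME f. f \<in> T
     in \<Oplus>\<^bsub>U\<^esub>z\<in>{z. f z \<noteq> 0}. f z \<odot>\<^bsub>U\<^esub> \<beta> (fst z) (snd z))"


section \<open>Hopf algebras and their actions\<close>

record ('k, 'h) hopf = "('k, 'h) module" +
  comult :: "'h \<Rightarrow> ('h \<times> 'h \<Rightarrow> 'k) set"
  counit :: "'h \<Rightarrow> 'k"
  antipode :: "'h \<Rightarrow> 'h"

text \<open>Coassociativity is stated in \<open>H \<otimes> (H \<otimes> H)\<close>: its left-hand side is \<open>(\<Delta> \<otimes> id) \<circ> \<Delta>\<close>
  followed by the identification \<open>(H \<otimes> H) \<otimes> H \<cong> H \<otimes> (H \<otimes> H)\<close>.\<close>

locale hopf_algebra = assoc_algebra ground H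
  for H :: "('k::field, 'h) hopf" (structure) +
  assumes comult_ring_hom: "comult H \<in> ring_hom H (tensor_product H H)"
    and comult_linear: "comult H \<in> linear_maps H (tensor_product H H)"
    and counit_ring_hom: "counit H \<in> ring_hom H ground"
    and counit_smult: "h \<in> carrier H \<Longrightarrow> counit H (c \<odot> h) = c * counit H h"
    and coassoc: "h \<in> carrier H \<Longrightarrow>
      tensor_lift (tensor_product H (tensor_product H H))
        (\<lambda>x c. tensor_lift (tensor_product H (tensor_product H H))
          (\<lambda>a b. tensor H (tensor_product H H) a (tensor H H b c)) (comult H x)) (comult H h)
      = tensor_lift (tensor_product H (tensor_product H H))
        (\<lambda>a x. tensor H (tensor_product H H) a (comult H x)) (comult H h)"
    and counit_left: "h \<in> carrier H \<Longrightarrow>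
      tensor_lift H (\<lambda>a b. counit H a \<odot> b) (comult H h) = h"
    and counit_right: "h \<in> carrier H \<Longrightarrow>
      tensor_lift H (\<lambda>a b. counit H b \<odot> a) (comult H h) = h"
    and antipode_linear: "antipode H \<in> linear_maps H H"
    and antipode_left: "h \<in> carrier H \<Longrightarrow>
      tensor_lift H (\<lambda>a b. antipode H a \<otimes> b) (comult H h) = counit H h \<odot> \<one>"
    and antipode_right: "h \<in> carrier H \<Longrightarrow>
      tensor_lift H (\<lambda>a b. a \<otimes> antipode H b) (comult H h) = counit H h \<odot> \<one>"

definition grouplike :: "('k::field, 'h) hopf \<Rightarrow> 'h \<Rightarrow> bool"
  where "grouplike H h \<longleftrightarrow> h \<in> carrier H \<and> comult H h = tensor H H h h \<and> counit H h = 1"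

definition hopf_ideal :: "'h set \<Rightarrow> ('k::field, 'h) hopf \<Rightarrow> bool"
  where "hopf_ideal I H \<longleftrightarrow>
    ideal I H \<and>
    comult H ` I \<subseteq>
      lin_span (tensor_product H H) {tensor H H a b | a b. a \<in> I \<and> b \<in> carrier H}
      <+>\<^bsub>tensor_product H H\<^esub>
      lin_span (tensor_product H H) {tensor H H a b | a b. a \<in> carrier H \<and> b \<in> I} \<and>
    (\<forall>h\<in>I. counit H h = 0) \<and>
    antipode H ` I \<subseteq> I"

definition module_algebra ::
  "('k::field, 'h) hopf \<Rightarrow> ('k, 'a, 'm) module_scheme \<Rightarrow> ('h \<Rightarrow> 'a \<Rightarrow> 'a) \<Rightarrow> bool"
  where "module_algebra H A act \<longleftrightarrow>
    (\<forall>h\<in>carrier H. act h \<in> linear_maps A A) \<and>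
    (\<forall>a\<in>carrier A. (\<lambda>h. act h a) \<in> linear_maps H A) \<and>
    (\<forall>a\<in>carrier A. act \<one>\<^bsub>H\<^esub> a = a) \<and>
    (\<forall>h\<in>carrier H. \<forall>h'\<in>carrier H. \<forall>a\<in>carrier A. act (h \<otimes>\<^bsub>H\<^esub> h') a = act h (act h' a)) \<and>
    (\<forall>h\<in>carrier H. act h \<one>\<^bsub>A\<^esub> = counit H h \<odot>\<^bsub>A\<^esub> \<one>\<^bsub>A\<^esub>) \<and>
    (\<forall>h\<in>carrier H. \<forall>a\<in>carrier A. \<forall>b\<in>carrier A.
      act h (a \<otimes>\<^bsub>A\<^esub> b) = tensor_lift A (\<lambda>h1 h2. act h1 a \<otimes>\<^bsub>A\<^esub> act h2 b) (comult H h))"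

definition inner_faithful ::
  "('k::field, 'h) hopf \<Rightarrow> ('k, 'a, 'm) module_scheme \<Rightarrow> ('h \<Rightarrow> 'a \<Rightarrow> 'a) \<Rightarrow> bool"
  where "inner_faithful H A act \<longleftrightarrow>
    \<not> (\<exists>I. hopf_ideal I H \<and> I \<noteq> {\<zero>\<^bsub>H\<^esub>} \<and> (\<forall>h\<in>I. \<forall>a\<in>carrier A. act h a = \<zero>\<^bsub>A\<^esub>))"


section \<open>Quantum affine spaces\<close>

text \<open>As for the library's group order, the value is \<open>0\<close> for elements of infinite order.\<close>

definition mult_ord :: "'k::field \<Rightarrow> nat"
  where "mult_ord q = group.ord (units_of ground) q"

definition quantum_params :: "nat \<Rightarrow> (nat \<Rightarrow> nat \<Rightarrow> 'k::field) \<Rightarrow> bool"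
  where "quantum_params t p \<longleftrightarrow>
    (\<forall>i<t. \<forall>j<t. p i j \<noteq> 0 \<and> p i j = inverse (p j i)) \<and> (\<forall>i<t. p i i = 1)"

text \<open>The generators \<open>u\<^sub>1, \<dots>, u\<^sub>t\<close> are indexed by \<open>{..<t}\<close>.\<close>

definition qas_relations :: "nat \<Rightarrow> (nat \<Rightarrow> nat \<Rightarrow> 'k::field) \<Rightarrow> (nat list \<Rightarrow> 'k) set"
  where "qas_relations t p =
    (let F = free_algebra {..<t} in
      {basis_vec [i, j] \<ominus>\<^bsub>F\<^esub> p i j \<odot>\<^bsub>F\<^esub> basis_vec [j, i] | i j. i < t \<and> j < t})"

definition quantum_affine_space ::
  "nat \<Rightarrow> (nat \<Rightarrow> nat \<Rightarrow> 'k::field) \<Rightarrow> ('k, (nat list \<Rightarrow> 'k) set) module"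
  where "quantum_affine_space t p = presented_algebra {..<t} (qas_relations t p)"

definition qas_gen :: "nat \<Rightarrow> (nat \<Rightarrow> nat \<Rightarrow> 'k::field) \<Rightarrow> nat \<Rightarrow> (nat list \<Rightarrow> 'k) set"
  where "qas_gen t p = presented_gen {..<t} (qas_relations t p)"

definition qas_degree_one :: "nat \<Rightarrow> (nat \<Rightarrow> nat \<Rightarrow> 'k::field) \<Rightarrow> (nat list \<Rightarrow> 'k) set set"
  where "qas_degree_one t p = lin_span (quantum_affine_space t p) (qas_gen t p ` {..<t})"


section \<open>Bosonizations of quantum linear spaces\<close>

text \<open>Here \<open>g\<close> and \<open>\<chi>\<close> are only relevant on the index set \<open>{..<\<theta>}\<close>.\<close>

definition qls_order :: "(nat \<Rightarrow> 'g) \<Rightarrow> (nat \<Rightarrow> 'g \<Rightarrow> 'k::field) \<Rightarrow> nat \<Rightarrow> nat"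
  where "qls_order g \<chi> i = mult_ord (\<chi> i (g i))"

definition qls_datum ::
  "('g, 'x) monoid_scheme \<Rightarrow> nat \<Rightarrow> (nat \<Rightarrow> 'g) \<Rightarrow> (nat \<Rightarrow> 'g \<Rightarrow> 'k::field) \<Rightarrow> bool"
  where "qls_datum G \<theta> g \<chi> \<longleftrightarrow>
    comm_group G \<and> finite (carrier G) \<and>
    (\<forall>i<\<theta>. g i \<in> carrier G) \<and>
    (\<forall>i<\<theta>. \<chi> i \<in> hom G (units_of ground)) \<and>
    (\<forall>i<\<theta>. \<forall>j<\<theta>. i \<noteq> j \<longrightarrow> \<chi> i (g j) = inverse (\<chi> j (g i))) \<and>
    (\<forall>i<\<theta>. qls_order g \<chi> i \<ge> 2)"

datatype 'g bos_symbol = Grp 'g | Skew nat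

definition bos_symbols :: "('g, 'x) monoid_scheme \<Rightarrow> nat \<Rightarrow> 'g bos_symbol set"
  where "bos_symbols G \<theta> = Grp ` carrier G \<union> Skew ` {..<\<theta>}"

definition bos_relations ::
  "('g, 'x) monoid_scheme \<Rightarrow> nat \<Rightarrow> (nat \<Rightarrow> 'g) \<Rightarrow> (nat \<Rightarrow> 'g \<Rightarrow> 'k::field) \<Rightarrow>
    ('g bos_symbol list \<Rightarrow> 'k) set"
  where "bos_relations G \<theta> g \<chi> =
    (let F = free_algebra (bos_symbols G \<theta>) in
      {basis_vec [Grp h, Grp h'] \<ominus>\<^bsub>F\<^esub> basis_vec [Grp (h \<otimes>\<^bsub>G\<^esub> h')] | h h'.
        h \<in> carrier G \<and> h' \<in> carrier G} \<union>
      {basis_vec [Grp \<one>\<^bsub>G\<^esub>] \<ominus>\<^bsub>F\<^esub> \<one>\<^bsub>F\<^esub>} \<union>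
      {basis_vec (replicate (qls_order g \<chi> i) (Skew i)) | i. i < \<theta>} \<union>
      {basis_vec [Skew i, Skew j] \<ominus>\<^bsub>F\<^esub> \<chi> j (g i) \<odot>\<^bsub>F\<^esub> basis_vec [Skew j, Skew i] | i j.
        i < \<theta> \<and> j < \<theta> \<and> i \<noteq> j} \<union>
      {basis_vec [Grp h, Skew i] \<ominus>\<^bsub>F\<^esub> \<chi> i h \<odot>\<^bsub>F\<^esub> basis_vec [Skew i, Grp h] | h i.
        h \<in> carrier G \<and> i < \<theta>})"

definition bos_gen ::
  "('g, 'x) monoid_scheme \<Rightarrow> nat \<Rightarrow> (nat \<Rightarrow> 'g) \<Rightarrow> (nat \<Rightarrow> 'g \<Rightarrow> 'k::field) \<Rightarrow>
    'g bos_symbol \<Rightarrow> ('g bos_symbol list \<Rightarrow> 'k) set"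
  where "bos_gen G \<theta> g \<chi> = presented_gen (bos_symbols G \<theta>) (bos_relations G \<theta> g \<chi>)"

text \<open>\<open>B\<close> is the algebra with the given presentation, equipped with the Hopf algebra structure that
  is determined by the comultiplication of the generators; the counit and the antipode are unique.\<close>

definition is_bosonization ::
  "('g, 'x) monoid_scheme \<Rightarrow> nat \<Rightarrow> (nat \<Rightarrow> 'g) \<Rightarrow> (nat \<Rightarrow> 'g \<Rightarrow> 'k::field) \<Rightarrow>
    ('k, ('g bos_symbol list \<Rightarrow> 'k) set) hopf \<Rightarrow> bool"
  where "is_bosonization G \<theta> g \<chi> B \<longleftrightarrow>
    module.truncate B = presented_algebra (bos_symbols G \<theta>) (bos_relations G \<theta> g \<chi>) \<and>
    hopf_algebra B \<and>
    (\<forall>h\<in>carrier G. grouplike B (bos_gen G \<theta> g \<chi> (Grp h))) \<and>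
    (\<forall>i<\<theta>. comult B (bos_gen G \<theta> g \<chi> (Skew i)) =
      tensor B B (bos_gen G \<theta> g \<chi> (Grp (g i))) (bos_gen G \<theta> g \<chi> (Skew i))
      \<oplus>\<^bsub>tensor_product B B\<^esub>
      tensor B B (bos_gen G \<theta> g \<chi> (Skew i)) \<one>\<^bsub>B\<^esub>)"

definition linear_action ::
  "('g, 'x) monoid_scheme \<Rightarrow> nat \<Rightarrow> (nat \<Rightarrow> 'g) \<Rightarrow> (nat \<Rightarrow> 'g \<Rightarrow> 'k::field) \<Rightarrow>
    nat \<Rightarrow> (nat \<Rightarrow> nat \<Rightarrow> 'k) \<Rightarrow>
    (('g bos_symbol list \<Rightarrow> 'k) set \<Rightarrow> (nat list \<Rightarrow> 'k) set \<Rightarrow> (nat list \<Rightarrow> 'k) set) \<Rightarrow> bool"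
  where "linear_action G \<theta> g \<chi> t p act \<longleftrightarrow>
    (\<forall>i<\<theta>. act (bos_gen G \<theta> g \<chi> (Grp (g i))) ` qas_degree_one t p \<subseteq> qas_degree_one t p \<and>
           act (bos_gen G \<theta> g \<chi> (Skew i)) ` qas_degree_one t p \<subseteq> qas_degree_one t p)"

end

theory Submission
  imports Defs
begin

text \<open>A linear action is governed by matrices.  Let \<open>\<Gamma>\<^sub>r\<close> and \<open>\<Xi>\<^sub>r\<close> be the matrices of \<open>g\<^sub>r\<close> and
  \<open>x\<^sub>r\<close> on the span of the generators \<open>u\<^sub>i\<close>, and let \<open>\<lambda>\<^sub>r = \<chi>\<^sub>r(g\<^sub>r)\<close>.  Applying \<open>g\<^sub>r\<close>, which acts by an
  automorphism, and \<open>x\<^sub>r\<close>, which acts by a skew derivation, to \<open>u\<^sub>i u\<^sub>j = p\<^sub>i\<^sub>j u\<^sub>j u\<^sub>i\<close> and comparing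
  coefficients of the monomials \<open>u\<^sub>m u\<^sub>n\<close> gives equations for these matrices (\<open>linear_skew_derivation\<close>);
  the commutation relations of \<open>B\<close> give further ones.

  Inner faithfulness enters through \<open>\<Xi>\<^sub>r \<noteq> 0\<close> (\<open>Skew_nonzero_on_generators\<close>).  If \<open>x\<^sub>r\<close> kills every
  \<open>u\<^sub>i\<close>, then it kills \<open>A\<close>, and so does the ideal that it generates; but this ideal is a nonzero Hopf ideal
  (\<open>skew_ideal_hopf_ideal\<close>, \<open>skew_ideal_nonzero\<close>).

  Since \<open>p\<^sub>i\<^sub>j \<noteq> 1\<close>, the matrix \<open>\<Gamma>\<^sub>r\<close> is a permutation matrix up to scalars, and the permutation swaps no
  two indices because \<open>p\<^sub>i\<^sub>j\<^sup>2 \<noteq> 1\<close>.  If it moved anything, the equations would force \<open>\<Xi>\<^sub>r = 0\<close>; so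
  \<open>\<Gamma>\<^sub>r\<close> is diagonal (\<open>diagonal\<close>), say with entries \<open>\<gamma>\<^sub>i\<close>.  Now an entry of \<open>\<Xi>\<^sub>r\<close> in row \<open>k\<close> and column
  \<open>j\<close> can only be nonzero if \<open>k \<noteq> j\<close>, \<open>\<gamma>\<^sub>k = p\<^sub>k\<^sub>j = \<lambda>\<^sub>r \<gamma>\<^sub>j\<close> and \<open>\<gamma>\<^sub>i = p\<^sub>i\<^sub>j p\<^sub>k\<^sub>i\<close> for
  the other \<open>i\<close> (\<open>edge\<close>).  It follows that \<open>x\<^sub>r u\<^sub>j\<close> is a multiple of one generator, and that
  \<open>\<lambda>\<^sub>r \<lambda>\<^sub>s = 1\<close> whenever \<open>x\<^sub>r u\<^sub>j\<close> and \<open>x\<^sub>s u\<^sub>j\<close> are both nonzero for some \<open>r \<noteq> s\<close>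
  (\<open>common_source\<close>).  As \<open>\<lambda>\<^sub>r\<^sup>2 \<noteq> 1\<close>, at most two of the \<open>x\<^sub>r\<close> are nonzero on a given \<open>u\<^sub>j\<close>.

  Counting pairs \<open>(r, j)\<close> with \<open>x\<^sub>r u\<^sub>j \<noteq> 0\<close> finishes the proof (\<open>rank_bound\<close>).  If some \<open>u\<^sub>j\<close> is killed by
  all \<open>x\<^sub>r\<close>, there are at least \<open>\<theta>\<close> and at most \<open>2(t - 1)\<close> such pairs.  Otherwise every \<open>x\<^sub>r\<close> is nonzero on
  at least two generators: if it were nonzero on \<open>u\<^sub>j\<close> only, with values in the line of \<open>u\<^sub>k\<close>, choose \<open>s\<close> with
  \<open>x\<^sub>s u\<^sub>k \<noteq> 0\<close>; then \<open>x\<^sub>s x\<^sub>r u\<^sub>j \<noteq> 0\<close>, whereas \<open>x\<^sub>r x\<^sub>s u\<^sub>j = 0\<close> because \<open>x\<^sub>s u\<^sub>j\<close> has no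
  component along \<open>u\<^sub>j\<close>.  Hence \<open>2\<theta> \<le> 2t\<close>, and \<open>t \<le> 2(t - 1)\<close>.\<close>

section \<open>Skew derivations in coordinates\<close>

text \<open>The coefficient of \<open>u\<^sub>m u\<^sub>n\<close> in the product of the linear forms with coefficients \<open>a\<close> and \<open>b\<close>, where
  \<open>u\<^sub>n u\<^sub>m\<close> has been rewritten as \<open>p\<^sub>n\<^sub>m u\<^sub>m u\<^sub>n\<close>.\<close>

definition quad_coeff :: "(nat \<Rightarrow> nat \<Rightarrow> 'k::field) \<Rightarrow> nat \<Rightarrow> nat \<Rightarrow> (nat \<Rightarrow> 'k) \<Rightarrow> (nat \<Rightarrow> 'k) \<Rightarrow> 'k"
  where "quad_coeff p m n a b =
    (if m = n then a m * b m else a m * b n + p n m * a n * b m)"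

locale quantum_parameters =
  fixes t :: nat and p :: "nat \<Rightarrow> nat \<Rightarrow> 'k::field"
  assumes p_inverse: "\<lbrakk>i < t; j < t\<rbrakk> \<Longrightarrow> p i j * p j i = 1"
    and p_diag: "i < t \<Longrightarrow> p i i = 1"
    and p_square: "\<lbrakk>i < t; j < t; i \<noteq> j\<rbrakk> \<Longrightarrow> p i j * p i j \<noteq> 1"
begin

lemma p_neq_1: "\<lbrakk>i < t; j < t; i \<noteq> j\<rbrakk> \<Longrightarrow> p i j \<noteq> 1"
  using p_square by fastforce

lemma p_nonzero: "\<lbrakk>i < t; j < t\<rbrakk> \<Longrightarrow> p i j \<noteq> 0"
  using p_inverse by fastforce

text \<open>The coefficient of \<open>u\<^sub>k\<^sup>2\<close> in the relation between the images of \<open>u\<^sub>i\<close> and \<open>u\<^sub>j\<close> says that a row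
  has at most one nonzero entry; with nonzero columns this leaves a permutation.  An automorphism preserves
  the parameters, so one that swaps \<open>i\<close> and \<open>j\<close> would give \<open>p\<^sub>i\<^sub>j = p\<^sub>j\<^sub>i\<close>.\<close>

lemma monomial_matrix:
  assumes quad: "\<And>i j m n. \<lbrakk>i < t; j < t; m < t; n < t\<rbrakk> \<Longrightarrow>
      quad_coeff p m n (\<lambda>k. \<Gamma> k i) (\<lambda>k. \<Gamma> k j) = p i j * quad_coeff p m n (\<lambda>k. \<Gamma> k j) (\<lambda>k. \<Gamma> k i)"
    and column: "\<And>i. i < t \<Longrightarrow> \<exists>k<t. \<Gamma> k i \<noteq> 0"
  obtains \<sigma> c where "bij_betw \<sigma> {..<t} {..<t}"
    and "\<And>i. i < t \<Longrightarrow> c i \<noteq> 0"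
    and "\<And>i k. \<lbrakk>i < t; k < t\<rbrakk> \<Longrightarrow> \<Gamma> k i = (if k = \<sigma> i then c i else 0)"
    and "\<And>i. i < t \<Longrightarrow> \<sigma> (\<sigma> i) = i \<Longrightarrow> \<sigma> i = i"
proof -
  have row: "i = j" if "i < t" "j < t" "k < t" "\<Gamma> k i \<noteq> 0" "\<Gamma> k j \<noteq> 0" for i j k
  proof (rule ccontr)
    assume "i \<noteq> j"
    have "\<Gamma> k i * \<Gamma> k j = p i j * (\<Gamma> k i * \<Gamma> k j)"
      using quad[of i j k k] that by (simp add: quad_coeff_def mult.commute)
    then show False
      using p_neq_1[of i j] that \<open>i \<noteq> j\<close> by simp
  qed
  obtain \<sigma> where \<sigma>: "\<And>i. i < t \<Longrightarrow> \<sigma> i < t \<and> \<Gamma> (\<sigma> i) i \<noteq> 0"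
    using column by metis
  have inj: "inj_on \<sigma> {..<t}"
    using row \<sigma> by (auto simp: inj_on_def) metis
  have "\<sigma> ` {..<t} \<subseteq> {..<t}"
    using \<sigma> by auto
  then have bij: "bij_betw \<sigma> {..<t} {..<t}"
    using inj by (simp add: bij_betw_def endo_inj_surj)
  have onto: "\<exists>i<t. \<sigma> i = k" if "k < t" for k
  proof -
    have "k \<in> \<sigma> ` {..<t}" using bij that by (simp add: bij_betw_def)
    then show ?thesis by auto
  qed
  have entry: "\<Gamma> k i = (if k = \<sigma> i then \<Gamma> (\<sigma> i) i else 0)" if "i < t" "k < t" for i k
  proof (cases "k = \<sigma> i")
    case False
    obtain j where j: "j < t" "\<sigma> j = k"
      using onto[OF \<open>k < t\<close>] by metis
    then have "\<Gamma> k j \<noteq> 0" using \<sigma>[of j] by simp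
    moreover have "i \<noteq> j" using False j by blast
    ultimately have "\<Gamma> k i = 0"
      using row[of i j k] j(1) that by blast
    with False show ?thesis by simp
  qed simp
  have no_swap: "\<sigma> i = i" if i: "i < t" "\<sigma> (\<sigma> i) = i" for i
  proof (rule ccontr)
    assume ne: "\<sigma> i \<noteq> i"
    define j where "j = \<sigma> i"
    have j: "j < t" "j \<noteq> i" "\<sigma> j = i" using \<sigma> i ne by (auto simp: j_def)
    have e: "\<Gamma> j j = 0" "\<Gamma> i i = 0" "\<Gamma> j i \<noteq> 0" "\<Gamma> i j \<noteq> 0"
      using entry[of j j] entry[of i i] \<sigma>[of i] \<sigma>[of j] j i ne by (auto simp: j_def)
    have "p i j * p i j * (\<Gamma> i j * \<Gamma> j i) = \<Gamma> i j * \<Gamma> j i"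
    proof -
      have "p i j * p j i = 1" using p_inverse i j by blast
      have "p j i * (\<Gamma> j i * \<Gamma> i j) = p i j * (\<Gamma> i j * \<Gamma> j i)"
        using quad[of i j i j] i j e by (simp add: quad_coeff_def mult.assoc)
      then have "(p i j * p j i) * (\<Gamma> j i * \<Gamma> i j) = p i j * p i j * (\<Gamma> i j * \<Gamma> j i)"
        by (simp add: mult.assoc)
      then show ?thesis
        using \<open>p i j * p j i = 1\<close> by (simp add: mult.commute)
    qed
    then show False using p_square[of i j] i j e by auto
  qed
  show ?thesis
  proof (rule that[of \<sigma> "\<lambda>i. \<Gamma> (\<sigma> i) i", OF bij])
    show "\<Gamma> (\<sigma> i) i \<noteq> 0" if "i < t" for i using \<sigma>[OF that] by simp
  qed (fact entry no_swap)+
qed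

end

lemma diagonal_twist:
  fixes M Z :: "nat \<Rightarrow> nat \<Rightarrow> 'k::field"
  assumes diag: "\<And>i k. \<lbrakk>i < t; k < t\<rbrakk> \<Longrightarrow> M k i \<noteq> 0 \<longleftrightarrow> k = i"
    and comm: "\<And>i m. \<lbrakk>i < t; m < t\<rbrakk> \<Longrightarrow> (\<Sum>k<t. M m k * Z k i) = c * (\<Sum>k<t. Z m k * M k i)"
    and i: "i < t" and m: "m < t"
  shows "M m m * Z m i = c * Z m i * M i i"
proof -
  have "(\<Sum>k<t. M m k * Z k i) = (\<Sum>k<t. if k = m then M m m * Z m i else 0)"
    by (rule sum.cong) (use diag m in auto)
  moreover have "(\<Sum>k<t. Z m k * M k i) = (\<Sum>k<t. if k = i then Z m i * M i i else 0)"
    by (rule sum.cong) (use diag i in auto)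
  ultimately have "M m m * Z m i = c * (Z m i * M i i)"
    using comm[OF i m] i m by (simp only: sum.delta finite_lessThan lessThan_iff if_True)
  then show ?thesis by (simp only: mult.assoc)
qed

text \<open>The matrices of a grouplike \<open>g\<close> and of a skew-primitive \<open>x\<close> with \<open>\<Delta>(x) = g \<otimes> x + x \<otimes> 1\<close>
  and \<open>g x = lam x g\<close>; column \<open>i\<close> holds the coefficients of the image of \<open>u\<^sub>i\<close>.\<close>

locale linear_skew_derivation = quantum_parameters t p
  for t :: nat and p :: "nat \<Rightarrow> nat \<Rightarrow> 'k::field" +
  fixes \<Gamma> \<Xi> :: "nat \<Rightarrow> nat \<Rightarrow> 'k" and lam :: 'k
  assumes automorphism: "\<lbrakk>i < t; j < t; m < t; n < t\<rbrakk> \<Longrightarrow>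
      quad_coeff p m n (\<lambda>k. \<Gamma> k i) (\<lambda>k. \<Gamma> k j) = p i j * quad_coeff p m n (\<lambda>k. \<Gamma> k j) (\<lambda>k. \<Gamma> k i)"
    and column: "i < t \<Longrightarrow> \<exists>k<t. \<Gamma> k i \<noteq> 0"
    and derivation: "\<lbrakk>i < t; j < t; m < t; n < t\<rbrakk> \<Longrightarrow>
      quad_coeff p m n (\<lambda>k. \<Gamma> k i) (\<lambda>k. \<Xi> k j) + quad_coeff p m n (\<lambda>k. \<Xi> k i) (\<lambda>k. of_bool (k = j))
      = p i j * (quad_coeff p m n (\<lambda>k. \<Gamma> k j) (\<lambda>k. \<Xi> k i)
               + quad_coeff p m n (\<lambda>k. \<Xi> k j) (\<lambda>k. of_bool (k = i)))"
    and twist: "\<lbrakk>i < t; m < t\<rbrakk> \<Longrightarrow> (\<Sum>k<t. \<Gamma> m k * \<Xi> k i) = lam * (\<Sum>k<t. \<Xi> m k * \<Gamma> k i)"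
    and lam_neq_1: "lam \<noteq> 1"
    and nonzero: "\<exists>k<t. \<exists>j<t. \<Xi> k j \<noteq> 0"
begin

text \<open>Suppose that the permutation \<open>\<sigma>\<close> underlying \<open>\<Gamma>\<close> moves something.  For a moved \<open>i\<close>, comparing
  coefficients shows that row \<open>\<sigma> i\<close> of \<open>\<Xi>\<close> vanishes outside the columns \<open>i\<close> and \<open>\<sigma> i\<close>, and that
  \<open>\<Xi>\<^sub>i\<^sub>i\<close> and \<open>\<Xi>\<^sub>\<sigma>\<^sub>i\<^sub>,\<^sub>\<sigma>\<^sub>i\<close> agree.  Commuting with \<open>\<Gamma>\<close> multiplies one by \<open>lam\<close>, so both are zero, and
  then so are the remaining entries of the moved rows.  In a fixed row \<open>k\<close> the coefficient of
  \<open>u\<^sub>\<sigma>\<^sub>i u\<^sub>k\<close> for a suitable moved \<open>i\<close> involves a single entry outside the moved rows.  Here it matters that \<open>\<sigma>\<close> has no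
  cycles of length two.\<close>

lemma diagonal:
  assumes "i < t" "k < t"
  shows "\<Gamma> k i \<noteq> 0 \<longleftrightarrow> k = i"
proof -
  obtain \<sigma> c where bij: "bij_betw \<sigma> {..<t} {..<t}"
    and c: "\<And>i. i < t \<Longrightarrow> c i \<noteq> 0"
    and \<Gamma>: "\<And>i k. \<lbrakk>i < t; k < t\<rbrakk> \<Longrightarrow> \<Gamma> k i = (if k = \<sigma> i then c i else 0)"
    and no_swap: "\<And>i. i < t \<Longrightarrow> \<sigma> (\<sigma> i) = i \<Longrightarrow> \<sigma> i = i"
    using monomial_matrix[OF automorphism column] by blast
  have lt: "\<sigma> i < t" if "i < t" for i
    using bij that by (auto simp: bij_betw_def)
  have inj: "\<sigma> i = \<sigma> j \<longleftrightarrow> i = j" if "i < t" "j < t" for i j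
    using bij that by (auto simp: bij_betw_def inj_on_def)
  have onto: "\<exists>i<t. \<sigma> i = k" if "k < t" for k
  proof -
    have "k \<in> \<sigma> ` {..<t}" using bij that by (simp add: bij_betw_def)
    then show ?thesis by auto
  qed
  have fixed: "\<sigma> i = i" if "i < t" for i
  proof (rule ccontr)
    assume moved: "\<sigma> i \<noteq> i"
    have off: "\<Xi> (\<sigma> i) j = 0" if "i < t" "j < t" "\<sigma> i \<noteq> i" "j \<noteq> i" "j \<noteq> \<sigma> i" for i j
      using derivation[of i j "\<sigma> i" "\<sigma> i"] that lt[of i] c[of i] inj[of i j]
      by (simp add: quad_coeff_def \<Gamma>)
    have diag: "\<Xi> i i = 0" if i: "i < t" "\<sigma> i \<noteq> i" for i
    proof -
      define j where "j = \<sigma> i"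
      have j: "j < t" "j \<noteq> i" "\<sigma> j \<noteq> j" "\<sigma> j \<noteq> i"
        using lt i inj[of "\<sigma> i" i] no_swap[of i] by (auto simp: j_def)
      obtain i' where i': "i' < t" "\<sigma> i' = i"
        using onto[OF i(1)] by metis
      have "\<Xi> i j = 0"
        using off[of i' j] i' j i inj[of i' i] by (metis j_def)
      moreover have "p j i * (c i * \<Xi> i j) + \<Xi> i i = p i j * p j i * \<Xi> j j"
        using derivation[of i j i j] i j by (simp add: quad_coeff_def \<Gamma> j_def[symmetric] mult_ac)
      ultimately have eq: "\<Xi> i i = \<Xi> j j"
        using p_inverse i j by simp
      have "(\<Sum>k<t. \<Gamma> j k * \<Xi> k i) = c i * \<Xi> i i"
      proof -
        have "(\<Sum>k<t. \<Gamma> j k * \<Xi> k i) = (\<Sum>k<t. if k = i then c i * \<Xi> i i else 0)"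
          by (rule sum.cong) (use j i inj in \<open>auto simp: \<Gamma> j_def\<close>)
        then show ?thesis using i by simp
      qed
      moreover have "(\<Sum>k<t. \<Xi> j k * \<Gamma> k i) = \<Xi> j j * c i"
      proof -
        have "(\<Sum>k<t. \<Xi> j k * \<Gamma> k i) = (\<Sum>k<t. if k = j then \<Xi> j j * c i else 0)"
          by (rule sum.cong) (use j i in \<open>auto simp: \<Gamma> j_def\<close>)
        then show ?thesis using j by simp
      qed
      ultimately have "\<Xi> j j = lam * \<Xi> j j"
        using twist[of i j] i j c[of i] eq by simp
      then show ?thesis using lam_neq_1 eq by simp
    qed
    have step: "\<Xi> (\<sigma> i) i = 0" if i: "i < t" "\<sigma> i \<noteq> i" for i
    proof -
      define j where "j = \<sigma> i"
      have j: "j < t" "j \<noteq> i" "\<sigma> j \<noteq> j" "\<sigma> j \<noteq> i"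
        using lt i inj[of "\<sigma> i" i] no_swap[of i] by (auto simp: j_def)
      have "c i * \<Xi> j j + \<Xi> j i = 0"
        using derivation[of i j j j] i j by (simp add: quad_coeff_def \<Gamma> j_def[symmetric])
      then show ?thesis using diag[of j] j by (simp add: j_def)
    qed
    have moved_row: "\<Xi> k j = 0" if "k < t" "j < t" "\<sigma> k \<noteq> k" for k j
    proof -
      obtain i where i: "i < t" "\<sigma> i = k"
        using onto[OF \<open>k < t\<close>] by metis
      have "\<sigma> i \<noteq> i"
      proof
        assume "\<sigma> i = i"
        with i(2) have "k = i" by simp
        with that(3) \<open>\<sigma> i = i\<close> show False by simp
      qed
      consider "j = i" | "j = k" | "j \<noteq> i" "j \<noteq> k" by blast
      then show ?thesis
      proof cases
        case 1
        then show ?thesis using step[of i] i \<open>\<sigma> i \<noteq> i\<close> by simp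
      next
        case 2
        then show ?thesis using diag[of k] that by simp
      next
        case 3
        then show ?thesis using off[of i j] i that \<open>\<sigma> i \<noteq> i\<close> by simp
      qed
    qed
    have fixed_row_moved_col: "\<Xi> k j = 0" if "k < t" "j < t" "\<sigma> k = k" "\<sigma> j \<noteq> j" for k j
    proof -
      have lts: "\<sigma> j < t" "\<sigma> (\<sigma> j) < t" using that lt by auto
      have "\<sigma> (\<sigma> j) \<noteq> j" "k \<noteq> j" using that no_swap[of j] by auto
      moreover have "\<sigma> (\<sigma> j) \<noteq> \<sigma> j" using inj[of "\<sigma> j" j] that lts by simp
      moreover have "\<sigma> j \<noteq> k" using inj[of j k] that by auto
      moreover have "\<sigma> (\<sigma> j) \<noteq> k" using inj[of "\<sigma> j" k] that lts calculation by auto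
      moreover note lts
      ultimately show ?thesis

        using derivation[of "\<sigma> j" j "\<sigma> (\<sigma> j)" k] that c[of "\<sigma> j"]
        by (simp add: quad_coeff_def \<Gamma>)
    qed
    have fixed_row_fixed_col: "\<Xi> k j = 0" if "k < t" "j < t" "\<sigma> k = k" "\<sigma> j = j" for k j
    proof -
      have "\<sigma> i < t" "i \<noteq> k" "i \<noteq> j"
        using that \<open>i < t\<close> moved lt by auto
      moreover from this have "\<sigma> (\<sigma> i) \<noteq> \<sigma> i" "\<sigma> i \<noteq> k" "\<sigma> i \<noteq> j"
        using inj[of "\<sigma> i" i] inj[of i k] inj[of i j] that \<open>i < t\<close> moved by auto
      ultimately show ?thesis
        using derivation[of i j "\<sigma> i" k] that moved \<open>i < t\<close> c[of i] moved_row[of "\<sigma> i" i]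
        by (simp add: quad_coeff_def \<Gamma>)
    qed
    show False
      using nonzero moved_row fixed_row_moved_col fixed_row_fixed_col by metis
  qed
  show ?thesis
    using \<Gamma>[of i k] fixed[of i] c[of i] assms by auto
qed

lemma twist_entry:
  assumes "i < t" "m < t"
  shows "\<Gamma> m m * \<Xi> m i = lam * \<Xi> m i * \<Gamma> i i"
  using diagonal twist assms by (rule diagonal_twist)

text \<open>The relation between \<open>u\<^sub>k\<close> and \<open>u\<^sub>j\<close>, read off at \<open>u\<^sub>k\<^sup>2\<close>, and the relation between \<open>u\<^sub>i\<close> and
  \<open>u\<^sub>j\<close>, read off at \<open>u\<^sub>i u\<^sub>k\<close>, each involve no entry of \<open>\<Xi>\<close> other than \<open>\<Xi>\<^sub>k\<^sub>j\<close>.  So a nonzero entry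
  determines all eigenvalues of \<open>\<Gamma>\<close> except the one at \<open>j\<close>, which \<open>lam\<close> then fixes.\<close>

lemma edge:
  assumes "k < t" "j < t" "\<Xi> k j \<noteq> 0"
  shows "k \<noteq> j" "\<Gamma> k k = p k j" "\<Gamma> k k = lam * \<Gamma> j j"
    and "\<And>i. \<lbrakk>i < t; i \<noteq> j; i \<noteq> k\<rbrakk> \<Longrightarrow> \<Gamma> i i = p i j * p k i"
proof -
  show tw: "\<Gamma> k k = lam * \<Gamma> j j"
    using twist_entry[of j k] assms by simp
  show kj: "k \<noteq> j"
  proof
    assume "k = j"
    then have "\<Gamma> j j = lam * \<Gamma> j j" using tw by simp
    then show False using diagonal[of j j] assms lam_neq_1 by simp
  qed
  have zero: "\<Gamma> a b = 0" if "a < t" "b < t" "a \<noteq> b" for a b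
    using diagonal[of b a] that by blast
  show "\<Gamma> k k = p k j"
    using derivation[of k j k k] assms kj by (simp add: quad_coeff_def zero)
  show "\<Gamma> i i = p i j * p k i" if "i < t" "i \<noteq> j" "i \<noteq> k" for i
    using derivation[of i j i k] assms kj that by (simp add: quad_coeff_def zero)
qed

text \<open>Otherwise the two descriptions of the eigenvalue at \<open>k\<close> differ by the factor \<open>p\<^sub>k\<^sub>'\<^sub>k \<noteq> 1\<close>.\<close>

lemma edge_unique:
  assumes "k < t" "k' < t" "j < t" "\<Xi> k j \<noteq> 0" "\<Xi> k' j \<noteq> 0"
  shows "k = k'"
proof (rule ccontr)
  assume ne: "k \<noteq> k'"
  have "p k j = p k j * p k' k"
    using edge(2)[of k j] edge(4)[of k' j k] edge(1)[of k j] assms ne by auto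
  then show False
    using p_nonzero[of k j] p_neq_1[of k' k] assms ne by simp
qed

end

text \<open>Let \<open>x u\<^sub>j\<close> be a multiple of \<open>u\<^sub>k\<close> and \<open>y u\<^sub>j\<close> a multiple of \<open>u\<^sub>k\<^sub>'\<close>.  Commuting \<open>g\<close> past \<open>y\<close> and
  \<open>h\<close> past \<open>x\<close> relates the product of \<open>\<Gamma>\<^sub>k\<^sub>'\<^sub>k\<^sub>'\<close> and \<open>H\<^sub>k\<^sub>k\<close> to \<open>\<Gamma>\<^sub>j\<^sub>j H\<^sub>j\<^sub>j\<close>; commuting \<open>g\<close> past \<open>x\<close> and
  \<open>h\<close> past \<open>y\<close> does the same for \<open>\<Gamma>\<^sub>k\<^sub>k H\<^sub>k\<^sub>'\<^sub>k\<^sub>'\<close>.  The two products agree by the description of the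
  eigenvalues in \<open>edge\<close>.\<close>

lemma (in quantum_parameters) common_source:
  assumes x: "linear_skew_derivation t p \<Gamma> \<Xi> lam"
    and y: "linear_skew_derivation t p H Y mu"
    and gy: "\<And>i m. \<lbrakk>i < t; m < t\<rbrakk> \<Longrightarrow> (\<Sum>k<t. \<Gamma> m k * Y k i) = a * (\<Sum>k<t. Y m k * \<Gamma> k i)"
    and hx: "\<And>i m. \<lbrakk>i < t; m < t\<rbrakk> \<Longrightarrow> (\<Sum>k<t. H m k * \<Xi> k i) = b * (\<Sum>k<t. \<Xi> m k * H k i)"
    and ab: "a * b = 1"
    and k: "k < t" "j < t" "\<Xi> k j \<noteq> 0" and k': "k' < t" "Y k' j \<noteq> 0"
  shows "lam * mu = 1"
proof -
  interpret x: linear_skew_derivation t p \<Gamma> \<Xi> lam by (fact x)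
  interpret y: linear_skew_derivation t p H Y mu by (fact y)
  have e1: "\<Gamma> k' k' = a * \<Gamma> j j"
    using diagonal_twist[OF x.diagonal gy, of j k'] k k' by simp
  have e2: "H k k = b * H j j"
    using diagonal_twist[OF y.diagonal hx, of j k] k k' by simp
  have nz: "\<Gamma> j j \<noteq> 0" "H j j \<noteq> 0" using x.diagonal y.diagonal k by auto
  have lm: "\<Gamma> k k = lam * \<Gamma> j j" "H k' k' = mu * H j j"
    using x.edge(3) y.edge(3) k k' by auto
  have "\<Gamma> k k * H k' k' = \<Gamma> k' k' * H k k"
  proof (cases "k = k'")
    case False
    have "\<Gamma> k k = p k j" "\<Gamma> k' k' = p k' j * p k k'" "H k' k' = p k' j" "H k k = p k j * p k' k"
      using x.edge[of k j] y.edge[of k' j] k k' False by auto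
    then show ?thesis using p_inverse[of k k'] k k' by (simp add: mult_ac)
  qed simp
  then have "lam * mu * (\<Gamma> j j * H j j) = a * b * (\<Gamma> j j * H j j)"
    using e1 e2 lm by (simp add: mult_ac)
  then show ?thesis using ab nz by simp
qed

text \<open>Double counting of the pairs \<open>(r, j)\<close> for which column \<open>j\<close> of \<open>\<Xi>\<^sub>r\<close> is nonzero.\<close>

theorem (in quantum_parameters) rank_bound:
  fixes \<Gamma> \<Xi> :: "nat \<Rightarrow> nat \<Rightarrow> nat \<Rightarrow> 'k" and a :: "nat \<Rightarrow> nat \<Rightarrow> 'k"
  assumes t: "2 \<le> t"
    and deriv: "\<And>r. r < \<theta> \<Longrightarrow> linear_skew_derivation t p (\<Gamma> r) (\<Xi> r) (a r r)"
    and sq: "\<And>r. r < \<theta> \<Longrightarrow> a r r * a r r \<noteq> 1"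
    and inv: "\<And>r s. \<lbrakk>r < \<theta>; s < \<theta>; r \<noteq> s\<rbrakk> \<Longrightarrow> a r s * a s r = 1"
    and gx: "\<And>r s i m. \<lbrakk>r < \<theta>; s < \<theta>; i < t; m < t\<rbrakk> \<Longrightarrow>
      (\<Sum>k<t. \<Gamma> r m k * \<Xi> s k i) = a r s * (\<Sum>k<t. \<Xi> s m k * \<Gamma> r k i)"
    and xx: "\<And>r s i m. \<lbrakk>r < \<theta>; s < \<theta>; r \<noteq> s; i < t; m < t\<rbrakk> \<Longrightarrow>
      (\<Sum>k<t. \<Xi> r m k * \<Xi> s k i) = a r s * (\<Sum>k<t. \<Xi> s m k * \<Xi> r k i)"
  shows "\<theta> \<le> 2 * (t - 1)"
proof -
  define src where "src r = {j. j < t \<and> (\<exists>k<t. \<Xi> r k j \<noteq> 0)}" for r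
  have fin: "finite (src r)" for r by (simp add: src_def)
  have pair: "a r r * a s s = 1" if "r < \<theta>" "s < \<theta>" "r \<noteq> s" "j \<in> src r" "j \<in> src s" for r s j
  proof -
    obtain k k' where "j < t" "k < t" "k' < t" "\<Xi> r k j \<noteq> 0" "\<Xi> s k' j \<noteq> 0"
      using \<open>j \<in> src r\<close> \<open>j \<in> src s\<close> by (auto simp: src_def)
    then show ?thesis
      using common_source[OF deriv deriv gx gx inv, of r s k j k'] that by auto
  qed
  have two: "card {r. r < \<theta> \<and> j \<in> src r} \<le> 2" for j
  proof (rule ccontr)
    assume "\<not> ?thesis"
    then obtain T where T: "T \<subseteq> {r. r < \<theta> \<and> j \<in> src r}" "card T = 3"
      using obtain_subset_with_card_n[of 3 "{r. r < \<theta> \<and> j \<in> src r}"] by (metis not_less_eq_eq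
          numeral_2_eq_2 numeral_3_eq_3)
    then obtain q r s where q: "T = {q, r, s}" "q \<noteq> r" "q \<noteq> s" "r \<noteq> s"
      by (metis card_3_iff)
    have 1: "a q q * a r r = 1" "a q q * a s s = 1" "a r r * a s s = 1"
      using pair[of q r j] pair[of q s j] pair[of r s j] q T by auto
    then have "a r r = a s s" by (metis mult_cancel_left mult_zero_left zero_neq_one)
    then show False using 1 sq[of r] q T by auto
  qed
  have total: "(\<Sum>r<\<theta>. card (src r)) \<le> 2 * card (\<Union>r<\<theta>. src r)"
  proof -
    let ?U = "\<Union>r<\<theta>. src r"
    have "(\<Sum>r<\<theta>. card (src r)) = (\<Sum>r<\<theta>. \<Sum>j\<in>?U. of_bool (j \<in> src r))"
    proof (rule sum.cong)
      fix r assume "r \<in> {..<\<theta>}"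
      then have "?U \<inter> {j. j \<in> src r} = src r" by auto
      then show "card (src r) = (\<Sum>j\<in>?U. of_bool (j \<in> src r))"
        using fin by simp
    qed simp
    also have "\<dots> = (\<Sum>j\<in>?U. \<Sum>r<\<theta>. of_bool (j \<in> src r))" by (rule sum.swap)
    also have "\<dots> = (\<Sum>j\<in>?U. card {r. r < \<theta> \<and> j \<in> src r})"
    proof (rule sum.cong)
      fix j
      have "{..<\<theta>} \<inter> {r. j \<in> src r} = {r. r < \<theta> \<and> j \<in> src r}" by auto
      then show "(\<Sum>r<\<theta>. of_bool (j \<in> src r)) = card {r. r < \<theta> \<and> j \<in> src r}" by simp
    qed simp
    also have "\<dots> \<le> (\<Sum>j\<in>?U. 2)" by (rule sum_mono) (rule two)
    finally show ?thesis by simp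
  qed
  have nonempty: "1 \<le> card (src r)" if "r < \<theta>" for r
  proof -
    interpret linear_skew_derivation t p "\<Gamma> r" "\<Xi> r" "a r r" using deriv[OF that] .
    have "src r \<noteq> {}" using nonzero by (auto simp: src_def)
    then show ?thesis using fin by (simp add: Suc_le_eq card_gt_0_iff)
  qed
  have sub: "(\<Union>r<\<theta>. src r) \<subseteq> {..<t}" by (auto simp: src_def)
  show ?thesis
  proof (cases "(\<Union>r<\<theta>. src r) = {..<t}")
    case False
    then have "card (\<Union>r<\<theta>. src r) < t"
      using psubset_card_mono[of "{..<t}" "\<Union>r<\<theta>. src r"] sub by auto
    moreover have "\<theta> \<le> (\<Sum>r<\<theta>. card (src r))"
      using sum_mono[of "{..<\<theta>}" "\<lambda>_. 1" "\<lambda>r. card (src r)"] nonempty by simp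
    ultimately show ?thesis using total by linarith
  next
    case True
    \<comment> \<open>If \<open>\<Xi>\<^sub>r\<close> has only the column \<open>j\<close>, with its entry in row \<open>k\<close>, then some \<open>\<Xi>\<^sub>s\<close> with a nonzero column \<open>k\<close>
      cannot commute with it up to a scalar.\<close>
    have "2 \<le> card (src r)" if r: "r < \<theta>" for r
    proof (rule ccontr)
      assume "\<not> ?thesis"
      then have "card (src r) = 1" using nonempty[OF r] by simp
      then obtain j where j: "src r = {j}" by (rule card_1_singletonE)
      interpret x: linear_skew_derivation t p "\<Gamma> r" "\<Xi> r" "a r r" using deriv[OF r] .
      obtain k where k: "k < t" "j < t" "\<Xi> r k j \<noteq> 0" using j by (auto simp: src_def)
      have "k \<noteq> j" using x.edge(1)[of k j] k by blast
      obtain s where s: "s < \<theta>" "k \<in> src s" using True k by auto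
      then have "r \<noteq> s" using j \<open>k \<noteq> j\<close> by auto
      interpret y: linear_skew_derivation t p "\<Gamma> s" "\<Xi> s" "a s s" using deriv[OF s(1)] .
      obtain l where l: "l < t" "\<Xi> s l k \<noteq> 0" using s by (auto simp: src_def)
      have only: "\<Xi> r m n = 0" if "m < t" "n < t" "n \<noteq> j" for m n
        using j that unfolding src_def by blast
      have "(\<Sum>m<t. \<Xi> r l m * \<Xi> s m j) = 0"
      proof (rule sum.neutral, intro ballI)
        fix m assume "m \<in> {..<t}"
        then show "\<Xi> r l m * \<Xi> s m j = 0"
          using only[of l m] y.edge(1)[of j j] k l by (cases "m = j") auto
      qed
      moreover have "(\<Sum>m<t. \<Xi> s l m * \<Xi> r m j) = \<Xi> s l k * \<Xi> r k j"
      proof -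
        have "(\<Sum>m<t. \<Xi> s l m * \<Xi> r m j) = (\<Sum>m<t. if m = k then \<Xi> s l k * \<Xi> r k j else 0)"
        proof (rule sum.cong)
          fix m assume "m \<in> {..<t}"
          then have "\<Xi> r m j = 0" if "m \<noteq> k"
            using x.edge_unique[of m k j] k that by auto
          then show "\<Xi> s l m * \<Xi> r m j = (if m = k then \<Xi> s l k * \<Xi> r k j else 0)" by simp
        qed simp
        then show ?thesis using k by simp
      qed
      moreover have "a r s \<noteq> 0" using inv[of r s] r s \<open>r \<noteq> s\<close> by auto
      ultimately show False using xx[of r s j l] k l r s \<open>r \<noteq> s\<close> by auto
    qed
    then have "(\<Sum>r<\<theta>. 2) \<le> (\<Sum>r<\<theta>. card (src r))" by (intro sum_mono) auto
    also have "\<dots> \<le> 2 * t" using total True by simp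
    finally show ?thesis using t by simp
  qed
qed

lemma ground_simps [simp]:
  "carrier (ground :: 'k::field ring) = UNIV"
  "a \<otimes>\<^bsub>ground\<^esub> b = a * (b :: 'k)"
  "a \<oplus>\<^bsub>ground\<^esub> b = a + (b :: 'k)"
  "\<one>\<^bsub>ground\<^esub> = (1 :: 'k)"
  "\<zero>\<^bsub>ground\<^esub> = (0 :: 'k)"
  by (simp_all add: ring_of_type_algebra_def)

lemma cring_ground: "cring (ground :: 'k::field ring)"
  by unfold_locales
    (auto simp: ring_of_type_algebra_def Units_def algebra_simps intro: exI[of _ "- x" for x]
      add.right_inverse)

section \<open>Monoid algebras\<close>

text \<open>Elements of a monoid algebra are studied through their values on test functions on the monoid.  The
  product becomes an iterated pairing (\<open>pairing_mult\<close>), which makes associativity a statement about the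
  monoid only.\<close>

definition pairing :: "('m \<Rightarrow> 'k::field) \<Rightarrow> ('m \<Rightarrow> 'k) \<Rightarrow> 'k"
  where "pairing f \<phi> = (\<Sum>m | f m \<noteq> 0. f m * \<phi> m)"

lemma monoid_algebra_simps [simp]:
  "f \<in> carrier (monoid_algebra M) \<longleftrightarrow> finite {m. f m \<noteq> 0} \<and> {m. f m \<noteq> 0} \<subseteq> carrier M"
  "f \<oplus>\<^bsub>monoid_algebra M\<^esub> g = (\<lambda>m. f m + g m)"
  "c \<odot>\<^bsub>monoid_algebra M\<^esub> f = (\<lambda>m. c * f m)"
  "\<zero>\<^bsub>monoid_algebra M\<^esub> = (\<lambda>m. 0)"
  "\<one>\<^bsub>monoid_algebra M\<^esub> = basis_vec \<one>\<^bsub>M\<^esub>"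
  by (simp_all add: monoid_algebra_def basis_vec_def)

lemma support_basis_vec [simp]: "{m'. basis_vec m m' \<noteq> (0 :: 'k::field)} = {m}"
  by (auto simp: basis_vec_def)

lemma pairing_on:
  "\<lbrakk>finite S; {m. f m \<noteq> 0} \<subseteq> S\<rbrakk> \<Longrightarrow> pairing f \<phi> = (\<Sum>m\<in>S. f m * \<phi> m)"
  unfolding pairing_def by (rule sum.mono_neutral_left) auto

lemma pairing_cong:
  "(\<And>m. f m \<noteq> 0 \<Longrightarrow> \<phi> m = \<psi> m) \<Longrightarrow> pairing f \<phi> = pairing f \<psi>"
  by (simp add: pairing_def)

lemma pairing_basis_vec [simp]: "pairing (basis_vec m) \<phi> = \<phi> m"
  unfolding pairing_def by (simp add: basis_vec_def)

lemma finite_support_add: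
  "\<lbrakk>finite {m. f m \<noteq> (0 :: 'k::field)}; finite {m. g m \<noteq> 0}\<rbrakk> \<Longrightarrow> finite {m. f m + g m \<noteq> 0}"
  by (rule finite_subset[of _ "{m. f m \<noteq> 0} \<union> {m. g m \<noteq> 0}"]) auto

lemma finite_support_scale:
  "finite {m. f m \<noteq> (0 :: 'k::field)} \<Longrightarrow> finite {m. c * f m \<noteq> 0}"
  by (rule finite_subset[of _ "{m. f m \<noteq> 0}"]) auto

lemma pairing_add:
  assumes "finite {m. f m \<noteq> 0}" "finite {m. g m \<noteq> 0}"
  shows "pairing (\<lambda>m. f m + g m) \<phi> = pairing f \<phi> + pairing g \<phi>"
proof -
  let ?S = "{m. f m \<noteq> 0} \<union> {m. g m \<noteq> 0}"
  have "finite ?S" "{m. f m + g m \<noteq> 0} \<subseteq> ?S" using assms by auto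
  then show ?thesis
    using pairing_on[of ?S f \<phi>] pairing_on[of ?S g \<phi>] pairing_on[of ?S "\<lambda>m. f m + g m" \<phi>]
    by (simp add: sum.distrib distrib_right)
qed

lemma pairing_scale: "pairing (\<lambda>m. c * f m) \<phi> = c * pairing f \<phi>"
proof (cases "c = 0")
  case False
  then show ?thesis by (simp add: pairing_def sum_distrib_left mult.assoc)
qed (simp add: pairing_def)

lemma pairing_right_scale: "pairing f (\<lambda>m. c * \<phi> m) = c * pairing f \<phi>"
  by (simp add: pairing_def sum_distrib_left mult_ac)

lemma pairing_right_add: "pairing f (\<lambda>m. \<phi> m + \<psi> m) = pairing f \<phi> + pairing f \<psi>"
  by (simp add: pairing_def distrib_left sum.distrib)

lemma pairing_right_zero [simp]: "pairing f (\<lambda>m. 0) = 0"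
  by (simp add: pairing_def)

lemma monoid_algebra_mult_eq:
  "(f \<otimes>\<^bsub>monoid_algebra M\<^esub> g) m =
    pairing f (\<lambda>a. pairing g (\<lambda>b. of_bool (a \<otimes>\<^bsub>M\<^esub> b = m)))" if "finite {m. g m \<noteq> 0}"
proof -
  have "(\<Sum>b | g b \<noteq> 0 \<and> a \<otimes>\<^bsub>M\<^esub> b = m. f a * g b) = f a * pairing g (\<lambda>b. of_bool (a \<otimes>\<^bsub>M\<^esub> b = m))" for a
  proof -
    have "(\<Sum>b | g b \<noteq> 0 \<and> a \<otimes>\<^bsub>M\<^esub> b = m. f a * g b)
        = (\<Sum>b | g b \<noteq> 0. if a \<otimes>\<^bsub>M\<^esub> b = m then f a * g b else 0)"
      using sum.inter_filter[OF that, of "\<lambda>b. f a * g b" "\<lambda>b. a \<otimes>\<^bsub>M\<^esub> b = m"] by simp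
    then show ?thesis by (simp add: pairing_def sum_distrib_left of_bool_def if_distrib cong: if_cong)
  qed
  then show ?thesis by (simp add: monoid_algebra_def pairing_def)
qed

lemma support_monoid_algebra_mult:
  "{m. (f \<otimes>\<^bsub>monoid_algebra M\<^esub> g) m \<noteq> 0} \<subseteq>
    (\<lambda>(a, b). a \<otimes>\<^bsub>M\<^esub> b) ` ({m. f m \<noteq> 0} \<times> {m. g m \<noteq> 0})"
proof
  fix m assume "m \<in> {m. (f \<otimes>\<^bsub>monoid_algebra M\<^esub> g) m \<noteq> 0}"
  then have "(\<Sum>a | f a \<noteq> 0. \<Sum>b | g b \<noteq> 0 \<and> a \<otimes>\<^bsub>M\<^esub> b = m. f a * g b) \<noteq> 0"
    by (simp add: monoid_algebra_def)
  then obtain a where "f a \<noteq> 0" "(\<Sum>b | g b \<noteq> 0 \<and> a \<otimes>\<^bsub>M\<^esub> b = m. f a * g b) \<noteq> 0"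
    by (metis (mono_tags, lifting) mem_Collect_eq sum.neutral)
  moreover from this obtain b where "g b \<noteq> 0" "a \<otimes>\<^bsub>M\<^esub> b = m"
    by (smt (verit) mem_Collect_eq sum.neutral)
  ultimately have "(a, b) \<in> {m. f m \<noteq> 0} \<times> {m. g m \<noteq> 0}" "m = (\<lambda>(a, b). a \<otimes>\<^bsub>M\<^esub> b) (a, b)"
    by simp_all
  then show "m \<in> (\<lambda>(a, b). a \<otimes>\<^bsub>M\<^esub> b) ` ({m. f m \<noteq> 0} \<times> {m. g m \<noteq> 0})"
    by (rule rev_image_eqI)
qed

lemma pairing_mult:
  assumes "finite {m. f m \<noteq> 0}" "finite {m. g m \<noteq> 0}"
  shows "pairing (f \<otimes>\<^bsub>monoid_algebra M\<^esub> g) \<phi> = pairing f (\<lambda>a. pairing g (\<lambda>b. \<phi> (a \<otimes>\<^bsub>M\<^esub> b)))"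
proof -
  let ?A = "{m. f m \<noteq> 0}" and ?B = "{m. g m \<noteq> 0}"
  let ?C = "(\<lambda>(a, b). a \<otimes>\<^bsub>M\<^esub> b) ` (?A \<times> ?B)"
  have C: "finite ?C" using assms by blast
  have "pairing (f \<otimes>\<^bsub>monoid_algebra M\<^esub> g) \<phi> = (\<Sum>m\<in>?C. (f \<otimes>\<^bsub>monoid_algebra M\<^esub> g) m * \<phi> m)"
    using C support_monoid_algebra_mult by (rule pairing_on)
  also have "\<dots> = (\<Sum>m\<in>?C. \<Sum>a\<in>?A. \<Sum>b\<in>?B. f a * g b * (of_bool (a \<otimes>\<^bsub>M\<^esub> b = m) * \<phi> m))"
    by (rule sum.cong)
      (simp_all only: monoid_algebra_mult_eq[OF assms(2)] pairing_def sum_distrib_left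
        sum_distrib_right mult.assoc)
  also have "\<dots> = (\<Sum>a\<in>?A. \<Sum>m\<in>?C. \<Sum>b\<in>?B. f a * g b * (of_bool (a \<otimes>\<^bsub>M\<^esub> b = m) * \<phi> m))"
    by (rule sum.swap)
  also have "\<dots> = (\<Sum>a\<in>?A. \<Sum>b\<in>?B. \<Sum>m\<in>?C. f a * g b * (of_bool (a \<otimes>\<^bsub>M\<^esub> b = m) * \<phi> m))"
    by (rule sum.cong[OF refl], rule sum.swap)
  also have "\<dots> = (\<Sum>a\<in>?A. \<Sum>b\<in>?B. f a * g b * \<phi> (a \<otimes>\<^bsub>M\<^esub> b))"
  proof (intro sum.cong refl)
    fix a b assume "a \<in> ?A" "b \<in> ?B"
    then have "a \<otimes>\<^bsub>M\<^esub> b \<in> ?C" by (intro image_eqI[of _ _ "(a, b)"]) auto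
    then show "(\<Sum>m\<in>?C. f a * g b * (of_bool (a \<otimes>\<^bsub>M\<^esub> b = m) * \<phi> m)) = f a * g b * \<phi> (a \<otimes>\<^bsub>M\<^esub> b)"
      using C by (simp add: of_bool_def if_distrib[of "\<lambda>x. x * _"] if_distrib[of "\<lambda>x. _ * x"] sum.delta
          cong: if_cong)
  qed
  finally show ?thesis by (simp add: pairing_def sum_distrib_left mult.assoc)
qed

lemma basis_vec_mult:
  "basis_vec a \<otimes>\<^bsub>monoid_algebra M\<^esub> basis_vec b = (basis_vec (a \<otimes>\<^bsub>M\<^esub> b) :: 'm \<Rightarrow> 'k::field)"
proof
  fix m
  have "(basis_vec a \<otimes>\<^bsub>monoid_algebra M\<^esub> basis_vec b) m = (of_bool (a \<otimes>\<^bsub>M\<^esub> b = m) :: 'k)"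
    by (simp add: monoid_algebra_mult_eq)
  then show "(basis_vec a \<otimes>\<^bsub>monoid_algebra M\<^esub> basis_vec b) m = (basis_vec (a \<otimes>\<^bsub>M\<^esub> b) m :: 'k)"
    by (auto simp: basis_vec_def)
qed

lemma finite_support_induct [consumes 2, case_names zero add]:
  assumes "finite {m. f m \<noteq> (0 :: 'k::field)}" "{m. f m \<noteq> 0} \<subseteq> W"
    and zero: "P (\<lambda>m. 0)"
    and add: "\<And>f c m. \<lbrakk>finite {m. f m \<noteq> 0}; {m. f m \<noteq> 0} \<subseteq> W; m \<in> W; P f\<rbrakk>
      \<Longrightarrow> P (\<lambda>x. f x + c * basis_vec m x)"
  shows "P f"
proof -
  have "finite S \<Longrightarrow> S \<subseteq> W \<Longrightarrow> {m. f m \<noteq> 0} \<subseteq> S \<Longrightarrow> P f" for S and f :: "'a \<Rightarrow> 'k"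
  proof (induction S arbitrary: f rule: finite_induct)
    case empty
    then have "f = (\<lambda>m. 0)" by auto
    then show ?case using zero by simp
  next
    case (insert m S)
    let ?f = "f(m := 0)"
    have supp: "{x. ?f x \<noteq> 0} \<subseteq> S" using insert.prems by auto
    have "P (\<lambda>x. ?f x + f m * basis_vec m x)"
    proof (rule add)
      show "finite {x. ?f x \<noteq> 0}" using supp insert.hyps(1) by (rule finite_subset)
      show "{x. ?f x \<noteq> 0} \<subseteq> W" using supp insert.prems by blast
      show "m \<in> W" using insert.prems by blast
      show "P ?f" using insert.IH[of ?f] insert.prems supp by blast
    qed
    moreover have "(\<lambda>x. ?f x + f m * basis_vec m x) = f"
      by (auto simp: basis_vec_def)
    ultimately show ?case by simp
  qed
  then show ?thesis using assms(1,2) by blast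
qed

locale ground_algebra = assoc_algebra ground A
  for A :: "('k::field, 'a, 'm) module_scheme" (structure)

lemma monoid_algebra_ground_algebra:
  assumes "Group.monoid M"
  shows "ground_algebra (monoid_algebra M :: ('k::field, 'm \<Rightarrow> 'k) module)"
proof -
  interpret M: Group.monoid M by fact
  let ?F = "monoid_algebra M :: ('k::field, 'm \<Rightarrow> 'k) module"
  have add_closed: "finite {m. f m + g m \<noteq> 0} \<and> {m. f m + g m \<noteq> 0} \<subseteq> carrier M"
    if "f \<in> carrier ?F" "g \<in> carrier ?F" for f g
  proof -
    have "{m. f m + g m \<noteq> 0} \<subseteq> {m. f m \<noteq> 0} \<union> {m. g m \<noteq> 0}" by auto
    then show ?thesis using that finite_support_add[of f g] by (simp, blast)
  qed
  have scale_closed: "finite {m. c * f m \<noteq> 0} \<and> {m. c * f m \<noteq> 0} \<subseteq> carrier M"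
    if "f \<in> carrier ?F" for f c
    using that finite_support_scale[of f c] by auto
  have mult_closed: "f \<otimes>\<^bsub>?F\<^esub> g \<in> carrier ?F" if "f \<in> carrier ?F" "g \<in> carrier ?F" for f g
  proof -
    let ?C = "(\<lambda>(a, b). a \<otimes>\<^bsub>M\<^esub> b) ` ({m. f m \<noteq> 0} \<times> {m. g m \<noteq> 0})"
    have "finite ?C" "?C \<subseteq> carrier M" using that by auto
    then show ?thesis
      using support_monoid_algebra_mult[of M f g] by (auto intro: finite_subset)
  qed
  have abelian: "abelian_group ?F"
  proof (rule abelian_groupI)
    fix f assume f: "f \<in> carrier ?F"
    show "\<exists>g\<in>carrier ?F. g \<oplus>\<^bsub>?F\<^esub> f = \<zero>\<^bsub>?F\<^esub>"
      using f scale_closed[OF f, of "-1"] by (intro bexI[of _ "\<lambda>m. - f m"]) auto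
  qed (use add_closed in \<open>auto simp: add_ac\<close>)
  have monoid: "Group.monoid ?F"
  proof (rule monoidI)
    fix f g h assume f: "f \<in> carrier ?F" and g: "g \<in> carrier ?F" and h: "h \<in> carrier ?F"
    then have fin: "finite {m. f m \<noteq> 0}" "finite {m. g m \<noteq> 0}" "finite {m. h m \<noteq> 0}" by auto
    have fin': "finite {m. (g \<otimes>\<^bsub>?F\<^esub> h) m \<noteq> 0}" using mult_closed[OF g h] by simp
    show "f \<otimes>\<^bsub>?F\<^esub> g \<otimes>\<^bsub>?F\<^esub> h = f \<otimes>\<^bsub>?F\<^esub> (g \<otimes>\<^bsub>?F\<^esub> h)"
    proof
      fix m
      have "(f \<otimes>\<^bsub>?F\<^esub> g \<otimes>\<^bsub>?F\<^esub> h) m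
          = pairing f (\<lambda>a. pairing g (\<lambda>b. pairing h (\<lambda>c. of_bool (a \<otimes>\<^bsub>M\<^esub> b \<otimes>\<^bsub>M\<^esub> c = m))))"
        by (simp only: monoid_algebra_mult_eq[OF fin(3)] pairing_mult[OF fin(1,2)])
      also have "\<dots> = pairing f (\<lambda>a. pairing g (\<lambda>b. pairing h (\<lambda>c. of_bool (a \<otimes>\<^bsub>M\<^esub> (b \<otimes>\<^bsub>M\<^esub> c) = m))))"
        using f g h by (intro pairing_cong) (simp add: subset_eq M.m_assoc)
      also have "\<dots> = (f \<otimes>\<^bsub>?F\<^esub> (g \<otimes>\<^bsub>?F\<^esub> h)) m"
        by (simp only: monoid_algebra_mult_eq[OF fin'] pairing_mult[OF fin(2,3)])
      finally show "(f \<otimes>\<^bsub>?F\<^esub> g \<otimes>\<^bsub>?F\<^esub> h) m = (f \<otimes>\<^bsub>?F\<^esub> (g \<otimes>\<^bsub>?F\<^esub> h)) m" .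
    qed
  next
    fix f assume f: "f \<in> carrier ?F"
    have delta: "pairing f (\<lambda>b. of_bool (b = m)) = f m" for m
    proof -
      have "pairing f (\<lambda>b. of_bool (b = m)) = (\<Sum>b\<in>insert m {m. f m \<noteq> 0}. f b * of_bool (b = m))"
        using f by (intro pairing_on) auto
      also have "\<dots> = (\<Sum>b\<in>insert m {m. f m \<noteq> 0}. if b = m then f b else 0)"
        by (rule sum.cong) auto
      also have "\<dots> = f m" using f by (simp add: sum.delta)
      finally show ?thesis .
    qed
    show "\<one>\<^bsub>?F\<^esub> \<otimes>\<^bsub>?F\<^esub> f = f"
    proof
      fix m
      have "(\<one>\<^bsub>?F\<^esub> \<otimes>\<^bsub>?F\<^esub> f) m = pairing f (\<lambda>b. of_bool (\<one>\<^bsub>M\<^esub> \<otimes>\<^bsub>M\<^esub> b = m))"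
        using f by (simp add: monoid_algebra_mult_eq)
      also have "\<dots> = f m"
        using f by (subst delta[symmetric], intro pairing_cong) (simp add: subset_eq)
      finally show "(\<one>\<^bsub>?F\<^esub> \<otimes>\<^bsub>?F\<^esub> f) m = f m" .
    qed
    show "f \<otimes>\<^bsub>?F\<^esub> \<one>\<^bsub>?F\<^esub> = f"
    proof
      fix m
      have "(f \<otimes>\<^bsub>?F\<^esub> \<one>\<^bsub>?F\<^esub>) m = pairing f (\<lambda>b. of_bool (b \<otimes>\<^bsub>M\<^esub> \<one>\<^bsub>M\<^esub> = m))"
        by (simp add: monoid_algebra_mult_eq)
      also have "\<dots> = f m"
        using f by (subst delta[symmetric], intro pairing_cong) (simp add: subset_eq)
      finally show "(f \<otimes>\<^bsub>?F\<^esub> \<one>\<^bsub>?F\<^esub>) m = f m" .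
    qed
  qed (use mult_closed in auto)
  have ring: "ring ?F"
  proof (rule ringI[OF abelian monoid])
    fix f g h assume "f \<in> carrier ?F" "g \<in> carrier ?F" "h \<in> carrier ?F"
    then have fin: "finite {m. f m \<noteq> 0}" "finite {m. g m \<noteq> 0}" "finite {m. h m \<noteq> 0}" by auto
    show "(f \<oplus>\<^bsub>?F\<^esub> g) \<otimes>\<^bsub>?F\<^esub> h = f \<otimes>\<^bsub>?F\<^esub> h \<oplus>\<^bsub>?F\<^esub> g \<otimes>\<^bsub>?F\<^esub> h"
      by (rule ext) (simp add: monoid_algebra_mult_eq fin pairing_add)
    show "h \<otimes>\<^bsub>?F\<^esub> (f \<oplus>\<^bsub>?F\<^esub> g) = h \<otimes>\<^bsub>?F\<^esub> f \<oplus>\<^bsub>?F\<^esub> h \<otimes>\<^bsub>?F\<^esub> g"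
      by (rule ext)
        (simp add: monoid_algebra_mult_eq fin finite_support_add pairing_add pairing_right_add)
  qed
  show ?thesis
  proof (intro ground_algebra.intro assoc_algebra.intro assoc_algebra_axioms.intro)
    show "module ground ?F"
      by (rule moduleI[OF cring_ground abelian])
        (use scale_closed in \<open>auto simp: distrib_left distrib_right mult.assoc\<close>)
    show "ring ?F" by (fact ring)
  next
    fix c :: 'k and f g assume "f \<in> carrier ?F" "g \<in> carrier ?F"
    then have fin: "finite {m. f m \<noteq> 0}" "finite {m. g m \<noteq> 0}" by auto
    show "(c \<odot>\<^bsub>?F\<^esub> f) \<otimes>\<^bsub>?F\<^esub> g = c \<odot>\<^bsub>?F\<^esub> (f \<otimes>\<^bsub>?F\<^esub> g)"
      by (rule ext) (simp add: monoid_algebra_mult_eq fin pairing_scale)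
    show "f \<otimes>\<^bsub>?F\<^esub> (c \<odot>\<^bsub>?F\<^esub> g) = c \<odot>\<^bsub>?F\<^esub> (f \<otimes>\<^bsub>?F\<^esub> g)"
      by (rule ext)
        (simp add: monoid_algebra_mult_eq fin finite_support_scale pairing_scale pairing_right_scale)
  qed
qed

lemma monoid_algebra_minus:
  assumes "Group.monoid M" "f \<in> carrier (monoid_algebra M)" "g \<in> carrier (monoid_algebra M)"
  shows "f \<ominus>\<^bsub>monoid_algebra M\<^esub> g = (\<lambda>m. f m - (g m :: 'k::field))"
proof -
  interpret ground_algebra "monoid_algebra M :: ('k, _) module"
    using assms(1) by (rule monoid_algebra_ground_algebra)
  have "(\<lambda>m. - g m) \<in> carrier (monoid_algebra M)" using assms by auto
  then have "\<ominus>\<^bsub>monoid_algebra M\<^esub> g = (\<lambda>m. - g m)"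
    using assms by (intro minus_equality) auto
  then show ?thesis by (simp add: a_minus_def)
qed

section \<open>Quotient algebras\<close>

context ground_algebra
begin

lemma smult_minus_one: "x \<in> carrier A \<Longrightarrow> (-1) \<odot> x = \<ominus> x"
proof -
  assume x: "x \<in> carrier A"
  have "(-1) \<odot> x \<oplus> x = (-1 + 1) \<odot> x"
    using x smult_l_distr[of "-1" 1 x] smult_one[of x] by simp
  also have "\<dots> = \<zero>" using smult_l_null[OF x] by simp
  finally have "\<ominus> x = (-1) \<odot> x" using x smult_closed[of "-1" x] by (intro minus_equality) auto
  then show ?thesis ..
qed

lemma subspaceI:
  assumes "U \<subseteq> carrier A" "\<zero> \<in> U" "\<And>x y. \<lbrakk>x \<in> U; y \<in> U\<rbrakk> \<Longrightarrow> x \<oplus> y \<in> U"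
    and "\<And>c x. x \<in> U \<Longrightarrow> c \<odot> x \<in> U"
  shows "submodule U ground A"
proof (rule submoduleI)
  fix x assume "x \<in> U"
  then show "\<ominus> x \<in> U"
    using assms(1) assms(4)[of x "-1"] by (subst smult_minus_one[symmetric]) auto
qed (use assms in auto)

lemma subspaceD:
  assumes "submodule U ground A"
  shows "U \<subseteq> carrier A" "\<zero> \<in> U" "\<And>x y. \<lbrakk>x \<in> U; y \<in> U\<rbrakk> \<Longrightarrow> x \<oplus> y \<in> U"
    and "\<And>c x. x \<in> U \<Longrightarrow> c \<odot> x \<in> U"
proof -
  note E = submoduleE[OF assms]
  show sub: "U \<subseteq> carrier A" by (rule E(1))
  show add: "\<And>x y. \<lbrakk>x \<in> U; y \<in> U\<rbrakk> \<Longrightarrow> x \<oplus> y \<in> U" by (rule E(5))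
  show scale: "\<And>c x. x \<in> U \<Longrightarrow> c \<odot> x \<in> U" by (rule E(4)) auto
  obtain x where "x \<in> U" using E(2) by blast
  then show "\<zero> \<in> U" using scale[of x 0] sub smult_l_null[of x] by auto
qed

lemma lin_span_subspace:
  assumes "S \<subseteq> carrier A"
  shows "submodule (lin_span A S) ground A"
proof -
  have carr: "submodule (carrier A) ground A" by (rule carrier_is_submodule)
  show ?thesis
  proof (rule subspaceI)
    show "lin_span A S \<subseteq> carrier A"
      unfolding lin_span_def using assms carr by (rule hull_minimal)
  qed (auto simp: lin_span_def hull_def dest: subspaceD)
qed

lemma lin_span_minimal:
  "\<lbrakk>submodule U ground A; S \<subseteq> U\<rbrakk> \<Longrightarrow> lin_span A S \<subseteq> U"
  unfolding lin_span_def by (rule hull_minimal)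

lemma lin_span_superset: "S \<subseteq> lin_span A S"
  unfolding lin_span_def by (rule hull_subset)

lemma subspace_sum:
  assumes "submodule U ground A" "submodule U' ground A"
  shows "submodule (U <+>\<^bsub>A\<^esub> U') ground A" and "U \<subseteq> U <+>\<^bsub>A\<^esub> U'" and "U' \<subseteq> U <+>\<^bsub>A\<^esub> U'"
proof -
  note U = subspaceD[OF assms(1)] and U' = subspaceD[OF assms(2)]
  have mem: "x \<in> U <+>\<^bsub>A\<^esub> U' \<longleftrightarrow> (\<exists>u\<in>U. \<exists>u'\<in>U'. x = u \<oplus> u')" for x
    by (auto simp: set_add_def')
  show "submodule (U <+>\<^bsub>A\<^esub> U') ground A"
  proof (rule subspaceI)
    show "U <+>\<^bsub>A\<^esub> U' \<subseteq> carrier A" using U(1) U'(1) by (auto simp: mem subset_eq)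
    show "\<zero> \<in> U <+>\<^bsub>A\<^esub> U'" unfolding mem using U(2) U'(2) by (metis l_zero zero_closed)
  next
    fix x y assume "x \<in> U <+>\<^bsub>A\<^esub> U'" "y \<in> U <+>\<^bsub>A\<^esub> U'"
    then obtain a a' b b' where ab: "a \<in> U" "a' \<in> U'" "x = a \<oplus> a'" "b \<in> U" "b' \<in> U'" "y = b \<oplus> b'"
      by (auto simp: mem)
    moreover from this have "a \<in> carrier A" "a' \<in> carrier A" "b \<in> carrier A" "b' \<in> carrier A"
      using U(1) U'(1) by auto
    ultimately have "x \<oplus> y = (a \<oplus> b) \<oplus> (a' \<oplus> b')" by (simp add: a_ac)
    then show "x \<oplus> y \<in> U <+>\<^bsub>A\<^esub> U'" unfolding mem using ab U(3) U'(3) by blast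
  next
    fix c x assume "x \<in> U <+>\<^bsub>A\<^esub> U'"
    then obtain a a' where a: "a \<in> U" "a' \<in> U'" "x = a \<oplus> a'" by (auto simp: mem)
    moreover from this have "a \<in> carrier A" "a' \<in> carrier A" using U(1) U'(1) by auto
    ultimately have "c \<odot> x = c \<odot> a \<oplus> c \<odot> a'" by (simp add: smult_r_distr)
    then show "c \<odot> x \<in> U <+>\<^bsub>A\<^esub> U'" unfolding mem using a U(4) U'(4) by blast
  qed
  show "U \<subseteq> U <+>\<^bsub>A\<^esub> U'"
  proof
    fix x assume "x \<in> U"
    then have "x = x \<oplus> \<zero>" using U(1) by auto
    then show "x \<in> U <+>\<^bsub>A\<^esub> U'" unfolding mem using \<open>x \<in> U\<close> U'(2) by blast
  qed
  show "U' \<subseteq> U <+>\<^bsub>A\<^esub> U'"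
  proof
    fix x assume "x \<in> U'"
    then have "x = \<zero> \<oplus> x" using U'(1) by auto
    then show "x \<in> U <+>\<^bsub>A\<^esub> U'" unfolding mem using \<open>x \<in> U'\<close> U(2) by blast
  qed
qed

lemma ideal_smult:
  assumes "ideal J A" "x \<in> J"
  shows "c \<odot> x \<in> J"
proof -
  interpret J: ideal J A by fact
  have x: "x \<in> carrier A" using assms J.Icarr by blast
  have "c \<odot> x = (c \<odot> \<one>) \<otimes> x"
    using x by (simp add: smult_mult_left)
  moreover have "(c \<odot> \<one>) \<otimes> x \<in> J" using assms(2) by (intro J.I_l_closed) auto
  ultimately show ?thesis by simp
qed

lemma ideal_subspace:
  assumes "ideal J A"
  shows "submodule J ground A"
proof -
  interpret J: ideal J A by fact
  show ?thesis
    by (rule subspaceI) (use ideal_smult[OF assms] J.a_subset J.zero_closed J.a_closed in auto)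
qed

lemma subspace_idealI:
  assumes "submodule J ground A"
    and "\<And>x y. \<lbrakk>x \<in> J; y \<in> carrier A\<rbrakk> \<Longrightarrow> y \<otimes> x \<in> J"
    and "\<And>x y. \<lbrakk>x \<in> J; y \<in> carrier A\<rbrakk> \<Longrightarrow> x \<otimes> y \<in> J"
  shows "ideal J A"
  by (rule idealI[OF ring_axioms submodule.axioms(1)[OF assms(1)]]) (use assms in auto)

lemma mult_minus_right:
  "\<lbrakk>x \<in> carrier A; y \<in> carrier A; z \<in> carrier A\<rbrakk> \<Longrightarrow> x \<otimes> (y \<ominus> z) = x \<otimes> y \<ominus> x \<otimes> z"
  by (simp add: a_minus_def r_distr r_minus)

lemma mult_minus_left:
  "\<lbrakk>x \<in> carrier A; y \<in> carrier A; z \<in> carrier A\<rbrakk> \<Longrightarrow> (y \<ominus> z) \<otimes> x = y \<otimes> x \<ominus> z \<otimes> x"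
  by (simp add: a_minus_def l_distr l_minus)

end

locale algebra_quotient = ground_algebra A + ideal J A
  for A :: "('k::field, 'a, 'm) module_scheme" (structure) and J
begin

lemma coset_eq_iff:
  "\<lbrakk>x \<in> carrier A; y \<in> carrier A\<rbrakk> \<Longrightarrow> J +> x = J +> y \<longleftrightarrow> x \<ominus> y \<in> J"
  using quotient_eq_iff_same_a_r_cos[OF is_ideal] by simp

lemma quotient_carrier: "carrier (quotient_algebra A J) = (+>) J ` carrier A"
  by (auto simp: quotient_algebra_def FactRing_def A_RCOSETS_def' image_iff)

lemma coset_closed [simp]: "x \<in> carrier A \<Longrightarrow> J +> x \<in> carrier (quotient_algebra A J)"
  by (simp add: quotient_carrier)

lemma coset_mult:
  "\<lbrakk>x \<in> carrier A; y \<in> carrier A\<rbrakk> \<Longrightarrow> (J +> x) \<otimes>\<^bsub>quotient_algebra A J\<^esub> (J +> y) = J +> (x \<otimes> y)"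
  by (simp add: quotient_algebra_def FactRing_def rcoset_mult_add)

lemma coset_add:
  "\<lbrakk>x \<in> carrier A; y \<in> carrier A\<rbrakk> \<Longrightarrow> (J +> x) \<oplus>\<^bsub>quotient_algebra A J\<^esub> (J +> y) = J +> (x \<oplus> y)"
  by (simp add: quotient_algebra_def FactRing_def a_rcos_sum)

lemma coset_zero: "\<zero>\<^bsub>quotient_algebra A J\<^esub> = J +> \<zero>"
  by (simp add: quotient_algebra_def FactRing_def a_subset)

lemma coset_one: "\<one>\<^bsub>quotient_algebra A J\<^esub> = J +> \<one>"
  by (simp add: quotient_algebra_def FactRing_def)

lemma coset_smult:
  assumes x: "x \<in> carrier A"
  shows "c \<odot>\<^bsub>quotient_algebra A J\<^esub> (J +> x) = J +> (c \<odot> x)"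
proof -
  have "J +> (c \<odot> y) = J +> (c \<odot> x)" if "y \<in> J +> x" for y
  proof -
    have y: "y \<in> carrier A" using that x a_r_coset_subset_G[OF a_subset x] by blast
    have "J +> y = J +> x" by (rule a_repr_independence[OF that x a_subgroup, symmetric])
    then have "y \<ominus> x \<in> J" using x y by (simp add: coset_eq_iff)
    then have "c \<odot> (y \<ominus> x) \<in> J" by (rule ideal_smult[OF is_ideal])
    moreover have "c \<odot> (y \<ominus> x) = c \<odot> y \<ominus> c \<odot> x"
      using x y by (simp add: a_minus_def smult_r_distr smult_r_minus)
    ultimately show ?thesis using x y by (simp add: coset_eq_iff)
  qed
  moreover have "x \<in> J +> x" using x by (rule a_rcos_self)
  ultimately have "(\<Union>y\<in>J +> x. J +> (c \<odot> y)) = J +> (c \<odot> x)" by blast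
  then show ?thesis by (simp add: quotient_algebra_def)
qed

lemmas coset_simps = coset_mult coset_add coset_smult coset_zero coset_one

lemma quotient_ground_algebra: "ground_algebra (quotient_algebra A J)"
proof -
  let ?Q = "quotient_algebra A J"
  have rep: "\<exists>x\<in>carrier A. C = J +> x" if "C \<in> carrier ?Q" for C
    using that by (auto simp: quotient_carrier)
  have abelian: "abelian_group ?Q"
  proof (rule abelian_groupI)
    fix C assume "C \<in> carrier ?Q"
    then obtain x where "x \<in> carrier A" "C = J +> x" using rep by blast
    then show "\<exists>D\<in>carrier ?Q. D \<oplus>\<^bsub>?Q\<^esub> C = \<zero>\<^bsub>?Q\<^esub>"
      by (intro bexI[of _ "J +> (\<ominus> x)"]) (simp_all add: coset_simps l_neg)
  qed (auto simp: quotient_carrier coset_simps a_ac)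
  have monoid: "Group.monoid ?Q"
    by (rule monoidI) (auto simp: quotient_carrier coset_simps m_assoc)
  have ring: "ring ?Q"
    by (rule ringI[OF abelian monoid]) (auto simp: quotient_carrier coset_simps l_distr r_distr)
  show ?thesis
  proof (intro ground_algebra.intro assoc_algebra.intro assoc_algebra_axioms.intro)
    show "module ground ?Q"
    proof (rule moduleI[OF cring_ground abelian])
      fix C assume "C \<in> carrier ?Q"
      then obtain x where x: "x \<in> carrier A" "C = J +> x" using rep by blast
      show "\<one>\<^bsub>ground\<^esub> \<odot>\<^bsub>?Q\<^esub> C = C"
        using x smult_one[of x] by (simp add: coset_simps)
      fix a b :: 'k
      show "a \<odot>\<^bsub>?Q\<^esub> C \<in> carrier ?Q" using x by (simp add: coset_simps)
      show "(a \<oplus>\<^bsub>ground\<^esub> b) \<odot>\<^bsub>?Q\<^esub> C = a \<odot>\<^bsub>?Q\<^esub> C \<oplus>\<^bsub>?Q\<^esub> b \<odot>\<^bsub>?Q\<^esub> C"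
        using x smult_l_distr[of a b x] by (simp add: coset_simps)
      show "(a \<otimes>\<^bsub>ground\<^esub> b) \<odot>\<^bsub>?Q\<^esub> C = a \<odot>\<^bsub>?Q\<^esub> (b \<odot>\<^bsub>?Q\<^esub> C)"
        using x smult_assoc1[of a b x] by (simp add: coset_simps)
    qed (auto simp: quotient_carrier coset_simps smult_r_distr)
    show "ring ?Q" by (fact ring)
  qed (auto simp: quotient_carrier coset_simps smult_mult_left smult_mult_right)
qed

end


section \<open>Linear extension and tensor products\<close>

lemma linear_mapsD:
  assumes "f \<in> linear_maps V W"
  shows "x \<in> carrier V \<Longrightarrow> f x \<in> carrier W"
    and "\<lbrakk>x \<in> carrier V; y \<in> carrier V\<rbrakk> \<Longrightarrow> f (x \<oplus>\<^bsub>V\<^esub> y) = f x \<oplus>\<^bsub>W\<^esub> f y"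
    and "x \<in> carrier V \<Longrightarrow> f (c \<odot>\<^bsub>V\<^esub> x) = c \<odot>\<^bsub>W\<^esub> f x"
  using assms by (auto simp: linear_maps_def)

text \<open>The linear map with values \<open>\<beta>\<close> on the basis of a monoid algebra; with \<open>\<beta>\<close> bilinear it is the sum
  that occurs in \<open>tensor_lift\<close>.\<close>

definition linear_extension ::
  "('k::field, 'u, 'n) module_scheme \<Rightarrow> ('z \<Rightarrow> 'u) \<Rightarrow> ('z \<Rightarrow> 'k) \<Rightarrow> 'u"
  where "linear_extension U \<beta> f = (\<Oplus>\<^bsub>U\<^esub>z\<in>{z. f z \<noteq> 0}. f z \<odot>\<^bsub>U\<^esub> \<beta> z)"

context ground_algebra
begin

lemma linear_extension_on:
  assumes "finite S" "{z. f z \<noteq> 0} \<subseteq> S" "S \<subseteq> W" "\<beta> \<in> W \<rightarrow> carrier A"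
  shows "linear_extension A \<beta> f = (\<Oplus>z\<in>S. f z \<odot> \<beta> z)"
  unfolding linear_extension_def
proof (rule add.finprod_mono_neutral_cong_left)
  show "f z \<odot> \<beta> z = \<zero>" if "z \<in> S - {z. f z \<noteq> 0}" for z
  proof -
    have "\<beta> z \<in> carrier A" using that assms by blast
    then show ?thesis using that smult_l_null[of "\<beta> z"] by simp
  qed
  show "(\<lambda>z. f z \<odot> \<beta> z) \<in> S \<rightarrow> carrier A"
    using assms by (auto intro!: smult_closed)
qed (use assms in auto)

lemma linear_extension_closed:
  assumes "finite {z. f z \<noteq> 0}" "{z. f z \<noteq> 0} \<subseteq> W" "\<beta> \<in> W \<rightarrow> carrier A"
  shows "linear_extension A \<beta> f \<in> carrier A"
  unfolding linear_extension_def using assms by (intro finsum_closed) (auto intro!: smult_closed)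

lemma linear_extension_add:
  assumes f: "finite {z. f z \<noteq> 0}" "{z. f z \<noteq> 0} \<subseteq> W"
    and g: "finite {z. g z \<noteq> 0}" "{z. g z \<noteq> 0} \<subseteq> W" and \<beta>: "\<beta> \<in> W \<rightarrow> carrier A"
  shows "linear_extension A \<beta> (\<lambda>z. f z + g z) = linear_extension A \<beta> f \<oplus> linear_extension A \<beta> g"
proof -
  let ?S = "{z. f z \<noteq> 0} \<union> {z. g z \<noteq> 0}"
  have S: "finite ?S" "?S \<subseteq> W" "{z. f z + g z \<noteq> 0} \<subseteq> ?S" using f g by auto
  have carr: "\<beta> z \<in> carrier A" if "z \<in> ?S" for z using that S(2) \<beta> by blast
  have "linear_extension A \<beta> (\<lambda>z. f z + g z) = (\<Oplus>z\<in>?S. (f z + g z) \<odot> \<beta> z)"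
    by (rule linear_extension_on[OF S(1,3,2) \<beta>])
  also have "\<dots> = (\<Oplus>z\<in>?S. f z \<odot> \<beta> z \<oplus> g z \<odot> \<beta> z)"
  proof (rule finsum_cong')
    show "(f z + g z) \<odot> \<beta> z = f z \<odot> \<beta> z \<oplus> g z \<odot> \<beta> z" if "z \<in> ?S" for z
      using smult_l_distr[of "f z" "g z" "\<beta> z"] carr[OF that] by simp
  qed (use carr in \<open>auto intro!: smult_closed\<close>)
  also have "\<dots> = (\<Oplus>z\<in>?S. f z \<odot> \<beta> z) \<oplus> (\<Oplus>z\<in>?S. g z \<odot> \<beta> z)"
    by (rule finsum_addf) (use carr in \<open>auto intro!: smult_closed\<close>)
  also have "\<dots> = linear_extension A \<beta> f \<oplus> linear_extension A \<beta> g"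
    by (subst (1 2) linear_extension_on[OF S(1) _ S(2) \<beta>]) auto
  finally show ?thesis .
qed

lemma linear_extension_zero [simp]: "linear_extension A \<beta> (\<lambda>z. 0) = \<zero>"
  by (simp add: linear_extension_def)

lemma linear_extension_scale:
  assumes f: "finite {z. f z \<noteq> 0}" "{z. f z \<noteq> 0} \<subseteq> W" and \<beta>: "\<beta> \<in> W \<rightarrow> carrier A"
  shows "linear_extension A \<beta> (\<lambda>z. c * f z) = c \<odot> linear_extension A \<beta> f"
proof -
  let ?S = "{z. f z \<noteq> 0}"
  have carr: "\<beta> z \<in> carrier A" if "z \<in> ?S" for z using that f(2) \<beta> by blast
  have "linear_extension A \<beta> (\<lambda>z. c * f z) = (\<Oplus>z\<in>?S. (c * f z) \<odot> \<beta> z)"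
    by (rule linear_extension_on[OF f(1) _ f(2) \<beta>]) auto
  also have "\<dots> = (\<Oplus>z\<in>?S. c \<odot> (f z \<odot> \<beta> z))"
  proof (rule finsum_cong')
    show "(c * f z) \<odot> \<beta> z = c \<odot> (f z \<odot> \<beta> z)" if "z \<in> ?S" for z
      using smult_assoc1[of c "f z" "\<beta> z"] carr[OF that] by simp
  qed (use carr in \<open>auto intro!: smult_closed\<close>)
  also have "\<dots> = c \<odot> linear_extension A \<beta> f"
    unfolding linear_extension_def
    by (rule finsum_smult_ldistr[symmetric]) (use f(1) carr in \<open>auto intro!: smult_closed\<close>)
  finally show ?thesis .
qed

lemma linear_extension_basis_vec:
  assumes "\<beta> z \<in> carrier A"
  shows "linear_extension A \<beta> (basis_vec z) = \<beta> z"
proof -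
  have "linear_extension A \<beta> (basis_vec z) = (\<Oplus>y\<in>{z}. basis_vec z y \<odot> \<beta> y)"
    by (simp add: linear_extension_def)
  also have "\<dots> = \<one>\<^bsub>ground\<^esub> \<odot> \<beta> z"
    using assms by (subst finsum_insert) (auto simp: basis_vec_def intro!: smult_closed r_zero)
  also have "\<dots> = \<beta> z" using assms by (rule smult_one)
  finally show ?thesis .
qed

end

definition bilinear_map ::
  "('k::field, 'v, 'm) module_scheme \<Rightarrow> ('k, 'w, 'n) module_scheme \<Rightarrow>
    ('k, 'u, 'o) module_scheme \<Rightarrow> ('v \<Rightarrow> 'w \<Rightarrow> 'u) \<Rightarrow> bool"
  where "bilinear_map V W U \<beta> \<longleftrightarrow>
    (\<forall>v\<in>carrier V. \<beta> v \<in> linear_maps W U) \<and> (\<forall>w\<in>carrier W. (\<lambda>v. \<beta> v w) \<in> linear_maps V U)"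

locale tensor_factors = V: ground_algebra V + W: ground_algebra W
  for V :: "('k::field, 'v, 'm) module_scheme" and W :: "('k, 'w, 'n) module_scheme"
begin

abbreviation "F \<equiv> monoid_algebra (V \<times>\<times> W) :: ('k, 'v \<times> 'w \<Rightarrow> 'k) module"

sublocale F: ground_algebra F
  by (intro monoid_algebra_ground_algebra DirProd_monoid V.monoid_axioms W.monoid_axioms)

\<comment> \<open>The calculations below use the ring axioms, not the description of the elements as functions.\<close>
declare monoid_algebra_simps [simp del]

lemma basis_vec_closed:
  "\<lbrakk>v \<in> carrier V; w \<in> carrier W\<rbrakk> \<Longrightarrow> basis_vec (v, w) \<in> carrier F"
  by (simp add: monoid_algebra_simps)

lemma tensor_relationsI:
  "\<lbrakk>v \<in> carrier V; v' \<in> carrier V; w \<in> carrier W\<rbrakk> \<Longrightarrow>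
    basis_vec (v \<oplus>\<^bsub>V\<^esub> v', w) \<ominus>\<^bsub>F\<^esub> (basis_vec (v, w) \<oplus>\<^bsub>F\<^esub> basis_vec (v', w)) \<in> tensor_relations V W"
  "\<lbrakk>v \<in> carrier V; w \<in> carrier W; w' \<in> carrier W\<rbrakk> \<Longrightarrow>
    basis_vec (v, w \<oplus>\<^bsub>W\<^esub> w') \<ominus>\<^bsub>F\<^esub> (basis_vec (v, w) \<oplus>\<^bsub>F\<^esub> basis_vec (v, w')) \<in> tensor_relations V W"
  "\<lbrakk>v \<in> carrier V; w \<in> carrier W\<rbrakk> \<Longrightarrow>
    basis_vec (c \<odot>\<^bsub>V\<^esub> v, w) \<ominus>\<^bsub>F\<^esub> c \<odot>\<^bsub>F\<^esub> basis_vec (v, w) \<in> tensor_relations V W"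
  "\<lbrakk>v \<in> carrier V; w \<in> carrier W\<rbrakk> \<Longrightarrow>
    basis_vec (v, c \<odot>\<^bsub>W\<^esub> w) \<ominus>\<^bsub>F\<^esub> c \<odot>\<^bsub>F\<^esub> basis_vec (v, w) \<in> tensor_relations V W"
  unfolding tensor_relations_def Let_def by blast+

lemma tensor_relationsE:
  assumes "r \<in> tensor_relations V W"
  obtains
    (add_left) v v' w where "v \<in> carrier V" "v' \<in> carrier V" "w \<in> carrier W"
      "r = basis_vec (v \<oplus>\<^bsub>V\<^esub> v', w) \<ominus>\<^bsub>F\<^esub> (basis_vec (v, w) \<oplus>\<^bsub>F\<^esub> basis_vec (v', w))"
  | (add_right) v w w' where "v \<in> carrier V" "w \<in> carrier W" "w' \<in> carrier W"
      "r = basis_vec (v, w \<oplus>\<^bsub>W\<^esub> w') \<ominus>\<^bsub>F\<^esub> (basis_vec (v, w) \<oplus>\<^bsub>F\<^esub> basis_vec (v, w'))"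
  | (smult_left) c v w where "v \<in> carrier V" "w \<in> carrier W"
      "r = basis_vec (c \<odot>\<^bsub>V\<^esub> v, w) \<ominus>\<^bsub>F\<^esub> c \<odot>\<^bsub>F\<^esub> basis_vec (v, w)"
  | (smult_right) c v w where "v \<in> carrier V" "w \<in> carrier W"
      "r = basis_vec (v, c \<odot>\<^bsub>W\<^esub> w) \<ominus>\<^bsub>F\<^esub> c \<odot>\<^bsub>F\<^esub> basis_vec (v, w)"
  using assms unfolding tensor_relations_def Let_def
  by (elim UnE CollectE exE conjE)
    (rule add_left add_right smult_left smult_right; assumption)+

lemma tensor_relations_closed: "tensor_relations V W \<subseteq> carrier F"
proof
  fix r assume "r \<in> tensor_relations V W"
  then show "r \<in> carrier F"
    by (cases rule: tensor_relationsE) (simp_all add: basis_vec_closed F.smult_closed)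
qed

lemma tensor_null_subspace: "submodule (tensor_null V W) ground F"
  unfolding tensor_null_def using tensor_relations_closed by (rule F.lin_span_subspace)

text \<open>A basis element times a bilinearity relation is again a bilinearity relation, because multiplication by a
  fixed element is linear.  This is why the tensor product inherits a product.\<close>

lemma tensor_relations_mult:
  assumes "r \<in> tensor_relations V W" and a: "a \<in> carrier V" and b: "b \<in> carrier W"
  shows "basis_vec (a, b) \<otimes>\<^bsub>F\<^esub> r \<in> tensor_relations V W
    \<and> r \<otimes>\<^bsub>F\<^esub> basis_vec (a, b) \<in> tensor_relations V W"
  using assms(1)
proof (cases rule: tensor_relationsE)
  case (add_left v v' w)
  note [simp] = basis_vec_closed F.smult_closed F.mult_minus_right F.mult_minus_left basis_vec_mult
    F.r_distr F.l_distr V.r_distr V.l_distr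
  show ?thesis
    using add_left a b tensor_relationsI(1)[of "a \<otimes>\<^bsub>V\<^esub> v" "a \<otimes>\<^bsub>V\<^esub> v'" "b \<otimes>\<^bsub>W\<^esub> w"]
      tensor_relationsI(1)[of "v \<otimes>\<^bsub>V\<^esub> a" "v' \<otimes>\<^bsub>V\<^esub> a" "w \<otimes>\<^bsub>W\<^esub> b"]
    by simp
next
  case (add_right v w w')
  note [simp] = basis_vec_closed F.smult_closed F.mult_minus_right F.mult_minus_left basis_vec_mult
    F.r_distr F.l_distr W.r_distr W.l_distr
  show ?thesis
    using add_right a b tensor_relationsI(2)[of "a \<otimes>\<^bsub>V\<^esub> v" "b \<otimes>\<^bsub>W\<^esub> w" "b \<otimes>\<^bsub>W\<^esub> w'"]
      tensor_relationsI(2)[of "v \<otimes>\<^bsub>V\<^esub> a" "w \<otimes>\<^bsub>W\<^esub> b" "w' \<otimes>\<^bsub>W\<^esub> b"]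
    by simp
next
  case (smult_left c v w)
  note [simp] = basis_vec_closed F.smult_closed F.mult_minus_right F.mult_minus_left basis_vec_mult
    F.smult_mult_left F.smult_mult_right V.smult_mult_left V.smult_mult_right V.smult_closed
  show ?thesis
    using smult_left a b tensor_relationsI(3)[of "a \<otimes>\<^bsub>V\<^esub> v" "b \<otimes>\<^bsub>W\<^esub> w" c]
      tensor_relationsI(3)[of "v \<otimes>\<^bsub>V\<^esub> a" "w \<otimes>\<^bsub>W\<^esub> b" c]
    by simp
next
  case (smult_right c v w)
  note [simp] = basis_vec_closed F.smult_closed F.mult_minus_right F.mult_minus_left basis_vec_mult
    F.smult_mult_left F.smult_mult_right W.smult_mult_left W.smult_mult_right W.smult_closed
  show ?thesis
    using smult_right a b tensor_relationsI(4)[of "a \<otimes>\<^bsub>V\<^esub> v" "b \<otimes>\<^bsub>W\<^esub> w" c]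
      tensor_relationsI(4)[of "v \<otimes>\<^bsub>V\<^esub> a" "w \<otimes>\<^bsub>W\<^esub> b" c]
    by simp
qed

lemma F_induct [consumes 1, case_names zero add]:
  assumes "f \<in> carrier F" "P \<zero>\<^bsub>F\<^esub>"
    and "\<And>f c v w. \<lbrakk>f \<in> carrier F; v \<in> carrier V; w \<in> carrier W; P f\<rbrakk>
      \<Longrightarrow> P (f \<oplus>\<^bsub>F\<^esub> c \<odot>\<^bsub>F\<^esub> basis_vec (v, w))"
  shows "P f"
proof -
  have "finite {m. f m \<noteq> 0}" "{m. f m \<noteq> 0} \<subseteq> carrier V \<times> carrier W"
    using assms(1) by (simp_all add: monoid_algebra_simps)
  then show ?thesis
  proof (induction rule: finite_support_induct)
    case zero
    then show ?case using assms(2) by (simp add: monoid_algebra_simps)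
  next
    case (add f c m)
    then show ?case using assms(3)[of f "fst m" "snd m" c] by (auto simp: monoid_algebra_simps)
  qed
qed

lemma tensor_null_ideal: "ideal (tensor_null V W) F"
proof -
  let ?N = "tensor_null V W"
  note N = F.subspaceD[OF tensor_null_subspace]
  have rel: "tensor_relations V W \<subseteq> ?N"
    unfolding tensor_null_def by (rule F.lin_span_superset)
  have left: "f \<otimes>\<^bsub>F\<^esub> r \<in> ?N" if r: "r \<in> tensor_relations V W" and f: "f \<in> carrier F" for f r
    using f
  proof (induction rule: F_induct)
    case zero
    then show ?case using r tensor_relations_closed N(2) by (simp add: subset_eq)
  next
    case (add f c v w)
    have "(f \<oplus>\<^bsub>F\<^esub> c \<odot>\<^bsub>F\<^esub> basis_vec (v, w)) \<otimes>\<^bsub>F\<^esub> r =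
        f \<otimes>\<^bsub>F\<^esub> r \<oplus>\<^bsub>F\<^esub> c \<odot>\<^bsub>F\<^esub> (basis_vec (v, w) \<otimes>\<^bsub>F\<^esub> r)"
      using add r tensor_relations_closed
      by (simp add: subset_eq basis_vec_closed F.smult_closed F.l_distr F.smult_mult_left)
    then show ?case using add tensor_relations_mult[OF r, of v w] rel by (auto intro!: N(3,4))
  qed
  have right: "r \<otimes>\<^bsub>F\<^esub> f \<in> ?N" if r: "r \<in> tensor_relations V W" and f: "f \<in> carrier F" for f r
    using f
  proof (induction rule: F_induct)
    case zero
    then show ?case using r tensor_relations_closed N(2) by (simp add: subset_eq)
  next
    case (add f c v w)
    have "r \<otimes>\<^bsub>F\<^esub> (f \<oplus>\<^bsub>F\<^esub> c \<odot>\<^bsub>F\<^esub> basis_vec (v, w)) =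
        r \<otimes>\<^bsub>F\<^esub> f \<oplus>\<^bsub>F\<^esub> c \<odot>\<^bsub>F\<^esub> (r \<otimes>\<^bsub>F\<^esub> basis_vec (v, w))"
      using add r tensor_relations_closed
      by (simp add: subset_eq basis_vec_closed F.smult_closed F.r_distr F.smult_mult_right)
    then show ?case using add tensor_relations_mult[OF r, of v w] rel by (auto intro!: N(3,4))
  qed
  let ?L = "{n \<in> carrier F. \<forall>f\<in>carrier F. f \<otimes>\<^bsub>F\<^esub> n \<in> ?N \<and> n \<otimes>\<^bsub>F\<^esub> f \<in> ?N}"
  have "submodule ?L ground F"
    by (rule F.subspaceI)
      (auto simp: N F.l_distr F.r_distr F.smult_mult_left F.smult_mult_right F.smult_closed)
  moreover have "tensor_relations V W \<subseteq> ?L"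
    using left right tensor_relations_closed by auto
  ultimately have "?N \<subseteq> ?L"
    unfolding tensor_null_def by (rule F.lin_span_minimal)
  then show ?thesis
    using tensor_null_subspace by (intro F.subspace_idealI) auto
qed

sublocale Q: algebra_quotient F "tensor_null V W"
  by (intro algebra_quotient.intro F.ground_algebra_axioms tensor_null_ideal)

sublocale T: ground_algebra "tensor_product V W"
  unfolding tensor_product_def by (rule Q.quotient_ground_algebra)

lemma tensor_closed [simp]:
  "\<lbrakk>v \<in> carrier V; w \<in> carrier W\<rbrakk> \<Longrightarrow> tensor V W v w \<in> carrier (tensor_product V W)"
  by (simp add: tensor_def tensor_product_def basis_vec_closed)

lemma tensor_mult:
  "\<lbrakk>v \<in> carrier V; w \<in> carrier W; v' \<in> carrier V; w' \<in> carrier W\<rbrakk> \<Longrightarrow>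
    tensor V W v w \<otimes>\<^bsub>tensor_product V W\<^esub> tensor V W v' w' = tensor V W (v \<otimes>\<^bsub>V\<^esub> v') (w \<otimes>\<^bsub>W\<^esub> w')"
  by (simp add: tensor_def tensor_product_def basis_vec_closed Q.coset_mult basis_vec_mult)

context
  fixes U :: "('k, 'u, 'o) module_scheme" and \<beta> :: "'v \<Rightarrow> 'w \<Rightarrow> 'u"
  assumes U: "ground_algebra U" and \<beta>: "bilinear_map V W U \<beta>"
begin

interpretation U: ground_algebra U by (fact U)

private abbreviation "L \<equiv> linear_extension U (\<lambda>z. \<beta> (fst z) (snd z))"

private lemma \<beta>_closed: "\<lbrakk>v \<in> carrier V; w \<in> carrier W\<rbrakk> \<Longrightarrow> \<beta> v w \<in> carrier U"
  using \<beta> by (auto simp: bilinear_map_def linear_maps_def)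

private lemma \<beta>_Pi: "(\<lambda>z. \<beta> (fst z) (snd z)) \<in> carrier V \<times> carrier W \<rightarrow> carrier U"
  using \<beta>_closed by auto

private lemma support: "f \<in> carrier F \<Longrightarrow> finite {z. f z \<noteq> 0}"
  "f \<in> carrier F \<Longrightarrow> {z. f z \<noteq> 0} \<subseteq> carrier V \<times> carrier W"
  by (simp_all add: monoid_algebra_simps)

private lemma L_closed: "f \<in> carrier F \<Longrightarrow> L f \<in> carrier U"
  by (rule U.linear_extension_closed[OF support \<beta>_Pi])

private lemma L_add: "\<lbrakk>f \<in> carrier F; g \<in> carrier F\<rbrakk> \<Longrightarrow> L (f \<oplus>\<^bsub>F\<^esub> g) = L f \<oplus>\<^bsub>U\<^esub> L g"
  using U.linear_extension_add[OF support(1,2) support(1,2) \<beta>_Pi, of f g] by (simp add: monoid_algebra_simps)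

private lemma L_scale: "f \<in> carrier F \<Longrightarrow> L (c \<odot>\<^bsub>F\<^esub> f) = c \<odot>\<^bsub>U\<^esub> L f"
  using U.linear_extension_scale[OF support(1,2) \<beta>_Pi, of f c] by (simp add: monoid_algebra_simps)

private lemma L_basis: "\<lbrakk>v \<in> carrier V; w \<in> carrier W\<rbrakk> \<Longrightarrow> L (basis_vec (v, w)) = \<beta> v w"
  using U.linear_extension_basis_vec[of "\<lambda>z. \<beta> (fst z) (snd z)" "(v, w)"] \<beta>_closed by simp

private lemma L_minus: "\<lbrakk>f \<in> carrier F; g \<in> carrier F\<rbrakk> \<Longrightarrow> L (f \<ominus>\<^bsub>F\<^esub> g) = L f \<ominus>\<^bsub>U\<^esub> L g"
  using L_add[of f "(-1) \<odot>\<^bsub>F\<^esub> g"] L_scale[of g "-1"] L_closed[of g]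
  by (simp add: a_minus_def F.smult_minus_one U.smult_minus_one)

private lemma L_null: "f \<in> tensor_null V W \<Longrightarrow> L f = \<zero>\<^bsub>U\<^esub>"
proof -
  let ?K = "{f \<in> carrier F. L f = \<zero>\<^bsub>U\<^esub>}"
  have "submodule ?K ground F"
  proof (rule F.subspaceI)
    show "\<zero>\<^bsub>F\<^esub> \<in> ?K"
      using F.zero_closed U.linear_extension_zero by (simp add: monoid_algebra_simps)
  qed (auto simp: L_add L_scale F.smult_closed intro!: U.smult_r_null)
  moreover have "tensor_relations V W \<subseteq> ?K"
  proof
    fix r assume r: "r \<in> tensor_relations V W"
    then have "r \<in> carrier F" using tensor_relations_closed by blast
    moreover have "L r = \<zero>\<^bsub>U\<^esub>"
      using r
    proof (cases rule: tensor_relationsE)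
      case (add_left v v' w)
      moreover from this have "\<beta> (v \<oplus>\<^bsub>V\<^esub> v') w = \<beta> v w \<oplus>\<^bsub>U\<^esub> \<beta> v' w"
        using \<beta> by (auto simp: bilinear_map_def linear_maps_def)
      ultimately show ?thesis
        by (simp add: basis_vec_closed L_minus L_add L_basis \<beta>_closed U.r_right_minus_eq)
    next
      case (add_right v w w')
      moreover from this have "\<beta> v (w \<oplus>\<^bsub>W\<^esub> w') = \<beta> v w \<oplus>\<^bsub>U\<^esub> \<beta> v w'"
        using \<beta> by (auto simp: bilinear_map_def linear_maps_def)
      ultimately show ?thesis
        by (simp add: basis_vec_closed L_minus L_add L_basis \<beta>_closed U.r_right_minus_eq)
    next
      case (smult_left c v w)
      moreover from this have "\<beta> (c \<odot>\<^bsub>V\<^esub> v) w = c \<odot>\<^bsub>U\<^esub> \<beta> v w"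
        using \<beta> by (auto simp: bilinear_map_def linear_maps_def)
      ultimately show ?thesis
        by (simp add: basis_vec_closed L_minus L_scale L_basis \<beta>_closed U.r_right_minus_eq
            F.smult_closed V.smult_closed U.smult_closed)
    next
      case (smult_right c v w)
      moreover from this have "\<beta> v (c \<odot>\<^bsub>W\<^esub> w) = c \<odot>\<^bsub>U\<^esub> \<beta> v w"
        using \<beta> by (auto simp: bilinear_map_def linear_maps_def)
      ultimately show ?thesis
        by (simp add: basis_vec_closed L_minus L_scale L_basis \<beta>_closed U.r_right_minus_eq
            F.smult_closed W.smult_closed U.smult_closed)
    qed
    ultimately show "r \<in> ?K" by simp
  qed
  ultimately have "tensor_null V W \<subseteq> ?K"
    unfolding tensor_null_def by (rule F.lin_span_minimal)
  then show "f \<in> tensor_null V W \<Longrightarrow> L f = \<zero>\<^bsub>U\<^esub>" by blast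
qed

private lemma tensor_lift_coset:
  assumes f: "f \<in> carrier F"
  shows "tensor_lift U \<beta> (tensor_null V W +>\<^bsub>F\<^esub> f) = L f"
proof -
  define h where "h = (SOME h. h \<in> tensor_null V W +>\<^bsub>F\<^esub> f)"
  have "h \<in> tensor_null V W +>\<^bsub>F\<^esub> f"
    unfolding h_def by (rule someI[of "\<lambda>h. h \<in> tensor_null V W +>\<^bsub>F\<^esub> f", OF Q.a_rcos_self[OF f]])
  then obtain n where n: "n \<in> tensor_null V W" "h = n \<oplus>\<^bsub>F\<^esub> f"
    by (auto simp: a_r_coset_def r_coset_def)
  then have "n \<in> carrier F" using F.subspaceD(1)[OF tensor_null_subspace] by blast
  then have "L h = L f" using n f L_null[of n] L_closed[OF f] by (simp add: L_add)
  then show ?thesis by (simp add: tensor_lift_def Let_def h_def linear_extension_def)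
qed

text \<open>\<open>tensor_lift\<close> is computed from a chosen representative.  The choice is immaterial: a bilinear map extends
  to a linear map on the formal combinations of pairs which kills the bilinearity relations.\<close>

lemma tensor_lift_tensor:
  "\<lbrakk>v \<in> carrier V; w \<in> carrier W\<rbrakk> \<Longrightarrow> tensor_lift U \<beta> (tensor V W v w) = \<beta> v w"
  by (simp add: tensor_def tensor_lift_coset basis_vec_closed L_basis)

lemma tensor_lift_add:
  assumes "x \<in> carrier (tensor_product V W)" "y \<in> carrier (tensor_product V W)"
  shows "tensor_lift U \<beta> (x \<oplus>\<^bsub>tensor_product V W\<^esub> y) = tensor_lift U \<beta> x \<oplus>\<^bsub>U\<^esub> tensor_lift U \<beta> y"
    and "tensor_lift U \<beta> x \<in> carrier U"
proof -
  obtain f g where "f \<in> carrier F" "x = tensor_null V W +>\<^bsub>F\<^esub> f"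
    "g \<in> carrier F" "y = tensor_null V W +>\<^bsub>F\<^esub> g"
    using assms by (auto simp: tensor_product_def Q.quotient_carrier)
  then show "tensor_lift U \<beta> (x \<oplus>\<^bsub>tensor_product V W\<^esub> y) = tensor_lift U \<beta> x \<oplus>\<^bsub>U\<^esub> tensor_lift U \<beta> y"
    "tensor_lift U \<beta> x \<in> carrier U"
    by (simp_all add: tensor_product_def Q.coset_add tensor_lift_coset L_add L_closed)
qed

end
end

section \<open>Presented algebras\<close>

definition presented_word :: "'x set \<Rightarrow> ('x list \<Rightarrow> 'k::field) set \<Rightarrow> 'x list \<Rightarrow> ('x list \<Rightarrow> 'k) set"
  where "presented_word S R w = (Idl\<^bsub>free_algebra S\<^esub> R) +>\<^bsub>free_algebra S\<^esub> basis_vec w"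

text \<open>A function \<open>\<phi>\<close> on words respects the relations if the largest two-sided ideal inside the kernel of its
  linear extension contains them.  Such a \<open>\<phi>\<close> induces a linear functional on the presented algebra, which
  serves to show that elements of that algebra are nonzero, without a normal form for its words.\<close>

definition respects_relations ::
  "'x set \<Rightarrow> ('x list \<Rightarrow> 'k::field) set \<Rightarrow> ('x list \<Rightarrow> 'k) \<Rightarrow> bool"
  where "respects_relations S R \<phi> \<longleftrightarrow>
    (\<forall>r\<in>R. \<forall>u\<in>lists S. \<forall>v\<in>lists S. pairing r (\<lambda>w. \<phi> (u @ w @ v)) = 0)"

definition coset_pairing :: "('m \<Rightarrow> 'k::field) \<Rightarrow> ('m \<Rightarrow> 'k) set \<Rightarrow> 'k"
  where "coset_pairing \<phi> C = pairing (SOME f. f \<in> C) \<phi>"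

locale presentation =
  fixes S :: "'x set" and R :: "('x list \<Rightarrow> 'k::field) set"
  assumes relations_closed: "R \<subseteq> carrier (free_algebra S)"
begin

abbreviation "F \<equiv> free_algebra S :: ('k, 'x list \<Rightarrow> 'k) module"
abbreviation "P \<equiv> presented_algebra S R"
abbreviation "word \<equiv> presented_word S R"

lemma words_monoid: "Group.monoid \<lparr>carrier = lists S, monoid.mult = (@), one = []\<rparr>"
  by (rule monoidI) auto

sublocale F: ground_algebra F
  unfolding free_algebra_def by (rule monoid_algebra_ground_algebra[OF words_monoid])

sublocale Q: algebra_quotient F "Idl\<^bsub>F\<^esub> R"
  by (intro algebra_quotient.intro F.ground_algebra_axioms F.genideal_ideal relations_closed)

sublocale P: ground_algebra P
  unfolding presented_algebra_def by (rule Q.quotient_ground_algebra)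

lemma F_carrier: "f \<in> carrier F \<longleftrightarrow> finite {w. f w \<noteq> 0} \<and> {w. f w \<noteq> 0} \<subseteq> lists S"
  by (simp add: free_algebra_def)

lemma basis_vec_closed: "w \<in> lists S \<Longrightarrow> basis_vec w \<in> carrier F"
  by (simp add: F_carrier)

lemma F_add: "f \<oplus>\<^bsub>F\<^esub> g = (\<lambda>w. f w + g w)" and F_smult: "c \<odot>\<^bsub>F\<^esub> f = (\<lambda>w. c * f w)"
  and F_zero: "\<zero>\<^bsub>F\<^esub> = (\<lambda>w. 0)" and F_one: "\<one>\<^bsub>F\<^esub> = basis_vec []"
  by (simp_all add: free_algebra_def)

lemma F_minus: "\<lbrakk>f \<in> carrier F; g \<in> carrier F\<rbrakk> \<Longrightarrow> f \<ominus>\<^bsub>F\<^esub> g = (\<lambda>w. f w - g w)"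
  unfolding free_algebra_def by (rule monoid_algebra_minus[OF words_monoid])

lemma word_closed: "w \<in> lists S \<Longrightarrow> word w \<in> carrier P"
  by (simp add: presented_word_def presented_algebra_def basis_vec_closed)

lemma F_mult_basis_vec: "basis_vec u \<otimes>\<^bsub>F\<^esub> basis_vec v = (basis_vec (u @ v) :: 'x list \<Rightarrow> 'k)"
  by (simp add: free_algebra_def basis_vec_mult)

lemma word_mult: "\<lbrakk>u \<in> lists S; v \<in> lists S\<rbrakk> \<Longrightarrow> word u \<otimes>\<^bsub>P\<^esub> word v = word (u @ v)"
  by (simp add: presented_word_def presented_algebra_def Q.coset_mult basis_vec_closed
      F_mult_basis_vec)

lemma word_one: "word [] = \<one>\<^bsub>P\<^esub>"
  by (simp add: presented_word_def presented_algebra_def Q.coset_one F_one)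

lemma presented_gen_eq_word: "presented_gen S R x = word [x]"
  by (simp add: presented_gen_def presented_word_def)

lemma word_relation:
  assumes "u \<in> lists S" "v \<in> lists S"
    and "basis_vec u \<ominus>\<^bsub>F\<^esub> c \<odot>\<^bsub>F\<^esub> basis_vec v \<in> R"
  shows "word u = c \<odot>\<^bsub>P\<^esub> word v"
proof -
  have "basis_vec u \<ominus>\<^bsub>F\<^esub> c \<odot>\<^bsub>F\<^esub> basis_vec v \<in> Idl\<^bsub>F\<^esub> R"
    using assms(3) F.genideal_self[OF relations_closed] by blast
  then show ?thesis
    using assms(1,2)
    by (simp add: presented_word_def presented_algebra_def Q.coset_smult basis_vec_closed
        Q.coset_eq_iff F.smult_closed)
qed

lemma word_relation_eq:
  assumes "u \<in> lists S" "v \<in> lists S" and "basis_vec u \<ominus>\<^bsub>F\<^esub> basis_vec v \<in> R"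
  shows "word u = word v"
proof -
  have "1 \<odot>\<^bsub>F\<^esub> basis_vec v = (basis_vec v :: 'x list \<Rightarrow> 'k)" by (simp add: F_smult)
  then have "word u = 1 \<odot>\<^bsub>P\<^esub> word v" using assms by (intro word_relation) simp_all
  then show ?thesis using P.smult_one[OF word_closed[OF assms(2)]] by simp
qed

definition word_span :: "'x list set \<Rightarrow> ('x list \<Rightarrow> 'k) set set"
  where "word_span W = (+>\<^bsub>F\<^esub>) (Idl\<^bsub>F\<^esub> R) ` {f \<in> carrier F. {w. f w \<noteq> 0} \<subseteq> W}"

lemma word_span_all: "word_span (lists S) = carrier P"
proof -
  have "{f \<in> carrier F. {w. f w \<noteq> 0} \<subseteq> lists S} = carrier F" using F_carrier by blast
  then show ?thesis by (simp add: word_span_def presented_algebra_def Q.quotient_carrier)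
qed

lemma word_span_subspace: "submodule (word_span W) ground P"
proof (rule P.subspaceI)
  show "word_span W \<subseteq> carrier P"
    by (auto simp: word_span_def presented_algebra_def Q.quotient_carrier)
  have "\<zero>\<^bsub>F\<^esub> \<in> {f \<in> carrier F. {w. f w \<noteq> 0} \<subseteq> W}"
    using F.zero_closed by (simp add: F_zero)
  then show "\<zero>\<^bsub>P\<^esub> \<in> word_span W"
    by (auto simp: word_span_def presented_algebra_def Q.coset_zero)
next
  fix x y assume "x \<in> word_span W" "y \<in> word_span W"
  then obtain f g where fg: "f \<in> carrier F" "{w. f w \<noteq> 0} \<subseteq> W" "x = Idl\<^bsub>F\<^esub> R +>\<^bsub>F\<^esub> f"
    "g \<in> carrier F" "{w. g w \<noteq> 0} \<subseteq> W" "y = Idl\<^bsub>F\<^esub> R +>\<^bsub>F\<^esub> g"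
    by (auto simp: word_span_def)
  moreover have "{w. (f \<oplus>\<^bsub>F\<^esub> g) w \<noteq> 0} \<subseteq> {w. f w \<noteq> 0} \<union> {w. g w \<noteq> 0}" by (auto simp: F_add)
  ultimately have "f \<oplus>\<^bsub>F\<^esub> g \<in> {f \<in> carrier F. {w. f w \<noteq> 0} \<subseteq> W}"
    using F.a_closed[of f g] by blast
  then show "x \<oplus>\<^bsub>P\<^esub> y \<in> word_span W"
    using fg by (simp add: word_span_def presented_algebra_def Q.coset_add)
next
  fix c x assume "x \<in> word_span W"
  then obtain f where f: "f \<in> carrier F" "{w. f w \<noteq> 0} \<subseteq> W" "x = Idl\<^bsub>F\<^esub> R +>\<^bsub>F\<^esub> f"
    by (auto simp: word_span_def)
  moreover have "{w. (c \<odot>\<^bsub>F\<^esub> f) w \<noteq> 0} \<subseteq> {w. f w \<noteq> 0}" by (auto simp: F_smult)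
  ultimately have "c \<odot>\<^bsub>F\<^esub> f \<in> {f \<in> carrier F. {w. f w \<noteq> 0} \<subseteq> W}"
    using F.smult_closed[of c f] by auto
  then show "c \<odot>\<^bsub>P\<^esub> x \<in> word_span W"
    using f by (simp add: word_span_def presented_algebra_def Q.coset_smult)
qed

lemma word_in_span: "\<lbrakk>w \<in> W; w \<in> lists S\<rbrakk> \<Longrightarrow> word w \<in> word_span W"
  by (auto simp: word_span_def presented_word_def basis_vec_closed)

lemma word_span_induct [consumes 2, case_names zero add]:
  assumes "x \<in> word_span W" "W \<subseteq> lists S"
    and zero: "Prop \<zero>\<^bsub>P\<^esub>"
    and add: "\<And>x c w. \<lbrakk>x \<in> word_span W; w \<in> W; Prop x\<rbrakk> \<Longrightarrow> Prop (x \<oplus>\<^bsub>P\<^esub> c \<odot>\<^bsub>P\<^esub> word w)"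
  shows "Prop x"
proof -
  obtain f where f: "f \<in> carrier F" "{w. f w \<noteq> 0} \<subseteq> W" "x = Idl\<^bsub>F\<^esub> R +>\<^bsub>F\<^esub> f"
    using assms(1) by (auto simp: word_span_def)
  have "finite {w. f w \<noteq> 0}" using f by (simp add: F_carrier)
  then have "Prop (Idl\<^bsub>F\<^esub> R +>\<^bsub>F\<^esub> f)" using f(2)
  proof (induction rule: finite_support_induct)
    case zero
    then show ?case using assms(3) by (simp add: presented_algebra_def Q.coset_zero F_zero)
  next
    case (add f c w)
    have f: "f \<in> carrier F" using add.hyps assms(2) unfolding F_carrier by blast
    have w: "w \<in> lists S" using add.hyps assms(2) by blast
    have "Idl\<^bsub>F\<^esub> R +>\<^bsub>F\<^esub> (\<lambda>x. f x + c * basis_vec w x) = (Idl\<^bsub>F\<^esub> R +>\<^bsub>F\<^esub> f) \<oplus>\<^bsub>P\<^esub> c \<odot>\<^bsub>P\<^esub> word w"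
      using f w basis_vec_closed[OF w] F.smult_closed[of c "basis_vec w"]
      by (simp add: presented_algebra_def presented_word_def Q.coset_smult Q.coset_add)
        (simp add: F_add F_smult)
    moreover have "Idl\<^bsub>F\<^esub> R +>\<^bsub>F\<^esub> f \<in> word_span W"
      using f add.hyps by (auto simp: word_span_def)
    ultimately show ?case using assms(4)[of "Idl\<^bsub>F\<^esub> R +>\<^bsub>F\<^esub> f" w c] add by simp
  qed
  then show ?thesis using f by simp
qed

text \<open>The elements whose two-sided translates by words all pair to zero with \<open>\<phi>\<close> form an ideal.\<close>

lemma ideal_pairing_zero:
  assumes \<phi>: "respects_relations S R \<phi>" and f: "f \<in> Idl\<^bsub>F\<^esub> R"
  shows "pairing f \<phi> = 0"
proof -
  let ?K = "{f \<in> carrier F. \<forall>u\<in>lists S. \<forall>v\<in>lists S. pairing f (\<lambda>w. \<phi> (u @ w @ v)) = 0}"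
  have mult: "pairing (f \<otimes>\<^bsub>F\<^esub> g) \<psi> = pairing f (\<lambda>a. pairing g (\<lambda>b. \<psi> (a @ b)))"
    if "f \<in> carrier F" "g \<in> carrier F" for f g \<psi>
    using pairing_mult[of f g "\<lparr>carrier = lists S, monoid.mult = (@), one = []\<rparr>" \<psi>] that
    by (simp add: F_carrier) (simp add: free_algebra_def)
  have "ideal ?K F"
  proof (rule F.subspace_idealI)
    show "submodule ?K ground F"
    proof (rule F.subspaceI)
      show "\<zero>\<^bsub>F\<^esub> \<in> ?K" using F.zero_closed by (simp add: F_zero pairing_def)
    next
      fix f g assume "f \<in> ?K" "g \<in> ?K"
      then show "f \<oplus>\<^bsub>F\<^esub> g \<in> ?K"
        using F.a_closed[of f g] by (simp add: F_add pairing_add F_carrier)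
    next
      fix c f assume "f \<in> ?K"
      then show "c \<odot>\<^bsub>F\<^esub> f \<in> ?K"
        using F.smult_closed[of c f] by (simp add: F_smult pairing_scale)
    qed auto
  next
    fix f g assume f: "f \<in> ?K" and g: "g \<in> carrier F"
    have "pairing (g \<otimes>\<^bsub>F\<^esub> f) (\<lambda>w. \<phi> (u @ w @ v)) = 0" if uv: "u \<in> lists S" "v \<in> lists S" for u v
    proof -
      have "pairing (g \<otimes>\<^bsub>F\<^esub> f) (\<lambda>w. \<phi> (u @ w @ v))
          = pairing g (\<lambda>a. pairing f (\<lambda>b. \<phi> ((u @ a) @ b @ v)))"
        using f g by (simp add: mult)
      also have "\<dots> = pairing g (\<lambda>a. 0)"
      proof (rule pairing_cong)
        fix a assume "g a \<noteq> 0"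
        then have "a \<in> lists S" using g unfolding F_carrier by blast
        then have "u @ a \<in> lists S" using uv by simp
        then show "pairing f (\<lambda>b. \<phi> ((u @ a) @ b @ v)) = 0" using f uv by blast
      qed
      finally show ?thesis by simp
    qed
    then show "g \<otimes>\<^bsub>F\<^esub> f \<in> ?K" using f g by simp
    have "pairing (f \<otimes>\<^bsub>F\<^esub> g) (\<lambda>w. \<phi> (u @ w @ v)) = 0" if uv: "u \<in> lists S" "v \<in> lists S" for u v
    proof -
      have "pairing (f \<otimes>\<^bsub>F\<^esub> g) (\<lambda>w. \<phi> (u @ w @ v))
          = pairing f (\<lambda>a. pairing g (\<lambda>b. \<phi> (u @ a @ (b @ v))))"
        using f g by (simp add: mult)
      also have "\<dots> = pairing g (\<lambda>b. pairing f (\<lambda>a. \<phi> (u @ a @ (b @ v))))"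
        unfolding pairing_def sum_distrib_left by (subst sum.swap) (simp add: mult_ac)
      also have "\<dots> = pairing g (\<lambda>b. 0)"
      proof (rule pairing_cong)
        fix b assume "g b \<noteq> 0"
        then have "b \<in> lists S" using g unfolding F_carrier by blast
        then have "b @ v \<in> lists S" using uv by simp
        then show "pairing f (\<lambda>a. \<phi> (u @ a @ (b @ v))) = 0" using f uv by blast
      qed
      finally show ?thesis by simp
    qed
    then show "f \<otimes>\<^bsub>F\<^esub> g \<in> ?K" using f g by simp
  qed
  moreover have "R \<subseteq> ?K"
    using \<phi> relations_closed by (auto simp: respects_relations_def)
  ultimately have "Idl\<^bsub>F\<^esub> R \<subseteq> ?K" by (rule F.genideal_minimal)
  then have "\<forall>u\<in>lists S. \<forall>v\<in>lists S. pairing f (\<lambda>w. \<phi> (u @ w @ v)) = 0" using f by blast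
  from bspec[OF bspec[OF this, of "[]"], of "[]"] show ?thesis by simp
qed

context
  fixes \<phi> :: "'x list \<Rightarrow> 'k" assumes \<phi>: "respects_relations S R \<phi>"
begin

lemma coset_pairing_coset:
  assumes f: "f \<in> carrier F"
  shows "coset_pairing \<phi> (Idl\<^bsub>F\<^esub> R +>\<^bsub>F\<^esub> f) = pairing f \<phi>"
proof -
  define h where "h = (SOME h. h \<in> Idl\<^bsub>F\<^esub> R +>\<^bsub>F\<^esub> f)"
  have "h \<in> Idl\<^bsub>F\<^esub> R +>\<^bsub>F\<^esub> f"
    unfolding h_def by (rule someI[of "\<lambda>h. h \<in> Idl\<^bsub>F\<^esub> R +>\<^bsub>F\<^esub> f", OF Q.a_rcos_self[OF f]])
  then obtain j where j: "j \<in> Idl\<^bsub>F\<^esub> R" "h = j \<oplus>\<^bsub>F\<^esub> f"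
    by (auto simp: a_r_coset_def r_coset_def)
  then have "j \<in> carrier F" using Q.a_subset by blast
  then have "pairing h \<phi> = pairing f \<phi>"
    using j f ideal_pairing_zero[OF \<phi> j(1)] by (simp add: F_add pairing_add F_carrier)
  then show ?thesis by (simp add: coset_pairing_def h_def)
qed

lemma coset_pairing_word: "w \<in> lists S \<Longrightarrow> coset_pairing \<phi> (word w) = \<phi> w"
  by (simp add: presented_word_def coset_pairing_coset basis_vec_closed)

lemma coset_pairing_add:
  assumes "x \<in> carrier P" "y \<in> carrier P"
  shows "coset_pairing \<phi> (x \<oplus>\<^bsub>P\<^esub> y) = coset_pairing \<phi> x + coset_pairing \<phi> y"
proof -
  obtain f g where fg: "f \<in> carrier F" "x = Idl\<^bsub>F\<^esub> R +>\<^bsub>F\<^esub> f" "g \<in> carrier F" "y = Idl\<^bsub>F\<^esub> R +>\<^bsub>F\<^esub> g"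
    using assms by (auto simp: presented_algebra_def Q.quotient_carrier)
  then have "coset_pairing \<phi> (x \<oplus>\<^bsub>P\<^esub> y) = pairing (f \<oplus>\<^bsub>F\<^esub> g) \<phi>"
    by (simp add: presented_algebra_def Q.coset_add coset_pairing_coset)
  also have "\<dots> = pairing f \<phi> + pairing g \<phi>"
    using fg by (simp add: F_add pairing_add F_carrier)
  finally show ?thesis using fg by (simp add: coset_pairing_coset)
qed

lemma coset_pairing_smult:
  assumes "x \<in> carrier P"
  shows "coset_pairing \<phi> (c \<odot>\<^bsub>P\<^esub> x) = c * coset_pairing \<phi> x"
proof -
  obtain f where f: "f \<in> carrier F" "x = Idl\<^bsub>F\<^esub> R +>\<^bsub>F\<^esub> f"
    using assms by (auto simp: presented_algebra_def Q.quotient_carrier)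
  then have "coset_pairing \<phi> (c \<odot>\<^bsub>P\<^esub> x) = pairing (c \<odot>\<^bsub>F\<^esub> f) \<phi>"
    by (simp add: presented_algebra_def Q.coset_smult coset_pairing_coset F.smult_closed)
  then show ?thesis using f by (simp add: F_smult pairing_scale coset_pairing_coset)
qed

lemma coset_pairing_zero: "coset_pairing \<phi> \<zero>\<^bsub>P\<^esub> = 0"
  by (simp add: presented_algebra_def Q.coset_zero coset_pairing_coset) (simp add: F_zero pairing_def)

end
end

context presentation
begin

lemma pairing_relation:
  assumes "a \<in> lists S" "b \<in> lists S"
  shows "pairing (basis_vec a \<ominus>\<^bsub>F\<^esub> c \<odot>\<^bsub>F\<^esub> basis_vec b) \<phi> = \<phi> a - c * \<phi> b"
proof -
  have "basis_vec a \<ominus>\<^bsub>F\<^esub> c \<odot>\<^bsub>F\<^esub> basis_vec b = (\<lambda>w. basis_vec a w + (- c) * basis_vec b w :: 'k)"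
    using assms basis_vec_closed F.smult_closed[of c "basis_vec b"]
    by (simp add: F_minus) (simp add: F_smult)
  moreover have "finite {w. (- c) * basis_vec b w \<noteq> (0 :: 'k)}"
    by (rule finite_support_scale) simp
  ultimately show ?thesis
    by (simp only: pairing_add[of "basis_vec a" "\<lambda>w. (- c) * basis_vec b w"] support_basis_vec
        finite.intros pairing_scale pairing_basis_vec)
      simp
qed

lemma F_smult_one: "(1 \<odot>\<^bsub>F\<^esub> f :: 'x list \<Rightarrow> 'k) = f"
  by (simp add: F_smult)

lemma word_span_ideal:
  assumes W: "W \<subseteq> lists S"
    and ext: "\<And>u w v. \<lbrakk>u \<in> lists S; w \<in> W; v \<in> lists S\<rbrakk> \<Longrightarrow> u @ w @ v \<in> W"
  shows "ideal (word_span W) P"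
proof (rule P.subspace_idealI)
  note sub = P.subspaceD[OF word_span_subspace[of W]]
  have w: "w \<in> lists S" if "w \<in> W" for w using that W by blast
  fix x y assume x: "x \<in> word_span W" and y: "y \<in> carrier P"
  have y': "y \<in> word_span (lists S)" using y by (simp add: word_span_all)
  have left: "word u \<otimes>\<^bsub>P\<^esub> x \<in> word_span W" if u: "u \<in> lists S" for u
    using x W
  proof (induction rule: word_span_induct)
    case zero
    then show ?case using u sub(2) by (simp add: word_closed)
  next
    case (add x c v)
    have xc: "x \<in> carrier P" using add.hyps sub(1) by blast
    have v: "v \<in> lists S" using add.hyps W by blast
    have "word u \<otimes>\<^bsub>P\<^esub> (x \<oplus>\<^bsub>P\<^esub> c \<odot>\<^bsub>P\<^esub> word v) = word u \<otimes>\<^bsub>P\<^esub> x \<oplus>\<^bsub>P\<^esub> c \<odot>\<^bsub>P\<^esub> word (u @ v)"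
      using xc u v by (simp add: P.r_distr P.smult_mult_right P.smult_closed word_closed word_mult)
    moreover have "word (u @ v) \<in> word_span W"
      using ext[of u v "[]"] u v add.hyps by (intro word_in_span) auto
    ultimately show ?case using add sub(3,4) by simp
  qed
  have right: "x \<otimes>\<^bsub>P\<^esub> word u \<in> word_span W" if u: "u \<in> lists S" for u
    using x W
  proof (induction rule: word_span_induct)
    case zero
    then show ?case using u sub(2) by (simp add: word_closed)
  next
    case (add x c v)
    have xc: "x \<in> carrier P" using add.hyps sub(1) by blast
    have v: "v \<in> lists S" using add.hyps W by blast
    have "(x \<oplus>\<^bsub>P\<^esub> c \<odot>\<^bsub>P\<^esub> word v) \<otimes>\<^bsub>P\<^esub> word u = x \<otimes>\<^bsub>P\<^esub> word u \<oplus>\<^bsub>P\<^esub> c \<odot>\<^bsub>P\<^esub> word (v @ u)"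
      using xc u v by (simp add: P.l_distr P.smult_mult_left P.smult_closed word_closed word_mult)
    moreover have "word (v @ u) \<in> word_span W"
      using ext[of "[]" v u] u v add.hyps by (intro word_in_span) auto
    ultimately show ?case using add sub(3,4) by simp
  qed
  have xc: "x \<in> carrier P" using x sub(1) by blast
  show "y \<otimes>\<^bsub>P\<^esub> x \<in> word_span W"
    using y' subset_refl
  proof (induction rule: word_span_induct)
    case zero
    then show ?case using xc sub(2) by simp
  next
    case (add y c u)
    have yc: "y \<in> carrier P" using add.hyps by (simp add: word_span_all)
    have "(y \<oplus>\<^bsub>P\<^esub> c \<odot>\<^bsub>P\<^esub> word u) \<otimes>\<^bsub>P\<^esub> x = y \<otimes>\<^bsub>P\<^esub> x \<oplus>\<^bsub>P\<^esub> c \<odot>\<^bsub>P\<^esub> (word u \<otimes>\<^bsub>P\<^esub> x)"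
      using xc yc add.hyps by (simp add: P.l_distr P.smult_mult_left P.smult_closed word_closed)
    then show ?case using add left sub(3,4) by simp
  qed
  show "x \<otimes>\<^bsub>P\<^esub> y \<in> word_span W"
    using y' subset_refl
  proof (induction rule: word_span_induct)
    case zero
    then show ?case using xc sub(2) by simp
  next
    case (add y c u)
    have yc: "y \<in> carrier P" using add.hyps by (simp add: word_span_all)
    have "x \<otimes>\<^bsub>P\<^esub> (y \<oplus>\<^bsub>P\<^esub> c \<odot>\<^bsub>P\<^esub> word u) = x \<otimes>\<^bsub>P\<^esub> y \<oplus>\<^bsub>P\<^esub> c \<odot>\<^bsub>P\<^esub> (x \<otimes>\<^bsub>P\<^esub> word u)"
      using xc yc add.hyps by (simp add: P.r_distr P.smult_mult_right P.smult_closed word_closed)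
    then show ?case using add right sub(3,4) by simp
  qed
qed (rule word_span_subspace)

end

section \<open>The bosonization\<close>

primrec skew_count :: "'g bos_symbol list \<Rightarrow> nat"
  where "skew_count [] = 0"
  | "skew_count (s # w) = (case s of Grp h \<Rightarrow> skew_count w | Skew i \<Rightarrow> Suc (skew_count w))"

text \<open>A matrix entry of the two-dimensional representation with basis \<open>e\<^sub>0, e\<^sub>1\<close> in which \<open>h\<close> fixes \<open>e\<^sub>0\<close> and
  scales \<open>e\<^sub>1\<close> by \<open>\<chi>\<^sub>i(h)\<close>, \<open>x\<^sub>i\<close> sends \<open>e\<^sub>0\<close> to \<open>e\<^sub>1\<close> and \<open>e\<^sub>1\<close> to \<open>0\<close>, and every other \<open>x\<^sub>j\<close> acts as
  \<open>0\<close>: the coefficient of \<open>e\<^sub>1\<close> in the image of \<open>e\<^sub>0\<close> under a word.\<close>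

primrec skew_coeff :: "(nat \<Rightarrow> 'g \<Rightarrow> 'k::field) \<Rightarrow> nat \<Rightarrow> 'g bos_symbol list \<Rightarrow> 'k"
  where "skew_coeff \<chi> i [] = 0"
  | "skew_coeff \<chi> i (s # w) =
      (case s of Grp h \<Rightarrow> \<chi> i h * skew_coeff \<chi> i w | Skew j \<Rightarrow> of_bool (j = i \<and> skew_count w = 0))"

lemma skew_count_append [simp]: "skew_count (u @ v) = skew_count u + skew_count v"
  by (induction u) (auto split: bos_symbol.split)

text \<open>Multiplying an equality \<open>w = c w'\<close> from the left.  A scalar \<open>c \<noteq> 1\<close> is harmless only if the words
  contain a skew generator: then one more skew generator in front makes both sides vanish.\<close>

lemma skew_coeff_append:
  assumes "skew_coeff \<chi> i w = c * skew_coeff \<chi> i w'" "skew_count w = 0 \<longleftrightarrow> skew_count w' = 0"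
    and "c = 1 \<or> skew_count w \<noteq> 0"
  shows "skew_coeff \<chi> i (u @ w) = c * skew_coeff \<chi> i (u @ w')"
proof (induction u)
  case (Cons s u)
  then show ?case
    using assms(2,3) by (cases s) (auto simp: mult_ac)
qed (use assms in simp)

locale bosonization =
  fixes G :: "'g monoid" and \<theta> :: nat and g :: "nat \<Rightarrow> 'g" and \<chi> :: "nat \<Rightarrow> 'g \<Rightarrow> 'k::field"
    and B :: "('k, ('g bos_symbol list \<Rightarrow> 'k) set) hopf"
  assumes datum: "qls_datum G \<theta> g \<chi>" and bosonization: "is_bosonization G \<theta> g \<chi> B"
begin

abbreviation "S \<equiv> bos_symbols G \<theta>"
abbreviation "R \<equiv> bos_relations G \<theta> g \<chi>"

lemma G_comm_group: "comm_group G" and g_closed: "i < \<theta> \<Longrightarrow> g i \<in> carrier G"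
  and \<chi>_hom: "i < \<theta> \<Longrightarrow> \<chi> i \<in> hom G (units_of ground)"
  and \<chi>_g: "\<lbrakk>i < \<theta>; j < \<theta>; i \<noteq> j\<rbrakk> \<Longrightarrow> \<chi> i (g j) = inverse (\<chi> j (g i))"
  and order_ge_2: "i < \<theta> \<Longrightarrow> qls_order g \<chi> i \<ge> 2"
  using datum unfolding qls_datum_def by blast+

sublocale G: comm_group G by (rule G_comm_group)

lemma \<chi>_mult: "\<lbrakk>i < \<theta>; h \<in> carrier G; h' \<in> carrier G\<rbrakk> \<Longrightarrow> \<chi> i (h \<otimes>\<^bsub>G\<^esub> h') = \<chi> i h * \<chi> i h'"
  using \<chi>_hom[of i] by (simp add: hom_def units_of_def)

lemma \<chi>_nonzero: "\<lbrakk>i < \<theta>; h \<in> carrier G\<rbrakk> \<Longrightarrow> \<chi> i h \<noteq> 0"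
  using \<chi>_hom[of i] by (fastforce simp: hom_def units_of_def Units_def Pi_def)

lemma \<chi>_one: "i < \<theta> \<Longrightarrow> \<chi> i \<one>\<^bsub>G\<^esub> = 1"
  using \<chi>_mult[of i "\<one>\<^bsub>G\<^esub>" "\<one>\<^bsub>G\<^esub>"] \<chi>_nonzero[of i "\<one>\<^bsub>G\<^esub>"] by simp

lemma Grp_symbol [simp]: "Grp h \<in> S \<longleftrightarrow> h \<in> carrier G"
  and Skew_symbol [simp]: "Skew i \<in> S \<longleftrightarrow> i < \<theta>"
  by (auto simp: bos_symbols_def)

lemma presentation: "presentation S R"
proof
  interpret F: ground_algebra "free_algebra S :: ('k, 'g bos_symbol list \<Rightarrow> 'k) module"
    unfolding free_algebra_def by (rule monoid_algebra_ground_algebra, rule monoidI) auto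
  have b: "basis_vec w \<in> carrier (free_algebra S :: ('k, 'g bos_symbol list \<Rightarrow> 'k) module)" if "w \<in> lists S" for w
    using that by (simp add: free_algebra_def)
  show "R \<subseteq> carrier (free_algebra S)"
    unfolding bos_relations_def Let_def
    by (auto intro!: F.minus_closed b F.smult_closed)
qed

sublocale presentation S R by (rule presentation)

lemma relation_GrpGrp:
  "\<lbrakk>h \<in> carrier G; h' \<in> carrier G\<rbrakk> \<Longrightarrow> basis_vec [Grp h, Grp h'] \<ominus>\<^bsub>F\<^esub> basis_vec [Grp (h \<otimes>\<^bsub>G\<^esub> h')] \<in> R"
  and relation_one: "basis_vec [Grp \<one>\<^bsub>G\<^esub>] \<ominus>\<^bsub>F\<^esub> \<one>\<^bsub>F\<^esub> \<in> R"
  and relation_SkewSkew: "\<lbrakk>i < \<theta>; j < \<theta>; i \<noteq> j\<rbrakk> \<Longrightarrow>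
    basis_vec [Skew i, Skew j] \<ominus>\<^bsub>F\<^esub> \<chi> j (g i) \<odot>\<^bsub>F\<^esub> basis_vec [Skew j, Skew i] \<in> R"
  and relation_GrpSkew: "\<lbrakk>h \<in> carrier G; i < \<theta>\<rbrakk> \<Longrightarrow>
    basis_vec [Grp h, Skew i] \<ominus>\<^bsub>F\<^esub> \<chi> i h \<odot>\<^bsub>F\<^esub> basis_vec [Skew i, Grp h] \<in> R"
  unfolding bos_relations_def Let_def by blast+

lemma skew_coeff_respects:
  assumes i: "i < \<theta>"
  shows "respects_relations S R (skew_coeff \<chi> i)"
  unfolding respects_relations_def
proof (intro ballI)
  fix r u v assume r: "r \<in> R" and u: "u \<in> lists S" and v: "v \<in> lists S"
  have eq: "pairing (basis_vec a \<ominus>\<^bsub>F\<^esub> c \<odot>\<^bsub>F\<^esub> basis_vec b) (\<lambda>w. skew_coeff \<chi> i (u @ w @ v)) = 0"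
    if "a \<in> lists S" "b \<in> lists S" "skew_coeff \<chi> i (a @ v) = c * skew_coeff \<chi> i (b @ v)"
      "skew_count (a @ v) = 0 \<longleftrightarrow> skew_count (b @ v) = 0" "c = 1 \<or> skew_count (a @ v) \<noteq> 0" for a b c
    using skew_coeff_append[OF that(3-5), of u] that(1,2) by (simp add: pairing_relation)
  note eq1 = eq[of _ _ 1, unfolded F_smult_one]
  consider (GrpGrp) h h' where "h \<in> carrier G" "h' \<in> carrier G"
      "r = basis_vec [Grp h, Grp h'] \<ominus>\<^bsub>F\<^esub> basis_vec [Grp (h \<otimes>\<^bsub>G\<^esub> h')]"
    | (one) "r = basis_vec [Grp \<one>\<^bsub>G\<^esub>] \<ominus>\<^bsub>F\<^esub> \<one>\<^bsub>F\<^esub>"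
    | (power) j where "j < \<theta>" "r = basis_vec (replicate (qls_order g \<chi> j) (Skew j))"
    | (SkewSkew) j k where "j < \<theta>" "k < \<theta>"
      "r = basis_vec [Skew j, Skew k] \<ominus>\<^bsub>F\<^esub> \<chi> k (g j) \<odot>\<^bsub>F\<^esub> basis_vec [Skew k, Skew j]"
    | (GrpSkew) h j where "h \<in> carrier G" "j < \<theta>"
      "r = basis_vec [Grp h, Skew j] \<ominus>\<^bsub>F\<^esub> \<chi> j h \<odot>\<^bsub>F\<^esub> basis_vec [Skew j, Grp h]"
    using r unfolding bos_relations_def Let_def by blast
  then show "pairing r (\<lambda>w. skew_coeff \<chi> i (u @ w @ v)) = 0"
  proof cases
    case GrpGrp
    then show ?thesis using i by (simp, intro eq1) (auto simp: \<chi>_mult mult_ac)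
  next
    case one
    then show ?thesis using i by (simp add: F_one, intro eq1) (auto simp: \<chi>_one)
  next
    case power
    obtain n where "qls_order g \<chi> j = Suc (Suc n)"
      using order_ge_2[OF power(1)] by (metis add_2_eq_Suc le_Suc_ex)
    then show ?thesis
      using skew_coeff_append[of \<chi> i "replicate (Suc (Suc n)) (Skew j) @ v" 0 "replicate (Suc (Suc n)) (Skew j) @ v" u]
      by (simp add: power)
  next
    case SkewSkew
    then show ?thesis by (simp, intro eq) auto
  next
    case GrpSkew
    then show ?thesis by (simp, intro eq) auto
  qed
qed

end

context bosonization
begin

lemma truncate_B: "module.truncate B = P"
  using bosonization by (simp add: is_bosonization_def)

lemma P_eq_B: "carrier P = carrier B" "monoid.mult P = monoid.mult B" "\<one>\<^bsub>P\<^esub> = \<one>\<^bsub>B\<^esub>"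
  "\<zero>\<^bsub>P\<^esub> = \<zero>\<^bsub>B\<^esub>" "add P = add B" "module.smult P = module.smult B"
  by (simp_all add: truncate_B[symmetric] module.truncate_def)

sublocale H: hopf_algebra B
  using bosonization by (simp add: is_bosonization_def)

sublocale T: tensor_factors B B
  by (intro tensor_factors.intro ground_algebra.intro H.assoc_algebra_axioms)

abbreviation "TB \<equiv> tensor_product B B"

lemmas wordB_closed = word_closed[unfolded P_eq_B]
  and wordB_mult = word_mult[unfolded P_eq_B]
  and wordB_one = word_one[unfolded P_eq_B]
  and wordB_relation = word_relation[unfolded P_eq_B]

lemma bos_gen_eq_word: "bos_gen G \<theta> g \<chi> s = word [s]"
  by (simp add: bos_gen_def presented_gen_eq_word)

lemma word_Grp_mult:
  "\<lbrakk>h \<in> carrier G; h' \<in> carrier G\<rbrakk> \<Longrightarrow> word [Grp h] \<otimes>\<^bsub>B\<^esub> word [Grp h'] = word [Grp (h \<otimes>\<^bsub>G\<^esub> h')]"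
  using word_relation_eq[OF _ _ relation_GrpGrp] by (simp add: wordB_mult)

lemma word_Grp_one: "word [Grp \<one>\<^bsub>G\<^esub>] = \<one>\<^bsub>B\<^esub>"
  using word_relation_eq[of "[Grp \<one>\<^bsub>G\<^esub>]" "[]"] relation_one by (simp add: F_one wordB_one)

lemma word_SkewSkew:
  assumes "i < \<theta>" "j < \<theta>" "i \<noteq> j"
  shows "word [Skew i] \<otimes>\<^bsub>B\<^esub> word [Skew j] = \<chi> j (g i) \<odot>\<^bsub>B\<^esub> (word [Skew j] \<otimes>\<^bsub>B\<^esub> word [Skew i])"
  using wordB_relation[OF _ _ relation_SkewSkew[OF assms]] assms by (simp add: wordB_mult)

lemma word_GrpSkew:
  assumes "h \<in> carrier G" "i < \<theta>"
  shows "word [Grp h] \<otimes>\<^bsub>B\<^esub> word [Skew i] = \<chi> i h \<odot>\<^bsub>B\<^esub> (word [Skew i] \<otimes>\<^bsub>B\<^esub> word [Grp h])"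
  using wordB_relation[OF _ _ relation_GrpSkew[OF assms]] assms by (simp add: wordB_mult)

text \<open>The functional \<open>skew_coeff\<close> takes the value \<open>1\<close> on \<open>x\<^sub>i\<close>.\<close>

lemma skew_nonzero:
  assumes "i < \<theta>"
  shows "word [Skew i] \<noteq> \<zero>\<^bsub>B\<^esub>"
proof
  assume "word [Skew i] = \<zero>\<^bsub>B\<^esub>"
  then have "coset_pairing (skew_coeff \<chi> i) (word [Skew i]) = 0"
    using coset_pairing_zero[OF skew_coeff_respects[OF assms]] by (simp add: P_eq_B)
  then show False
    using coset_pairing_word[OF skew_coeff_respects[OF assms], of "[Skew i]"] assms by simp
qed

lemma group_word_invertible:
  assumes "k \<in> lists (Grp ` carrier G)"
  shows "\<exists>y\<in>carrier B. word k \<otimes>\<^bsub>B\<^esub> y = \<one>\<^bsub>B\<^esub>"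
  using assms
proof (induction k)
  case Nil
  then show ?case by (auto simp: wordB_one)
next
  case (Cons s k)
  then obtain y where y: "y \<in> carrier B" "word k \<otimes>\<^bsub>B\<^esub> y = \<one>\<^bsub>B\<^esub>" by auto
  obtain h where h: "h \<in> carrier G" "s = Grp h" using Cons.hyps by auto
  have k: "k \<in> lists S" using Cons.hyps by (auto simp: bos_symbols_def)
  have z: "word [Grp (inv\<^bsub>G\<^esub> h)] \<in> carrier B" using h by (simp add: wordB_closed)
  have "word (s # k) = word [s] \<otimes>\<^bsub>B\<^esub> word k" using h k by (simp add: wordB_mult)
  then have "word (s # k) \<otimes>\<^bsub>B\<^esub> (y \<otimes>\<^bsub>B\<^esub> word [Grp (inv\<^bsub>G\<^esub> h)])
      = word [s] \<otimes>\<^bsub>B\<^esub> (word k \<otimes>\<^bsub>B\<^esub> y) \<otimes>\<^bsub>B\<^esub> word [Grp (inv\<^bsub>G\<^esub> h)]"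
    using y(1) z h k by (simp add: wordB_closed H.m_assoc)
  also have "\<dots> = \<one>\<^bsub>B\<^esub>"
    using y z h by (simp add: wordB_closed word_Grp_mult word_Grp_one)
  finally show ?case using y z by (intro bexI[of _ "y \<otimes>\<^bsub>B\<^esub> word [Grp (inv\<^bsub>G\<^esub> h)]"]) auto
qed

lemma comult_Grp: "h \<in> carrier G \<Longrightarrow> comult B (word [Grp h]) = tensor B B (word [Grp h]) (word [Grp h])"
  and counit_Grp: "h \<in> carrier G \<Longrightarrow> counit B (word [Grp h]) = 1"
  and comult_Skew: "i < \<theta> \<Longrightarrow> comult B (word [Skew i]) =
      tensor B B (word [Grp (g i)]) (word [Skew i]) \<oplus>\<^bsub>TB\<^esub> tensor B B (word [Skew i]) (word [])"
  using bosonization by (auto simp: is_bosonization_def grouplike_def bos_gen_eq_word wordB_one)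

lemma comult_mult: "\<lbrakk>x \<in> carrier B; y \<in> carrier B\<rbrakk> \<Longrightarrow>
    comult B (x \<otimes>\<^bsub>B\<^esub> y) = comult B x \<otimes>\<^bsub>TB\<^esub> comult B y"
  using H.comult_ring_hom by (simp add: ring_hom_def)

lemma comult_one: "comult B \<one>\<^bsub>B\<^esub> = tensor B B \<one>\<^bsub>B\<^esub> \<one>\<^bsub>B\<^esub>"
  using H.comult_ring_hom
  by (simp add: ring_hom_def tensor_product_def T.Q.coset_one tensor_def
      monoid_algebra_simps(5))

subsection \<open>The comultiplication of a word\<close>

definition tensor_sum :: "('g bos_symbol list \<times> 'g bos_symbol list) list \<Rightarrow>
    (('g bos_symbol list \<Rightarrow> 'k) set \<times> ('g bos_symbol list \<Rightarrow> 'k) set \<Rightarrow> 'k) set"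
  where "tensor_sum L = foldr (\<lambda>(u, v) x. tensor B B (word u) (word v) \<oplus>\<^bsub>TB\<^esub> x) L \<zero>\<^bsub>TB\<^esub>"

lemma tensor_sum_simps [simp]:
  "tensor_sum [] = \<zero>\<^bsub>TB\<^esub>"
  "tensor_sum ((u, v) # L) = tensor B B (word u) (word v) \<oplus>\<^bsub>TB\<^esub> tensor_sum L"
  by (simp_all add: tensor_sum_def)

lemma tensor_word_closed [simp]:
  "\<lbrakk>u \<in> lists S; v \<in> lists S\<rbrakk> \<Longrightarrow> tensor B B (word u) (word v) \<in> carrier TB"
  by (simp add: wordB_closed)

lemma tensor_sum_closed [simp]:
  "set L \<subseteq> lists S \<times> lists S \<Longrightarrow> tensor_sum L \<in> carrier TB"
proof (induction L)
  case (Cons a L)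
  then show ?case by (cases a) simp
qed simp

lemma tensor_sum_append:
  "\<lbrakk>set L \<subseteq> lists S \<times> lists S; set M \<subseteq> lists S \<times> lists S\<rbrakk>
    \<Longrightarrow> tensor_sum (L @ M) = tensor_sum L \<oplus>\<^bsub>TB\<^esub> tensor_sum M"
proof (induction L)
  case (Cons a L)
  then show ?case by (cases a) (simp add: T.T.a_assoc)
qed simp

lemma tensor_sum_mult:
  "\<lbrakk>a \<in> lists S; b \<in> lists S; set L \<subseteq> lists S \<times> lists S\<rbrakk> \<Longrightarrow>
    tensor B B (word a) (word b) \<otimes>\<^bsub>TB\<^esub> tensor_sum L = tensor_sum (map (\<lambda>(u, v). (a @ u, b @ v)) L)"
proof (induction L)
  case (Cons x L)
  then show ?case
    by (cases x) (simp add: T.T.r_distr T.tensor_mult wordB_closed wordB_mult)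
qed simp

text \<open>The tensors \<open>u \<otimes> v\<close> that may accompany the leading term \<open>w \<otimes> k\<close> in the coproduct of a word \<open>w\<close>: the
  left factor has lost a skew generator, and every skew generator of \<open>w\<close> survives on one of the sides.\<close>

definition lower_terms :: "'g bos_symbol list \<Rightarrow> ('g bos_symbol list \<times> 'g bos_symbol list) set"
  where "lower_terms w = {(u, v). u \<in> lists S \<and> v \<in> lists S \<and> skew_count u < skew_count w \<and>
    (\<forall>i. Skew i \<in> set w \<longrightarrow> Skew i \<in> set u \<or> Skew i \<in> set v)}"

lemma lower_terms_subset: "lower_terms w \<subseteq> lists S \<times> lists S"
  by (auto simp: lower_terms_def)

lemma lower_terms_map:
  assumes "set L \<subseteq> lower_terms w"
    and "\<And>u v. (u, v) \<in> lower_terms w \<Longrightarrow> (a @ u, b @ v) \<in> lower_terms w'"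
  shows "set (map (\<lambda>(u, v). (a @ u, b @ v)) L) \<subseteq> lower_terms w'"
proof
  fix z assume "z \<in> set (map (\<lambda>(u, v). (a @ u, b @ v)) L)"
  then obtain u v where uv: "(u, v) \<in> set L" "z = (a @ u, b @ v)" by auto
  then show "z \<in> lower_terms w'" using assms by blast
qed

text \<open>Expanding the product of the coproducts of the letters, the term in which every \<open>x\<^sub>j\<close> goes to the left is
  \<open>w \<otimes> k\<close> with \<open>k\<close> a product of group elements; in all others some \<open>x\<^sub>j\<close> on the left has been replaced by
  \<open>g\<^sub>j\<close>.\<close>

lemma comult_word:
  assumes "w \<in> lists S"
  shows "\<exists>k L. k \<in> lists (Grp ` carrier G) \<and> set L \<subseteq> lower_terms w \<and>
    comult B (word w) = tensor B B (word w) (word k) \<oplus>\<^bsub>TB\<^esub> tensor_sum L"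
  using assms
proof (induction w)
  case Nil
  have "comult B (word []) = tensor B B (word []) (word []) \<oplus>\<^bsub>TB\<^esub> tensor_sum []"
    using tensor_word_closed[of "[]" "[]"] by (simp add: wordB_one comult_one)
  then show ?case by (intro exI[of _ "[]"]) simp
next
  case (Cons s w)
  then obtain k L where k: "k \<in> lists (Grp ` carrier G)" and L: "set L \<subseteq> lower_terms w"
    and \<Delta>: "comult B (word w) = tensor B B (word w) (word k) \<oplus>\<^bsub>TB\<^esub> tensor_sum L"
    by auto
  have w: "w \<in> lists S" and s: "[s] \<in> lists S" using Cons.hyps by auto
  have kS: "k \<in> lists S" using k by (auto simp: bos_symbols_def)
  have LS: "set L \<subseteq> lists S \<times> lists S" using L lower_terms_subset by blast
  have sw: "comult B (word (s # w)) = comult B (word [s]) \<otimes>\<^bsub>TB\<^esub> comult B (word w)"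
    using comult_mult[of "word [s]" "word w"] s w by (simp add: wordB_closed wordB_mult)
  have mapS: "set (map (\<lambda>(u, v). (a @ u, b @ v)) L) \<subseteq> lists S \<times> lists S"
    if "a \<in> lists S" "b \<in> lists S" for a b
  proof
    fix z assume "z \<in> set (map (\<lambda>(u, v). (a @ u, b @ v)) L)"
    then obtain u v where uv: "(u, v) \<in> set L" "z = (a @ u, b @ v)" by auto
    then have "u \<in> lists S" "v \<in> lists S" using LS by blast+
    then show "z \<in> lists S \<times> lists S" using that uv by simp
  qed
  show ?case
  proof (cases s)
    case (Grp h)
    have h: "h \<in> carrier G" using s Grp by simp
    let ?L = "map (\<lambda>(u, v). ([Grp h] @ u, [Grp h] @ v)) L"
    have "comult B (word (s # w)) = tensor B B (word (s # w)) (word (Grp h # k)) \<oplus>\<^bsub>TB\<^esub> tensor_sum ?L"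
      using tensor_sum_mult[of "[Grp h]" "[Grp h]" L] h w kS LS
      by (simp add: sw[unfolded Grp] \<Delta> Grp comult_Grp T.T.r_distr T.tensor_mult wordB_closed wordB_mult)
    moreover have "set ?L \<subseteq> lower_terms (s # w)"
      using h Grp by (intro lower_terms_map[OF L]) (simp add: lower_terms_def)
    moreover have "Grp h # k \<in> lists (Grp ` carrier G)" using k h by simp
    ultimately show ?thesis by blast
  next
    case (Skew j)
    have j: "j < \<theta>" using s Skew by simp
    have gj: "[Grp (g j)] \<in> lists S" using g_closed[OF j] by simp
    have sj: "[Skew j] \<in> lists S" using j by simp
    let ?L1 = "map (\<lambda>(u, v). ([Grp (g j)] @ u, [Skew j] @ v)) L"
    let ?L2 = "map (\<lambda>(u, v). ([Skew j] @ u, [] @ v)) L"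
    let ?a = "(Grp (g j) # w, Skew j # k)"
    let ?L = "?a # ?L1 @ ?L2"
    let ?T1 = "tensor B B (word [Grp (g j)]) (word [Skew j])"
    let ?T2 = "tensor B B (word [Skew j]) (word [])"
    let ?T = "tensor B B (word w) (word k)"
    have c: "?T1 \<in> carrier TB" "?T2 \<in> carrier TB" "?T \<in> carrier TB" "tensor_sum L \<in> carrier TB"
      "tensor_sum ?L1 \<in> carrier TB" "tensor_sum ?L2 \<in> carrier TB"
      using gj sj w kS LS mapS[OF gj sj] mapS[OF sj, of "[]"] by simp_all
    have m: "?T1 \<otimes>\<^bsub>TB\<^esub> tensor_sum L = tensor_sum ?L1" "?T2 \<otimes>\<^bsub>TB\<^esub> tensor_sum L = tensor_sum ?L2"
      using tensor_sum_mult[OF gj sj LS] tensor_sum_mult[OF sj _ LS, of "[]"] by auto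
    have m': "?T1 \<otimes>\<^bsub>TB\<^esub> ?T = tensor B B (word (Grp (g j) # w)) (word (Skew j # k))"
      "?T2 \<otimes>\<^bsub>TB\<^esub> ?T = tensor B B (word (s # w)) (word k)"
      using gj sj w kS by (simp_all add: T.tensor_mult wordB_closed wordB_mult Skew)
    have c': "tensor B B (word (Grp (g j) # w)) (word (Skew j # k)) \<in> carrier TB"
      "tensor B B (word (s # w)) (word k) \<in> carrier TB"
      using gj sj w kS Skew by simp_all
    have "comult B (word (s # w)) = (?T1 \<oplus>\<^bsub>TB\<^esub> ?T2) \<otimes>\<^bsub>TB\<^esub> (?T \<oplus>\<^bsub>TB\<^esub> tensor_sum L)"
      by (simp add: sw[unfolded Skew] \<Delta> Skew comult_Skew j)
    also have "\<dots> = ?T1 \<otimes>\<^bsub>TB\<^esub> ?T \<oplus>\<^bsub>TB\<^esub> ?T1 \<otimes>\<^bsub>TB\<^esub> tensor_sum L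
        \<oplus>\<^bsub>TB\<^esub> (?T2 \<otimes>\<^bsub>TB\<^esub> ?T \<oplus>\<^bsub>TB\<^esub> ?T2 \<otimes>\<^bsub>TB\<^esub> tensor_sum L)"
      using c by (simp add: T.T.l_distr T.T.r_distr T.T.a_ac)
    also have "\<dots> = tensor B B (word (s # w)) (word k) \<oplus>\<^bsub>TB\<^esub> tensor_sum ?L"
      using c c' mapS[OF gj sj] mapS[OF sj, of "[]"]
      by (simp add: m m' tensor_sum_append T.T.a_ac del: append.simps map_append)
    finally have eq: "comult B (word (s # w)) = tensor B B (word (s # w)) (word k) \<oplus>\<^bsub>TB\<^esub> tensor_sum ?L" .
    have "?a \<in> lower_terms (s # w)"
      using gj sj w kS Skew by (simp add: lower_terms_def)
    moreover have "set ?L1 \<subseteq> lower_terms (s # w)"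
      using gj sj Skew by (intro lower_terms_map[OF L]) (auto simp: lower_terms_def)
    moreover have "set ?L2 \<subseteq> lower_terms (s # w)"
      using gj sj Skew by (intro lower_terms_map[OF L]) (auto simp: lower_terms_def)
    ultimately have "set ?L \<subseteq> lower_terms (s # w)" by (simp only: list.set set_append) blast
    with eq k show ?thesis by blast
  qed
qed

end

context bosonization
begin

subsection \<open>The Hopf ideal generated by a skew-primitive generator\<close>

definition skew_words :: "nat \<Rightarrow> 'g bos_symbol list set"
  where "skew_words i = {w \<in> lists S. Skew i \<in> set w}"

abbreviation "skew_ideal i \<equiv> word_span (skew_words i)"

lemma skew_words_subset: "skew_words i \<subseteq> lists S"
  by (auto simp: skew_words_def)

lemma ground_algebra_B: "ground_algebra B"
  by (intro ground_algebra.intro H.assoc_algebra_axioms)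

lemma tensor_lift_tensor_sum:
  assumes U: "ground_algebra U" and \<beta>: "bilinear_map B B U \<beta>" and I: "submodule I ground U"
    and L: "set L \<subseteq> lists S \<times> lists S" "\<And>u v. (u, v) \<in> set L \<Longrightarrow> \<beta> (word u) (word v) \<in> I"
  shows "tensor_lift U \<beta> (tensor_sum L) \<in> I"
proof -
  interpret U: ground_algebra U by (fact U)
  note add = T.tensor_lift_add[OF U \<beta>]
  show ?thesis
    using L
  proof (induction L)
    case Nil
    have "tensor_lift U \<beta> \<zero>\<^bsub>TB\<^esub> = tensor_lift U \<beta> \<zero>\<^bsub>TB\<^esub> \<oplus>\<^bsub>U\<^esub> tensor_lift U \<beta> \<zero>\<^bsub>TB\<^esub>"
      using add(1)[of "\<zero>\<^bsub>TB\<^esub>" "\<zero>\<^bsub>TB\<^esub>"] by simp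
    then have "tensor_lift U \<beta> \<zero>\<^bsub>TB\<^esub> = \<zero>\<^bsub>U\<^esub>"
      using add(2)[of "\<zero>\<^bsub>TB\<^esub>" "\<zero>\<^bsub>TB\<^esub>"] by (simp add: U.add.l_cancel_one')
    then show ?case using U.subspaceD(2)[OF I] by simp
  next
    case (Cons a L)
    obtain u v where a: "a = (u, v)" by (cases a)
    have "u \<in> lists S" "v \<in> lists S" "set L \<subseteq> lists S \<times> lists S" using Cons.prems(1) a by simp_all
    moreover from this have "tensor_lift U \<beta> (tensor_sum (a # L))
        = \<beta> (word u) (word v) \<oplus>\<^bsub>U\<^esub> tensor_lift U \<beta> (tensor_sum L)"
      using add(1)[of "tensor B B (word u) (word v)" "tensor_sum L"] a
      by (simp add: T.tensor_lift_tensor[OF U \<beta>] wordB_closed)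
    ultimately show ?case
      using Cons a U.subspaceD(3)[OF I] by simp
  qed
qed

lemma skew_ideal_ideal: "ideal (skew_ideal i) B"
proof -
  have "ideal (skew_ideal i) P"
    by (rule word_span_ideal[OF skew_words_subset]) (simp add: skew_words_def)
  then interpret I: ideal "skew_ideal i" P .
  have "submodule (skew_ideal i) ground B"
  proof (rule T.V.subspaceI)
    note sub = P.subspaceD[OF word_span_subspace[of "skew_words i"], unfolded P_eq_B]
    show "skew_ideal i \<subseteq> carrier B" "\<zero>\<^bsub>B\<^esub> \<in> skew_ideal i" by (fact sub)+
  qed (use P.subspaceD[OF word_span_subspace[of "skew_words i"], unfolded P_eq_B] in auto)
  then show ?thesis
    by (rule T.V.subspace_idealI)
      (use I.I_l_closed I.I_r_closed in \<open>simp_all add: P_eq_B\<close>)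
qed

lemma skew_ideal_subspace: "submodule (skew_ideal i) ground B"
  by (rule T.V.ideal_subspace[OF skew_ideal_ideal])

lemma skew_ideal_word: "\<lbrakk>w \<in> lists S; Skew i \<in> set w\<rbrakk> \<Longrightarrow> word w \<in> skew_ideal i"
  by (rule word_in_span) (simp_all add: skew_words_def)

lemma skew_ideal_induct [consumes 1, case_names zero add]:
  assumes "x \<in> skew_ideal i" "Prop \<zero>\<^bsub>B\<^esub>"
    and "\<And>x c w. \<lbrakk>x \<in> carrier B; w \<in> lists S; Skew i \<in> set w; Prop x\<rbrakk>
      \<Longrightarrow> Prop (x \<oplus>\<^bsub>B\<^esub> c \<odot>\<^bsub>B\<^esub> word w)"
  shows "Prop x"
  using assms(1) skew_words_subset
proof (induction rule: word_span_induct)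
  case zero
  then show ?case using assms(2) by (simp add: P_eq_B)
next
  case (add x c w)
  then have "x \<in> carrier B" using T.V.subspaceD(1)[OF skew_ideal_subspace] by blast
  then show ?case using assms(3)[of x w c] add by (simp add: P_eq_B skew_words_def)
qed

lemma counit_mult: "\<lbrakk>x \<in> carrier B; y \<in> carrier B\<rbrakk> \<Longrightarrow> counit B (x \<otimes>\<^bsub>B\<^esub> y) = counit B x * counit B y"
  and counit_add: "\<lbrakk>x \<in> carrier B; y \<in> carrier B\<rbrakk> \<Longrightarrow> counit B (x \<oplus>\<^bsub>B\<^esub> y) = counit B x + counit B y"
  and counit_one: "counit B \<one>\<^bsub>B\<^esub> = 1"
  using H.counit_ring_hom by (simp_all add: ring_hom_def)

text \<open>The counit axiom on the left, applied to \<open>x\<^sub>i\<close>, reads \<open>x\<^sub>i + \<epsilon>(x\<^sub>i) 1 = x\<^sub>i\<close>.\<close>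

lemma counit_Skew:
  assumes i: "i < \<theta>"
  shows "counit B (word [Skew i]) = 0"
proof -
  let ?\<beta> = "\<lambda>a b. counit B a \<odot>\<^bsub>B\<^esub> b"
  have \<beta>: "bilinear_map B B B ?\<beta>"
  proof -
    have l: "(a + b) \<odot>\<^bsub>B\<^esub> x = a \<odot>\<^bsub>B\<^esub> x \<oplus>\<^bsub>B\<^esub> b \<odot>\<^bsub>B\<^esub> x"
      and m: "(a * b) \<odot>\<^bsub>B\<^esub> x = a \<odot>\<^bsub>B\<^esub> (b \<odot>\<^bsub>B\<^esub> x)"
      and c: "a \<odot>\<^bsub>B\<^esub> x \<in> carrier B" if "x \<in> carrier B" for a b x
      using H.smult_l_distr[of a b x] H.smult_assoc1[of a b x] that by simp_all
    have "a \<odot>\<^bsub>B\<^esub> (b \<odot>\<^bsub>B\<^esub> x) = b \<odot>\<^bsub>B\<^esub> (a \<odot>\<^bsub>B\<^esub> x)" if "x \<in> carrier B" for a b x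
      using m[OF that, of a b] m[OF that, of b a] by (simp add: mult.commute)
    then show ?thesis
      by (auto simp: bilinear_map_def linear_maps_def counit_add H.counit_smult H.smult_r_distr l m c)
  qed
  let ?x = "word [Skew i]" and ?g = "word [Grp (g i)]"
  have c: "?x \<in> carrier B" "?g \<in> carrier B" using i g_closed by (simp_all add: wordB_closed)
  have "tensor_lift B ?\<beta> (comult B ?x) = counit B ?g \<odot>\<^bsub>B\<^esub> ?x \<oplus>\<^bsub>B\<^esub> counit B ?x \<odot>\<^bsub>B\<^esub> \<one>\<^bsub>B\<^esub>"
    using c i by (simp add: comult_Skew T.tensor_lift_add[OF ground_algebra_B \<beta>]
        T.tensor_lift_tensor[OF ground_algebra_B \<beta>] wordB_one)
  then have "?x = ?x \<oplus>\<^bsub>B\<^esub> counit B ?x \<odot>\<^bsub>B\<^esub> \<one>\<^bsub>B\<^esub>"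
    using H.counit_left[OF c(1)] counit_Grp[OF g_closed[OF i]] H.smult_one[OF c(1)] by simp
  then have "counit B ?x \<odot>\<^bsub>B\<^esub> \<one>\<^bsub>B\<^esub> = \<zero>\<^bsub>B\<^esub>"
    using c H.smult_closed[of "counit B ?x" "\<one>\<^bsub>B\<^esub>"] by (simp add: H.add.l_cancel_one')
  moreover have "counit B (counit B ?x \<odot>\<^bsub>B\<^esub> \<one>\<^bsub>B\<^esub>) = counit B ?x"
    using H.counit_smult[of "\<one>\<^bsub>B\<^esub>" "counit B ?x"] counit_one by simp
  moreover have "counit B \<zero>\<^bsub>B\<^esub> = 0"
    using H.counit_smult[of "\<zero>\<^bsub>B\<^esub>" 0] H.smult_l_null[of "\<zero>\<^bsub>B\<^esub>"] by simp
  ultimately show ?thesis by simp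
qed

lemma counit_word:
  assumes "w \<in> lists S" "Skew i \<in> set w"
  shows "counit B (word w) = 0"
  using assms
proof (induction w)
  case (Cons s w)
  have "counit B (word (s # w)) = counit B (word [s]) * counit B (word w)"
    using counit_mult[of "word [s]" "word w"] Cons.hyps wordB_mult[of "[s]" w]
      wordB_closed[of "[s]"] wordB_closed[of w] by simp
  then show ?case
    using Cons counit_Skew[of i] by (cases "s = Skew i") auto
qed simp

lemma antipode_bilinear: "bilinear_map B B B (\<lambda>a b. antipode B a \<otimes>\<^bsub>B\<^esub> b)"
  using H.antipode_linear
  by (auto simp: bilinear_map_def linear_maps_def Pi_iff H.l_distr H.r_distr
      H.smult_mult_left H.smult_mult_right)

text \<open>The usual argument uses that the antipode is antimultiplicative.  Here its defining identity, applied to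
  \<open>w\<close>, is solved for \<open>S(w)\<close> instead: by \<open>comult_word\<close> it reads \<open>S(w) k + \<Sum> S(u) v = \<epsilon>(w) = 0\<close>.  Each
  \<open>S(u) v\<close> lies in the ideal, either since \<open>v\<close> contains \<open>x\<^sub>i\<close> or by induction on the number of skew generators,
  and \<open>k\<close> is invertible.\<close>

lemma antipode_word:
  assumes "w \<in> lists S" "Skew i \<in> set w"
  shows "antipode B (word w) \<in> skew_ideal i"
  using assms
proof (induction "skew_count w" arbitrary: w rule: less_induct)
  case less
  interpret I: ideal "skew_ideal i" B by (rule skew_ideal_ideal)
  let ?\<beta> = "\<lambda>a b. antipode B a \<otimes>\<^bsub>B\<^esub> b"
  obtain k L where k: "k \<in> lists (Grp ` carrier G)" and L: "set L \<subseteq> lower_terms w"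
    and \<Delta>: "comult B (word w) = tensor B B (word w) (word k) \<oplus>\<^bsub>TB\<^esub> tensor_sum L"
    using comult_word[OF less.prems(1)] by blast
  have kS: "k \<in> lists S" using k by (auto simp: bos_symbols_def)
  have LS: "set L \<subseteq> lists S \<times> lists S" using L lower_terms_subset by blast
  have anti: "antipode B x \<in> carrier B" if "x \<in> carrier B" for x
    using H.antipode_linear that by (auto simp: linear_maps_def)
  have term_in: "?\<beta> (word u) (word v) \<in> skew_ideal i" if "(u, v) \<in> set L" for u v
  proof -
    have uv: "u \<in> lists S" "v \<in> lists S" "skew_count u < skew_count w"
      "Skew i \<in> set u \<or> Skew i \<in> set v"
      using that L less.prems(2) by (auto simp: lower_terms_def simp del: in_lists_conv_set)
    show ?thesis
    proof (cases "Skew i \<in> set u")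
      case True
      then show ?thesis using less.hyps uv by (intro I.I_r_closed wordB_closed) auto
    next
      case False
      then show ?thesis using uv by (intro I.I_l_closed anti wordB_closed skew_ideal_word) auto
    qed
  qed
  let ?rest = "tensor_lift B ?\<beta> (tensor_sum L)"
  have rest: "?rest \<in> skew_ideal i"
    using term_in by (intro tensor_lift_tensor_sum[OF ground_algebra_B antipode_bilinear skew_ideal_subspace LS])
  have c: "word w \<in> carrier B" "word k \<in> carrier B" using less.prems kS by (simp_all add: wordB_closed)
  have c': "antipode B (word w) \<otimes>\<^bsub>B\<^esub> word k \<in> carrier B" using c anti by simp
  have "tensor_lift B ?\<beta> (comult B (word w)) = antipode B (word w) \<otimes>\<^bsub>B\<^esub> word k \<oplus>\<^bsub>B\<^esub> ?rest"
    using c LS by (simp add: \<Delta> T.tensor_lift_add[OF ground_algebra_B antipode_bilinear]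
        T.tensor_lift_tensor[OF ground_algebra_B antipode_bilinear])
  moreover have "tensor_lift B ?\<beta> (comult B (word w)) = \<zero>\<^bsub>B\<^esub>"
    using H.antipode_left[OF c(1)] counit_word[OF less.prems] H.smult_l_null[of "\<one>\<^bsub>B\<^esub>"] by simp
  ultimately have "antipode B (word w) \<otimes>\<^bsub>B\<^esub> word k = \<ominus>\<^bsub>B\<^esub> ?rest"
    using H.minus_equality[of "antipode B (word w) \<otimes>\<^bsub>B\<^esub> word k" ?rest] c' I.Icarr[OF rest] by simp
  then have *: "antipode B (word w) \<otimes>\<^bsub>B\<^esub> word k \<in> skew_ideal i"
    using rest by (simp add: I.a_inv_closed)
  obtain y where y: "y \<in> carrier B" "word k \<otimes>\<^bsub>B\<^esub> y = \<one>\<^bsub>B\<^esub>"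
    using group_word_invertible[OF k] by blast
  have "antipode B (word w) \<otimes>\<^bsub>B\<^esub> word k \<otimes>\<^bsub>B\<^esub> y = antipode B (word w)"
    using c y anti by (simp add: H.m_assoc)
  then show ?case using I.I_r_closed[OF * y(1)] by simp
qed

text \<open>The ideal is spanned by the words that contain \<open>x\<^sub>i\<close>, so all closure conditions can be checked on these
  words.\<close>

theorem skew_ideal_hopf_ideal: "hopf_ideal (skew_ideal i) B"
  unfolding hopf_ideal_def
proof (intro conjI)
  interpret I: ideal "skew_ideal i" B by (rule skew_ideal_ideal)
  show "ideal (skew_ideal i) B" by (rule skew_ideal_ideal)
  let ?K1 = "lin_span TB {tensor B B a b | a b. a \<in> skew_ideal i \<and> b \<in> carrier B}"
  let ?K2 = "lin_span TB {tensor B B a b | a b. a \<in> carrier B \<and> b \<in> skew_ideal i}"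
  have sub: "submodule ?K1 ground TB" "submodule ?K2 ground TB"
    by (intro T.T.lin_span_subspace; use I.Icarr in auto)+
  note K = T.T.subspace_sum[OF sub]
  note K0 = T.T.subspaceD[OF K(1)]
  have gen: "tensor B B (word u) (word v) \<in> ?K1 <+>\<^bsub>TB\<^esub> ?K2"
    if "u \<in> lists S" "v \<in> lists S" "Skew i \<in> set u \<or> Skew i \<in> set v" for u v
  proof (cases "Skew i \<in> set u")
    case True
    then have "tensor B B (word u) (word v) \<in> ?K1"
      using that by (intro subsetD[OF T.T.lin_span_superset]) (auto intro: skew_ideal_word wordB_closed)
    then show ?thesis using K(2) by blast
  next
    case False
    then have "tensor B B (word u) (word v) \<in> ?K2"
      using that by (intro subsetD[OF T.T.lin_span_superset]) (auto intro: skew_ideal_word wordB_closed)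
    then show ?thesis using K(3) by blast
  qed
  have word_in: "comult B (word w) \<in> ?K1 <+>\<^bsub>TB\<^esub> ?K2" if w: "w \<in> lists S" "Skew i \<in> set w" for w
  proof -
    obtain k L where k: "k \<in> lists (Grp ` carrier G)" and L: "set L \<subseteq> lower_terms w"
      and \<Delta>: "comult B (word w) = tensor B B (word w) (word k) \<oplus>\<^bsub>TB\<^esub> tensor_sum L"
      using comult_word[OF w(1)] by blast
    have kS: "k \<in> lists S" using k by (auto simp: bos_symbols_def)
    have "set M \<subseteq> set L \<Longrightarrow> tensor_sum M \<in> ?K1 <+>\<^bsub>TB\<^esub> ?K2" for M
    proof (induction M)
      case (Cons a M)
      obtain u v where a: "a = (u, v)" by (cases a)
      have "(u, v) \<in> lower_terms w" using Cons.prems L a by auto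
      then have "u \<in> lists S" "v \<in> lists S" "Skew i \<in> set u \<or> Skew i \<in> set v"
        using w by (simp_all add: lower_terms_def)
      then show ?case using Cons a gen K0(3) by simp
    qed (simp add: K0(2))
    then show ?thesis using \<Delta> gen[of w k] w kS K0(3) by simp
  qed
  have comult: "comult B (x \<oplus>\<^bsub>B\<^esub> y) = comult B x \<oplus>\<^bsub>TB\<^esub> comult B y" "comult B (c \<odot>\<^bsub>B\<^esub> x) = c \<odot>\<^bsub>TB\<^esub> comult B x"
    if "x \<in> carrier B" "y \<in> carrier B" for x y c
    using H.comult_linear that by (auto simp: linear_maps_def)
  have zero: "\<zero>\<^bsub>B\<^esub> = 0 \<odot>\<^bsub>B\<^esub> \<zero>\<^bsub>B\<^esub>" using H.smult_l_null[of "\<zero>\<^bsub>B\<^esub>"] by simp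
  show "comult B ` skew_ideal i \<subseteq> ?K1 <+>\<^bsub>TB\<^esub> ?K2"
  proof clarify
    fix x assume "x \<in> skew_ideal i"
    then show "comult B x \<in> ?K1 <+>\<^bsub>TB\<^esub> ?K2"
    proof (induction rule: skew_ideal_induct)
      case zero
      have "comult B \<zero>\<^bsub>B\<^esub> \<in> carrier TB" using H.comult_linear by (auto simp: linear_maps_def)
      then have "comult B \<zero>\<^bsub>B\<^esub> = \<zero>\<^bsub>TB\<^esub>"
        using comult(2)[of "\<zero>\<^bsub>B\<^esub>" "\<zero>\<^bsub>B\<^esub>" 0] T.T.smult_l_null[of "comult B \<zero>\<^bsub>B\<^esub>"] \<open>\<zero>\<^bsub>B\<^esub> = 0 \<odot>\<^bsub>B\<^esub> \<zero>\<^bsub>B\<^esub>\<close>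
        by simp
      then show ?case using K0(2) by simp
    next
      case (add x c w)
      then show ?case
        using word_in by (simp add: comult wordB_closed K0(3,4))
    qed
  qed
  show "\<forall>x\<in>skew_ideal i. counit B x = 0"
  proof
    fix x assume "x \<in> skew_ideal i"
    then show "counit B x = 0"
    proof (induction rule: skew_ideal_induct)
      case zero
      then show ?case using H.counit_smult[of "\<zero>\<^bsub>B\<^esub>" 0] zero by simp
    next
      case (add x c w)
      then have "c \<odot>\<^bsub>B\<^esub> word w \<in> carrier B" by (simp add: wordB_closed)
      then show ?case using add by (simp add: counit_add H.counit_smult wordB_closed counit_word)
    qed
  qed
  have anti: "antipode B (x \<oplus>\<^bsub>B\<^esub> y) = antipode B x \<oplus>\<^bsub>B\<^esub> antipode B y" "antipode B (c \<odot>\<^bsub>B\<^esub> x) = c \<odot>\<^bsub>B\<^esub> antipode B x"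
    "antipode B x \<in> carrier B"
    if "x \<in> carrier B" "y \<in> carrier B" for x y c
    using H.antipode_linear that by (auto simp: linear_maps_def)
  show "antipode B ` skew_ideal i \<subseteq> skew_ideal i"
  proof clarify
    fix x assume "x \<in> skew_ideal i"
    then show "antipode B x \<in> skew_ideal i"
    proof (induction rule: skew_ideal_induct)
      case zero
      have "antipode B \<zero>\<^bsub>B\<^esub> = \<zero>\<^bsub>B\<^esub>"
        using anti(2)[of "\<zero>\<^bsub>B\<^esub>" "\<zero>\<^bsub>B\<^esub>" 0] anti(3)[of "\<zero>\<^bsub>B\<^esub>" "\<zero>\<^bsub>B\<^esub>"]
          H.smult_l_null[of "antipode B \<zero>\<^bsub>B\<^esub>"] \<open>\<zero>\<^bsub>B\<^esub> = 0 \<odot>\<^bsub>B\<^esub> \<zero>\<^bsub>B\<^esub>\<close>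
        by simp
      then show ?case by (simp add: I.zero_closed)
    next
      case (add x c w)
      then show ?case
        using antipode_word[of w i] T.V.subspaceD(3,4)[OF skew_ideal_subspace]
        by (simp add: anti wordB_closed)
    qed
  qed
qed

lemma skew_ideal_nonzero:
  assumes "i < \<theta>"
  shows "skew_ideal i \<noteq> {\<zero>\<^bsub>B\<^esub>}"
  using skew_ideal_word[of "[Skew i]" i] skew_nonzero[OF assms] assms by auto

end

section \<open>Quantum affine space in degrees one and two\<close>

lemma mult_ord_square:
  fixes q :: "'k::field"
  assumes "mult_ord q \<ge> 3" "q \<noteq> 0"
  shows "q * q \<noteq> 1"
proof
  assume q: "q * q = 1"
  interpret R: cring "ground :: 'k ring" by (rule cring_ground)
  interpret U: group "units_of (ground :: 'k ring)" by (rule R.units_group)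
  have carr: "q \<in> carrier (units_of ground)"
    using q by (auto simp: units_of_def Units_def)
  have "q [^]\<^bsub>units_of ground\<^esub> (2::nat) = \<one>\<^bsub>units_of ground\<^esub>"
    using q carr by (simp add: numeral_2_eq_2 units_of_def)
  then have "U.ord q dvd 2" using U.pow_eq_id[OF carr] by simp
  then show False using assms(1) dvd_imp_le[of "U.ord q" 2] by (simp add: mult_ord_def)
qed

locale quantum_affine =
  fixes t :: nat and p :: "nat \<Rightarrow> nat \<Rightarrow> 'k::field"
  assumes params: "quantum_params t p"
begin

lemma p_inverse: "\<lbrakk>i < t; j < t\<rbrakk> \<Longrightarrow> p i j * p j i = 1"
proof -
  assume "i < t" "j < t"
  then have eq: "p i j = inverse (p j i)" and "p j i \<noteq> 0"
    using params unfolding quantum_params_def by blast+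
  then show "p i j * p j i = 1" by (subst eq) (rule left_inverse)
qed

lemma p_diag: "i < t \<Longrightarrow> p i i = 1"
  using params unfolding quantum_params_def by blast

lemma presentation: "presentation {..<t} (qas_relations t p)"
proof
  interpret F: ground_algebra "free_algebra {..<t} :: ('k, nat list \<Rightarrow> 'k) module"
    unfolding free_algebra_def by (rule monoid_algebra_ground_algebra, rule monoidI) auto
  have b: "basis_vec w \<in> carrier (free_algebra {..<t} :: ('k, nat list \<Rightarrow> 'k) module)"
    if "w \<in> lists {..<t}" for w
    using that by (simp add: free_algebra_def)
  show "qas_relations t p \<subseteq> carrier (free_algebra {..<t})"
    unfolding qas_relations_def Let_def by (auto intro!: F.minus_closed b F.smult_closed)
qed

sublocale presentation "{..<t}" "qas_relations t p" by (rule presentation)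

lemma quantum_affine_space_eq: "quantum_affine_space t p = P"
  by (simp add: quantum_affine_space_def)

definition linear_coeff :: "nat \<Rightarrow> (nat list \<Rightarrow> 'k) set \<Rightarrow> 'k"
  where "linear_coeff k = coset_pairing (\<lambda>w. of_bool (w = [k]))"

text \<open>In degree two only the words of length two matter, and a relation never changes the length of a word; so
  these functionals respect the relations and read off the coefficient of \<open>u\<^sub>m u\<^sub>n\<close>.\<close>

definition quad_functional :: "nat \<Rightarrow> nat \<Rightarrow> nat list \<Rightarrow> 'k"
  where "quad_functional m n w = (if w = [m, n] then 1 else if w = [n, m] then p n m else 0)"

lemma linear_respects: "respects_relations {..<t} (qas_relations t p) (\<lambda>w. of_bool (w = [k]))"
  unfolding respects_relations_def qas_relations_def Let_def
proof clarify
  fix i j and u v :: "nat list" assume ij: "i < t" "j < t"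
  have "u @ [a, b] @ v \<noteq> [k]" for a b by (cases u) simp_all
  then show "pairing (basis_vec [i, j] \<ominus>\<^bsub>F\<^esub> p i j \<odot>\<^bsub>F\<^esub> basis_vec [j, i]) (\<lambda>w. of_bool (u @ w @ v = [k])) = 0"
    using ij by (simp add: pairing_relation)
qed

lemma quad_respects:
  assumes "m < t" "n < t"
  shows "respects_relations {..<t} (qas_relations t p) (quad_functional m n)"
  unfolding respects_relations_def qas_relations_def Let_def
proof clarify
  fix i j and u v :: "nat list" assume ij: "i < t" "j < t"
  have eq: "u @ [a, b] @ v = [c, d] \<longleftrightarrow> u = [] \<and> v = [] \<and> a = c \<and> b = d" for a b c d
  proof
    assume *: "u @ [a, b] @ v = [c, d]"
    then have "length (u @ [a, b] @ v) = 2" by simp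
    then have "u = []" "v = []" by simp_all
    with * show "u = [] \<and> v = [] \<and> a = c \<and> b = d" by simp
  qed simp
  have "quad_functional m n (u @ [i, j] @ v) = p i j * quad_functional m n (u @ [j, i] @ v)"
  proof (cases "u = [] \<and> v = []")
    case True
    consider "i = m \<and> j = n" | "i = n \<and> j = m" | "\<not> (i = m \<and> j = n)" "\<not> (i = n \<and> j = m)"
      by blast
    then show ?thesis
    proof cases
      case 1
      then have ij: "i = m" "j = n" by simp_all
      show ?thesis
        unfolding ij using True p_inverse[OF assms] p_diag[OF assms(1)] by (cases "m = n") (simp_all add: quad_functional_def)
    next
      case 2
      then have ij: "i = n" "j = m" by simp_all
      show ?thesis
        unfolding ij using True p_diag[OF assms(1)]
        by (cases "m = n") (simp_all add: quad_functional_def)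
    next
      case 3
      then have "quad_functional m n [i, j] = 0" "quad_functional m n [j, i] = 0"
        unfolding quad_functional_def by auto
      then show ?thesis using True by simp
    qed
  next
    case False
    then have "u @ [a, b] @ v \<noteq> [c, d]" for a b c d using eq by blast
    then have "quad_functional m n (u @ [a, b] @ v) = 0" for a b
      unfolding quad_functional_def by (simp only: if_False)
    then show ?thesis by (simp only: mult_zero_right)
  qed
  then show "pairing (basis_vec [i, j] \<ominus>\<^bsub>F\<^esub> p i j \<odot>\<^bsub>F\<^esub> basis_vec [j, i]) (\<lambda>w. quad_functional m n (u @ w @ v)) = 0"
    using ij by (subst pairing_relation) simp_all
qed

abbreviation "degree_one \<equiv> word_span ((\<lambda>k. [k]) ` {..<t})"

lemma degree_one_words: "(\<lambda>k. [k]) ` {..<t} \<subseteq> lists {..<t}"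
  by auto

lemma degree_one_closed: "x \<in> degree_one \<Longrightarrow> x \<in> carrier P"
  using P.subspaceD(1)[OF word_span_subspace] by blast

lemma gen_degree_one: "k < t \<Longrightarrow> word [k] \<in> degree_one"
  by (rule word_in_span) auto

lemma degree_one_induct [consumes 1, case_names zero add]:
  assumes "x \<in> degree_one" "Prop \<zero>\<^bsub>P\<^esub>"
    and "\<And>x c k. \<lbrakk>x \<in> carrier P; k < t; word [k] \<in> carrier P; Prop x\<rbrakk> \<Longrightarrow> Prop (x \<oplus>\<^bsub>P\<^esub> c \<odot>\<^bsub>P\<^esub> word [k])"
  shows "Prop x"
  using assms(1) degree_one_words
proof (induction rule: word_span_induct)
  case (add x c w)
  then show ?case using assms(3)[of x] degree_one_closed[of x] by (auto simp: word_closed)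
qed (rule assms(2))

lemma qas_degree_one_eq: "qas_degree_one t p \<subseteq> degree_one" "k < t \<Longrightarrow> word [k] \<in> qas_degree_one t p"
proof -
  have gen: "qas_gen t p ` {..<t} = (\<lambda>k. word [k]) ` {..<t}"
    by (simp add: qas_gen_def presented_gen_eq_word)
  have "(\<lambda>k. word [k]) ` {..<t} \<subseteq> degree_one" using gen_degree_one by auto
  then show "qas_degree_one t p \<subseteq> degree_one"
    unfolding qas_degree_one_def quantum_affine_space_eq gen
    by (rule P.lin_span_minimal[OF word_span_subspace])
  show "k < t \<Longrightarrow> word [k] \<in> qas_degree_one t p"
    unfolding qas_degree_one_def quantum_affine_space_eq gen
    using P.lin_span_superset[of "(\<lambda>k. word [k]) ` {..<t}"] by blast
qed

lemma gen_mult: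
  assumes "i < t" "j < t"
  shows "word [i] \<otimes>\<^bsub>P\<^esub> word [j] = p i j \<odot>\<^bsub>P\<^esub> (word [j] \<otimes>\<^bsub>P\<^esub> word [i])"
proof -
  have "basis_vec [i, j] \<ominus>\<^bsub>F\<^esub> p i j \<odot>\<^bsub>F\<^esub> basis_vec [j, i] \<in> qas_relations t p"
    using assms unfolding qas_relations_def Let_def by blast
  then have "word [i, j] = p i j \<odot>\<^bsub>P\<^esub> word [j, i]" using assms by (intro word_relation) simp_all
  then show ?thesis using assms by (simp add: word_mult)
qed

lemmas linear_coeff_add = coset_pairing_add[OF linear_respects, folded linear_coeff_def]
  and linear_coeff_smult = coset_pairing_smult[OF linear_respects, folded linear_coeff_def]
  and linear_coeff_zero = coset_pairing_zero[OF linear_respects, folded linear_coeff_def]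

lemma linear_coeff_gen: "i < t \<Longrightarrow> linear_coeff k (word [i]) = of_bool (k = i)"
  using coset_pairing_word[OF linear_respects, of "[i]" k] by (auto simp: linear_coeff_def)

lemma degree_one_eq_zero:
  assumes "x \<in> degree_one" "\<And>k. k < t \<Longrightarrow> linear_coeff k x = 0"
  shows "x = \<zero>\<^bsub>P\<^esub>"
proof -
  obtain f where f: "f \<in> carrier F" "{w. f w \<noteq> 0} \<subseteq> (\<lambda>k. [k]) ` {..<t}"
    "x = Idl\<^bsub>F\<^esub> (qas_relations t p) +>\<^bsub>F\<^esub> f"
    using assms(1) by (auto simp: word_span_def)
  have "f [k] = 0" if "k < t" for k
  proof -
    have fin: "finite (insert [k] {w. f w \<noteq> 0})" using f(1) by (simp add: F_carrier)
    have "linear_coeff k x = pairing f (\<lambda>w. of_bool (w = [k]))"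
      using f(1) by (simp add: f(3) linear_coeff_def coset_pairing_coset[OF linear_respects])
    also have "\<dots> = (\<Sum>w\<in>insert [k] {w. f w \<noteq> 0}. f w * of_bool (w = [k]))"
      by (rule pairing_on[OF fin]) blast
    also have "\<dots> = (\<Sum>w\<in>insert [k] {w. f w \<noteq> 0}. if w = [k] then f w else 0)"
      by (rule sum.cong) auto
    also have "\<dots> = f [k]" using fin by (simp add: sum.delta)
    finally show ?thesis using assms(2)[OF that] by simp
  qed
  then have "f w = 0" for w using f(2) by blast
  then have "f = \<zero>\<^bsub>F\<^esub>" by (simp add: F_zero fun_eq_iff)
  then show ?thesis using f(3) by (simp add: presented_algebra_def Q.coset_zero)
qed

lemma linear_coeff_map:
  assumes T: "T \<in> linear_maps P P" and x: "x \<in> degree_one"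
  shows "linear_coeff m (T x) = (\<Sum>k<t. linear_coeff m (T (word [k])) * linear_coeff k x)"
proof -
  have T_closed: "T y \<in> carrier P" and T_smult: "T (c \<odot>\<^bsub>P\<^esub> y) = c \<odot>\<^bsub>P\<^esub> T y"
    if "y \<in> carrier P" for y c using T that by (auto simp: linear_maps_def)
  have T_add: "T (y \<oplus>\<^bsub>P\<^esub> z) = T y \<oplus>\<^bsub>P\<^esub> T z" if "y \<in> carrier P" "z \<in> carrier P" for y z
    using T that by (auto simp: linear_maps_def)
  show ?thesis
    using x
  proof (induction rule: degree_one_induct)
    case zero
    have "T \<zero>\<^bsub>P\<^esub> = T (0 \<odot>\<^bsub>P\<^esub> \<zero>\<^bsub>P\<^esub>)" using P.smult_l_null[of "\<zero>\<^bsub>P\<^esub>"] by simp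
    also have "\<dots> = \<zero>\<^bsub>P\<^esub>"
      using T_smult[of "\<zero>\<^bsub>P\<^esub>" 0] T_closed[of "\<zero>\<^bsub>P\<^esub>"] P.smult_l_null[of "T \<zero>\<^bsub>P\<^esub>"] by simp
    finally show ?case by (simp add: linear_coeff_zero)
  next
    case (add x c k)
    have "linear_coeff m (T (x \<oplus>\<^bsub>P\<^esub> c \<odot>\<^bsub>P\<^esub> word [k]))
        = linear_coeff m (T x) + c * linear_coeff m (T (word [k]))"
      using add.hyps by (simp add: T_add T_smult T_closed P.smult_closed linear_coeff_add linear_coeff_smult)
    moreover have "(\<Sum>j<t. linear_coeff m (T (word [j])) * linear_coeff j (x \<oplus>\<^bsub>P\<^esub> c \<odot>\<^bsub>P\<^esub> word [k]))
        = (\<Sum>j<t. linear_coeff m (T (word [j])) * linear_coeff j x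
             + (if j = k then c * linear_coeff m (T (word [k])) else 0))"
      using add.hyps by (intro sum.cong)
        (auto simp: linear_coeff_add linear_coeff_smult P.smult_closed linear_coeff_gen distrib_left)
    ultimately show ?case using add by (simp add: sum.distrib)
  qed
qed

lemma quad_coeff_product:
  assumes mn: "m < t" "n < t" and x: "x \<in> degree_one" and y: "y \<in> degree_one"
  shows "coset_pairing (quad_functional m n) (x \<otimes>\<^bsub>P\<^esub> y)
    = quad_coeff p m n (\<lambda>k. linear_coeff k x) (\<lambda>k. linear_coeff k y)"
proof -
  note q = coset_pairing_add[OF quad_respects[OF mn]] coset_pairing_smult[OF quad_respects[OF mn]]
    coset_pairing_zero[OF quad_respects[OF mn]]
  have gen: "coset_pairing (quad_functional m n) (word [i] \<otimes>\<^bsub>P\<^esub> word [j])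
      = quad_coeff p m n (\<lambda>k. of_bool (k = i)) (\<lambda>k. of_bool (k = j))" if "i < t" "j < t" for i j
    using coset_pairing_word[OF quad_respects[OF mn], of "[i, j]"] that
    by (auto simp: word_mult quad_functional_def quad_coeff_def)
  have left: "coset_pairing (quad_functional m n) (word [i] \<otimes>\<^bsub>P\<^esub> y)
      = quad_coeff p m n (\<lambda>k. of_bool (k = i)) (\<lambda>k. linear_coeff k y)" if i: "i < t" for i
    using y
  proof (induction rule: degree_one_induct)
    case zero
    then show ?case using i by (simp add: q linear_coeff_zero word_closed quad_coeff_def)
  next
    case (add y c j)
    have "word [i] \<in> carrier P" using i by (simp add: word_closed)
    then have "coset_pairing (quad_functional m n) (word [i] \<otimes>\<^bsub>P\<^esub> (y \<oplus>\<^bsub>P\<^esub> c \<odot>\<^bsub>P\<^esub> word [j]))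
      = quad_coeff p m n (\<lambda>k. of_bool (k = i)) (\<lambda>k. linear_coeff k y)
        + c * quad_coeff p m n (\<lambda>k. of_bool (k = i)) (\<lambda>k. of_bool (k = j))"
      using add gen[OF i] by (simp add: P.r_distr P.smult_mult_right P.smult_closed q)
    then show ?case
      using add by (simp add: quad_coeff_def linear_coeff_add linear_coeff_smult P.smult_closed
          linear_coeff_gen algebra_simps)
  qed
  have yc: "y \<in> carrier P" using y by (rule degree_one_closed)
  show ?thesis
    using x
  proof (induction rule: degree_one_induct)
    case zero
    then show ?case using yc by (simp add: q linear_coeff_zero quad_coeff_def)
  next
    case (add x c i)
    have "coset_pairing (quad_functional m n) ((x \<oplus>\<^bsub>P\<^esub> c \<odot>\<^bsub>P\<^esub> word [i]) \<otimes>\<^bsub>P\<^esub> y)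
      = quad_coeff p m n (\<lambda>k. linear_coeff k x) (\<lambda>k. linear_coeff k y)
        + c * quad_coeff p m n (\<lambda>k. of_bool (k = i)) (\<lambda>k. linear_coeff k y)"
      using add left yc by (simp add: P.l_distr P.smult_mult_left P.smult_closed q)
    then show ?case
      using add by (simp add: quad_coeff_def linear_coeff_add linear_coeff_smult P.smult_closed
          linear_coeff_gen algebra_simps)
  qed
qed

lemma gen_nonzero: "k < t \<Longrightarrow> word [k] \<noteq> \<zero>\<^bsub>P\<^esub>"
  using linear_coeff_gen[of k k] linear_coeff_zero[of k] by auto

end

section \<open>The action in coordinates\<close>

locale quantum_action = bosonization G \<theta> g \<chi> B + A: quantum_affine t p
  for G :: "'g monoid" and \<theta> :: nat and g :: "nat \<Rightarrow> 'g" and \<chi> :: "nat \<Rightarrow> 'g \<Rightarrow> 'k::field"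
    and B :: "('k, ('g bos_symbol list \<Rightarrow> 'k) set) hopf"
    and t :: nat and p :: "nat \<Rightarrow> nat \<Rightarrow> 'k" +
  fixes act :: "('g bos_symbol list \<Rightarrow> 'k) set \<Rightarrow> (nat list \<Rightarrow> 'k) set \<Rightarrow> (nat list \<Rightarrow> 'k) set"
  assumes module_algebra: "module_algebra B (quantum_affine_space t p) act"
    and linear: "linear_action G \<theta> g \<chi> t p act"
    and faithful: "inner_faithful B (quantum_affine_space t p) act"
begin

lemma act_linear: "h \<in> carrier B \<Longrightarrow> act h \<in> linear_maps A.P A.P"
  and act_linear_left: "a \<in> carrier A.P \<Longrightarrow> (\<lambda>h. act h a) \<in> linear_maps B A.P"
  and act_one: "a \<in> carrier A.P \<Longrightarrow> act \<one>\<^bsub>B\<^esub> a = a"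
  and act_mult: "\<lbrakk>h \<in> carrier B; h' \<in> carrier B; a \<in> carrier A.P\<rbrakk> \<Longrightarrow> act (h \<otimes>\<^bsub>B\<^esub> h') a = act h (act h' a)"
  and act_unit: "h \<in> carrier B \<Longrightarrow> act h \<one>\<^bsub>A.P\<^esub> = counit B h \<odot>\<^bsub>A.P\<^esub> \<one>\<^bsub>A.P\<^esub>"
  and act_product: "\<lbrakk>h \<in> carrier B; a \<in> carrier A.P; b \<in> carrier A.P\<rbrakk> \<Longrightarrow>
      act h (a \<otimes>\<^bsub>A.P\<^esub> b) = tensor_lift A.P (\<lambda>h1 h2. act h1 a \<otimes>\<^bsub>A.P\<^esub> act h2 b) (comult B h)"
  using module_algebra unfolding module_algebra_def A.quantum_affine_space_eq by blast+

lemma act_closed: "\<lbrakk>h \<in> carrier B; a \<in> carrier A.P\<rbrakk> \<Longrightarrow> act h a \<in> carrier A.P"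
  by (rule linear_mapsD(1)[OF act_linear])

lemma act_smult_left: "\<lbrakk>h \<in> carrier B; a \<in> carrier A.P\<rbrakk> \<Longrightarrow> act (c \<odot>\<^bsub>B\<^esub> h) a = c \<odot>\<^bsub>A.P\<^esub> act h a"
  and act_add_left: "\<lbrakk>h \<in> carrier B; h' \<in> carrier B; a \<in> carrier A.P\<rbrakk> \<Longrightarrow>
    act (h \<oplus>\<^bsub>B\<^esub> h') a = act h a \<oplus>\<^bsub>A.P\<^esub> act h' a"
  using linear_mapsD(2,3)[OF act_linear_left] by metis+

lemma act_smult_right: "\<lbrakk>h \<in> carrier B; a \<in> carrier A.P\<rbrakk> \<Longrightarrow> act h (c \<odot>\<^bsub>A.P\<^esub> a) = c \<odot>\<^bsub>A.P\<^esub> act h a"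
  and act_add_right: "\<lbrakk>h \<in> carrier B; a \<in> carrier A.P; b \<in> carrier A.P\<rbrakk> \<Longrightarrow>
    act h (a \<oplus>\<^bsub>A.P\<^esub> b) = act h a \<oplus>\<^bsub>A.P\<^esub> act h b"
  using linear_mapsD(2,3)[OF act_linear] by metis+

lemma act_zero_left: "a \<in> carrier A.P \<Longrightarrow> act \<zero>\<^bsub>B\<^esub> a = \<zero>\<^bsub>A.P\<^esub>"
  using act_smult_left[of "\<zero>\<^bsub>B\<^esub>" a 0] act_closed[of "\<zero>\<^bsub>B\<^esub>" a] H.smult_l_null[of "\<zero>\<^bsub>B\<^esub>"]
    A.P.smult_l_null[of "act \<zero>\<^bsub>B\<^esub> a"] by simp

lemma act_zero_right: "h \<in> carrier B \<Longrightarrow> act h \<zero>\<^bsub>A.P\<^esub> = \<zero>\<^bsub>A.P\<^esub>"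
  using act_smult_right[of h "\<zero>\<^bsub>A.P\<^esub>" 0] act_closed[of h "\<zero>\<^bsub>A.P\<^esub>"] A.P.smult_l_null[of "\<zero>\<^bsub>A.P\<^esub>"]
    A.P.smult_l_null[of "act h \<zero>\<^bsub>A.P\<^esub>"] by simp

lemma act_bilinear:
  assumes "a \<in> carrier A.P" "b \<in> carrier A.P"
  shows "bilinear_map B B A.P (\<lambda>h1 h2. act h1 a \<otimes>\<^bsub>A.P\<^esub> act h2 b)"
  using assms
  by (auto simp: bilinear_map_def linear_maps_def act_smult_left act_add_left act_closed
      A.P.l_distr A.P.r_distr A.P.smult_mult_left A.P.smult_mult_right)

lemma act_Grp_product:
  assumes "h \<in> carrier G" "a \<in> carrier A.P" "b \<in> carrier A.P"
  shows "act (word [Grp h]) (a \<otimes>\<^bsub>A.P\<^esub> b) = act (word [Grp h]) a \<otimes>\<^bsub>A.P\<^esub> act (word [Grp h]) b"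
  using assms T.tensor_lift_tensor[OF A.P.ground_algebra_axioms act_bilinear, of a b]
  by (simp add: act_product wordB_closed comult_Grp)

lemma act_Skew_product:
  assumes "i < \<theta>" "a \<in> carrier A.P" "b \<in> carrier A.P"
  shows "act (word [Skew i]) (a \<otimes>\<^bsub>A.P\<^esub> b) =
    act (word [Grp (g i)]) a \<otimes>\<^bsub>A.P\<^esub> act (word [Skew i]) b \<oplus>\<^bsub>A.P\<^esub> act (word [Skew i]) a \<otimes>\<^bsub>A.P\<^esub> b"
proof -
  note \<beta> = A.P.ground_algebra_axioms act_bilinear[OF assms(2,3)]
  have "word [Grp (g i)] \<in> carrier B" "word [Skew i] \<in> carrier B" "word [] \<in> carrier B"
    using assms g_closed by (simp_all add: wordB_closed)
  then show ?thesis
    using assms act_one[of b]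
    by (simp add: act_product comult_Skew T.tensor_lift_add[OF \<beta>] T.tensor_lift_tensor[OF \<beta>] wordB_one)
qed

text \<open>The inverse of \<open>h\<close> acts as well, even where it does not preserve degrees.\<close>

lemma act_Grp_injective:
  assumes "h \<in> carrier G" "a \<in> carrier A.P" "act (word [Grp h]) a = \<zero>\<^bsub>A.P\<^esub>"
  shows "a = \<zero>\<^bsub>A.P\<^esub>"
proof -
  have "act (word [Grp (inv\<^bsub>G\<^esub> h)]) (act (word [Grp h]) a) = a"
    using assms act_mult[of "word [Grp (inv\<^bsub>G\<^esub> h)]" "word [Grp h]" a]
    by (simp add: wordB_closed word_Grp_mult word_Grp_one act_one)
  then show ?thesis
    using assms act_zero_right[of "word [Grp (inv\<^bsub>G\<^esub> h)]"] by (simp add: wordB_closed)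
qed

lemma act_Grp_Skew:
  assumes "h \<in> carrier G" "i < \<theta>" "a \<in> carrier A.P"
  shows "act (word [Grp h]) (act (word [Skew i]) a) = \<chi> i h \<odot>\<^bsub>A.P\<^esub> act (word [Skew i]) (act (word [Grp h]) a)"
proof -
  have c: "word [Grp h] \<in> carrier B" "word [Skew i] \<in> carrier B"
    using assms by (simp_all add: wordB_closed)
  then show ?thesis
    using act_mult[of "word [Grp h]" "word [Skew i]" a] act_mult[of "word [Skew i]" "word [Grp h]" a]
      word_GrpSkew[OF assms(1,2)] act_smult_left[of "word [Skew i] \<otimes>\<^bsub>B\<^esub> word [Grp h]" a "\<chi> i h"] assms(3)
    by simp
qed

lemma act_Skew_Skew:
  assumes "i < \<theta>" "j < \<theta>" "i \<noteq> j" "a \<in> carrier A.P"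
  shows "act (word [Skew i]) (act (word [Skew j]) a) = \<chi> j (g i) \<odot>\<^bsub>A.P\<^esub> act (word [Skew j]) (act (word [Skew i]) a)"
proof -
  have c: "word [Skew i] \<in> carrier B" "word [Skew j] \<in> carrier B"
    using assms by (simp_all add: wordB_closed)
  then show ?thesis
    using act_mult[of "word [Skew i]" "word [Skew j]" a] act_mult[of "word [Skew j]" "word [Skew i]" a]
      word_SkewSkew[OF assms(1-3)] act_smult_left[of "word [Skew j] \<otimes>\<^bsub>B\<^esub> word [Skew i]" a "\<chi> j (g i)"] assms(4)
    by simp
qed

text \<open>This is where inner faithfulness enters: a skew derivation that kills the generators kills the whole
  algebra, and then so does the nonzero Hopf ideal \<open>skew_ideal i\<close>.\<close>

lemma Skew_nonzero_on_generators:
  assumes i: "i < \<theta>"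
  shows "\<exists>k<t. act (word [Skew i]) (A.word [k]) \<noteq> \<zero>\<^bsub>A.P\<^esub>"
proof (rule ccontr)
  let ?x = "word [Skew i]"
  assume "\<not> ?thesis"
  then have gen: "act ?x (A.word [k]) = \<zero>\<^bsub>A.P\<^esub>" if "k < t" for k using that by blast
  have x: "?x \<in> carrier B" and gi: "word [Grp (g i)] \<in> carrier B"
    using i g_closed[OF i] by (simp_all add: wordB_closed)
  have words: "act ?x (A.word w) = \<zero>\<^bsub>A.P\<^esub>" if "w \<in> lists {..<t}" for w
    using that
  proof (induction w)
    case Nil
    then show ?case
      using x by (simp add: A.word_one act_unit counit_Skew[OF i] A.P.smult_l_null[simplified])
  next
    case (Cons k w)
    then have k: "k < t" "A.word [k] \<in> carrier A.P" "A.word w \<in> carrier A.P"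
      by (simp_all add: A.word_closed)
    have "A.word (k # w) = A.word [k] \<otimes>\<^bsub>A.P\<^esub> A.word w"
      using A.word_mult[of "[k]" w] Cons.hyps by simp
    then show ?case
      using Cons k gen[OF k(1)] act_closed[OF gi k(2)] by (simp add: act_Skew_product[OF i])
  qed
  have all: "act ?x a = \<zero>\<^bsub>A.P\<^esub>" if "a \<in> carrier A.P" for a
    using that[folded A.word_span_all] subset_refl
  proof (induction rule: A.word_span_induct)
    case zero
    then show ?case by (rule act_zero_right[OF x])
  next
    case (add a c w)
    then have "a \<in> carrier A.P" "A.word w \<in> carrier A.P"
      by (simp_all add: A.word_closed A.word_span_all)
    then show ?case
      using add words[of w] x A.P.smult_r_null[of c]
      by (simp add: act_add_right act_smult_right A.P.smult_closed)
  qed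
  have kill: "act (word w) a = \<zero>\<^bsub>A.P\<^esub>" if "w \<in> lists S" "Skew i \<in> set w" "a \<in> carrier A.P" for w a
    using that
  proof (induction w arbitrary: a)
    case (Cons s w)
    have c: "word [s] \<in> carrier B" "word w \<in> carrier B" using Cons.hyps by (simp_all add: wordB_closed)
    have "word (s # w) = word [s] \<otimes>\<^bsub>B\<^esub> word w"
      using Cons.hyps wordB_mult[of "[s]" w] by simp
    then have eq: "act (word (s # w)) a = act (word [s]) (act (word w) a)"
      using act_mult[OF c] Cons.prems by simp
    show ?case
    proof (cases "s = Skew i")
      case True
      then show ?thesis using eq all act_closed[OF c(2)] Cons.prems by simp
    next
      case False
      then show ?thesis using eq Cons act_zero_right[OF c(1)] by simp
    qed
  qed simp
  have "act h a = \<zero>\<^bsub>A.P\<^esub>" if "h \<in> skew_ideal i" "a \<in> carrier A.P" for h a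
    using that(1)
  proof (induction rule: skew_ideal_induct)
    case zero
    then show ?case using that(2) by (rule act_zero_left)
  next
    case (add x c w)
    then show ?case
      using that(2) kill[of w a] A.P.smult_r_null[of c]
      by (simp add: act_add_left act_smult_left wordB_closed H.smult_closed)
  qed
  then have "hopf_ideal (skew_ideal i) B \<and> skew_ideal i \<noteq> {\<zero>\<^bsub>B\<^esub>} \<and>
      (\<forall>h\<in>skew_ideal i. \<forall>a\<in>carrier A.P. act h a = \<zero>\<^bsub>A.P\<^esub>)"
    using skew_ideal_hopf_ideal skew_ideal_nonzero[OF i] by blast
  then show False
    using faithful unfolding inner_faithful_def A.quantum_affine_space_eq by blast
qed

definition grp_matrix :: "nat \<Rightarrow> nat \<Rightarrow> nat \<Rightarrow> 'k"
  where "grp_matrix r m k = A.linear_coeff m (act (word [Grp (g r)]) (A.word [k]))"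

definition skew_matrix :: "nat \<Rightarrow> nat \<Rightarrow> nat \<Rightarrow> 'k"
  where "skew_matrix r m k = A.linear_coeff m (act (word [Skew r]) (A.word [k]))"

lemma gens_closed:
  assumes "r < \<theta>"
  shows "word [Grp (g r)] \<in> carrier B" "word [Skew r] \<in> carrier B"
  using assms g_closed[OF assms] by (simp_all add: wordB_closed)

lemma act_degree_one:
  assumes "r < \<theta>" "k < t"
  shows "act (word [Grp (g r)]) (A.word [k]) \<in> A.degree_one" "act (word [Skew r]) (A.word [k]) \<in> A.degree_one"
  using linear assms(1) A.qas_degree_one_eq(1) A.qas_degree_one_eq(2)[OF assms(2)]
  by (auto simp: linear_action_def bos_gen_eq_word)

lemma grp_skew_matrix:
  assumes "r < \<theta>" "s < \<theta>" "i < t" "m < t"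
  shows "(\<Sum>k<t. grp_matrix r m k * skew_matrix s k i) = \<chi> s (g r) * (\<Sum>k<t. skew_matrix s m k * grp_matrix r k i)"
proof -
  have u: "A.word [i] \<in> carrier A.P" using assms by (simp add: A.word_closed)
  have "A.linear_coeff m (act (word [Grp (g r)]) (act (word [Skew s]) (A.word [i])))
      = \<chi> s (g r) * A.linear_coeff m (act (word [Skew s]) (act (word [Grp (g r)]) (A.word [i])))"
    using act_Grp_Skew[OF g_closed[OF assms(1)] assms(2) u] gens_closed[OF assms(1)] gens_closed[OF assms(2)] u
    by (simp add: A.linear_coeff_smult act_closed)
  then show ?thesis
    using A.linear_coeff_map[OF act_linear[OF gens_closed(1)[OF assms(1)]] act_degree_one(2)[OF assms(2,3)], of m]
      A.linear_coeff_map[OF act_linear[OF gens_closed(2)[OF assms(2)]] act_degree_one(1)[OF assms(1,3)], of m]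
    by (simp add: grp_matrix_def skew_matrix_def)
qed

lemma skew_skew_matrix:
  assumes "r < \<theta>" "s < \<theta>" "r \<noteq> s" "i < t" "m < t"
  shows "(\<Sum>k<t. skew_matrix r m k * skew_matrix s k i) = \<chi> s (g r) * (\<Sum>k<t. skew_matrix s m k * skew_matrix r k i)"
proof -
  have u: "A.word [i] \<in> carrier A.P" using assms by (simp add: A.word_closed)
  have "A.linear_coeff m (act (word [Skew r]) (act (word [Skew s]) (A.word [i])))
      = \<chi> s (g r) * A.linear_coeff m (act (word [Skew s]) (act (word [Skew r]) (A.word [i])))"
    using act_Skew_Skew[OF assms(1-3) u] gens_closed[OF assms(1)] gens_closed[OF assms(2)] u
    by (simp add: A.linear_coeff_smult act_closed)
  then show ?thesis
    using A.linear_coeff_map[OF act_linear[OF gens_closed(2)[OF assms(1)]] act_degree_one(2)[OF assms(2,4)], of m]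
      A.linear_coeff_map[OF act_linear[OF gens_closed(2)[OF assms(2)]] act_degree_one(2)[OF assms(1,4)], of m]
    by (simp add: skew_matrix_def)
qed

text \<open>The equations are those obtained by applying \<open>g\<^sub>r\<close> and \<open>x\<^sub>r\<close> to \<open>u\<^sub>i u\<^sub>j = p\<^sub>i\<^sub>j u\<^sub>j u\<^sub>i\<close>.\<close>

lemma skew_matrix_derivation:
  assumes r: "r < \<theta>"
    and p_sq: "\<And>i j. \<lbrakk>i < t; j < t; i \<noteq> j\<rbrakk> \<Longrightarrow> p i j * p i j \<noteq> 1"
    and lam: "\<chi> r (g r) \<noteq> 1"
  shows "linear_skew_derivation t p (grp_matrix r) (skew_matrix r) (\<chi> r (g r))"
proof unfold_locales
  note gens_closed = gens_closed[OF r] and act_degree_one = act_degree_one[OF r]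
  let ?g = "word [Grp (g r)]" and ?x = "word [Skew r]"
  have u: "A.word [k] \<in> carrier A.P" if "k < t" for k using that by (simp add: A.word_closed)
  show "p i j * p j i = 1" if "i < t" "j < t" for i j using that by (rule A.p_inverse)
  show "p i i = 1" if "i < t" for i using that by (rule A.p_diag)
  show "p i j * p i j \<noteq> 1" if "i < t" "j < t" "i \<noteq> j" for i j using that by (rule p_sq)
  show "\<chi> r (g r) \<noteq> 1" by (fact lam)
  show "\<exists>k<t. grp_matrix r k i \<noteq> 0" if "i < t" for i
  proof (rule ccontr)
    assume "\<not> ?thesis"
    then have "act ?g (A.word [i]) = \<zero>\<^bsub>A.P\<^esub>"
      using act_degree_one(1)[OF that] by (intro A.degree_one_eq_zero) (auto simp: grp_matrix_def)
    then show False
      using act_Grp_injective[OF g_closed[OF r] u[OF that]] A.gen_nonzero[OF that] by blast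
  qed
  show "\<exists>k<t. \<exists>j<t. skew_matrix r k j \<noteq> 0"
  proof -
    obtain j where j: "j < t" "act ?x (A.word [j]) \<noteq> \<zero>\<^bsub>A.P\<^esub>"
      using Skew_nonzero_on_generators[OF r] by blast
    then have "\<exists>k<t. skew_matrix r k j \<noteq> 0"
      using A.degree_one_eq_zero[OF act_degree_one(2)[OF j(1)]] by (auto simp: skew_matrix_def)
    then show ?thesis using j(1) by blast
  qed
  show "(\<Sum>k<t. grp_matrix r m k * skew_matrix r k i) = \<chi> r (g r) * (\<Sum>k<t. skew_matrix r m k * grp_matrix r k i)"
    if "i < t" "m < t" for i m using r r that by (rule grp_skew_matrix)
  fix i j m n assume ij: "i < t" "j < t" and mn: "m < t" "n < t"
  let ?q = "coset_pairing (A.quad_functional m n)"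
  note q = A.quad_coeff_product[OF mn]
  have qa: "?q (a \<oplus>\<^bsub>A.P\<^esub> b) = ?q a + ?q b" and qs: "?q (c \<odot>\<^bsub>A.P\<^esub> a) = c * ?q a"
    if "a \<in> carrier A.P" "b \<in> carrier A.P" for a b c
    using that A.coset_pairing_add[OF A.quad_respects[OF mn]] A.coset_pairing_smult[OF A.quad_respects[OF mn]]
    by blast+
  have gi: "act ?g (A.word [i]) \<in> carrier A.P" "act ?g (A.word [j]) \<in> carrier A.P"
    "act ?x (A.word [i]) \<in> carrier A.P" "act ?x (A.word [j]) \<in> carrier A.P"
    using gens_closed u ij by (simp_all add: act_closed)
  have prod: "A.word [j] \<otimes>\<^bsub>A.P\<^esub> A.word [i] \<in> carrier A.P" using u ij by simp
  show "quad_coeff p m n (\<lambda>k. grp_matrix r k i) (\<lambda>k. grp_matrix r k j)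
      = p i j * quad_coeff p m n (\<lambda>k. grp_matrix r k j) (\<lambda>k. grp_matrix r k i)"
  proof -
    have "act ?g (A.word [i] \<otimes>\<^bsub>A.P\<^esub> A.word [j]) = p i j \<odot>\<^bsub>A.P\<^esub> act ?g (A.word [j] \<otimes>\<^bsub>A.P\<^esub> A.word [i])"
      using A.gen_mult[OF ij] prod gens_closed by (simp add: act_smult_right)
    then have "?q (act ?g (A.word [i]) \<otimes>\<^bsub>A.P\<^esub> act ?g (A.word [j]))
        = p i j * ?q (act ?g (A.word [j]) \<otimes>\<^bsub>A.P\<^esub> act ?g (A.word [i]))"
      using u ij gi by (simp add: act_Grp_product g_closed[OF r] qs)
    then show ?thesis
      using act_degree_one ij by (simp add: q grp_matrix_def)
  qed
  show "quad_coeff p m n (\<lambda>k. grp_matrix r k i) (\<lambda>k. skew_matrix r k j)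
        + quad_coeff p m n (\<lambda>k. skew_matrix r k i) (\<lambda>k. of_bool (k = j))
      = p i j * (quad_coeff p m n (\<lambda>k. grp_matrix r k j) (\<lambda>k. skew_matrix r k i)
        + quad_coeff p m n (\<lambda>k. skew_matrix r k j) (\<lambda>k. of_bool (k = i)))"
  proof -
    have "act ?x (A.word [i] \<otimes>\<^bsub>A.P\<^esub> A.word [j]) = p i j \<odot>\<^bsub>A.P\<^esub> act ?x (A.word [j] \<otimes>\<^bsub>A.P\<^esub> A.word [i])"
      using A.gen_mult[OF ij] prod gens_closed by (simp add: act_smult_right)
    then have "act ?g (A.word [i]) \<otimes>\<^bsub>A.P\<^esub> act ?x (A.word [j]) \<oplus>\<^bsub>A.P\<^esub> act ?x (A.word [i]) \<otimes>\<^bsub>A.P\<^esub> A.word [j]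
        = p i j \<odot>\<^bsub>A.P\<^esub> (act ?g (A.word [j]) \<otimes>\<^bsub>A.P\<^esub> act ?x (A.word [i]) \<oplus>\<^bsub>A.P\<^esub> act ?x (A.word [j]) \<otimes>\<^bsub>A.P\<^esub> A.word [i])"
      using u ij by (simp add: act_Skew_product[OF r])
    from arg_cong[OF this, of ?q]
    have "?q (act ?g (A.word [i]) \<otimes>\<^bsub>A.P\<^esub> act ?x (A.word [j])) + ?q (act ?x (A.word [i]) \<otimes>\<^bsub>A.P\<^esub> A.word [j])
        = p i j * (?q (act ?g (A.word [j]) \<otimes>\<^bsub>A.P\<^esub> act ?x (A.word [i])) + ?q (act ?x (A.word [j]) \<otimes>\<^bsub>A.P\<^esub> A.word [i]))"
      using u ij gi by (simp add: qs qa)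
    then show ?thesis
      using act_degree_one ij A.gen_degree_one
      by (simp add: q grp_matrix_def skew_matrix_def A.linear_coeff_gen)
  qed
qed

lemma rank_le:
  assumes t: "2 \<le> t"
    and order: "\<And>r. r < \<theta> \<Longrightarrow> qls_order g \<chi> r \<ge> 3"
    and p_order: "\<And>i j. \<lbrakk>i < t; j < t; i \<noteq> j\<rbrakk> \<Longrightarrow> mult_ord (p i j) \<ge> 3"
  shows "\<theta> \<le> 2 * (t - 1)"
proof -
  have p_sq: "p i j * p i j \<noteq> 1" if "i < t" "j < t" "i \<noteq> j" for i j
  proof (rule mult_ord_square)
    show "p i j \<noteq> 0" using A.p_inverse[OF that(1,2)] by auto
  qed (rule p_order[OF that])
  have sq: "\<chi> r (g r) * \<chi> r (g r) \<noteq> 1" if "r < \<theta>" for r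
    using mult_ord_square[of "\<chi> r (g r)"] order[OF that] \<chi>_nonzero[OF that g_closed[OF that]]
    by (simp add: qls_order_def)
  interpret quantum_parameters t p
    by unfold_locales (use A.p_inverse A.p_diag p_sq in auto)
  show ?thesis
  proof (rule rank_bound[OF t, of \<theta> grp_matrix skew_matrix "\<lambda>r s. \<chi> s (g r)"])
    show "linear_skew_derivation t p (grp_matrix r) (skew_matrix r) (\<chi> r (g r))" if "r < \<theta>" for r
      using sq[OF that] by (intro skew_matrix_derivation[OF that p_sq]) auto
    show "\<chi> s (g r) * \<chi> r (g s) = 1" if "r < \<theta>" "s < \<theta>" "r \<noteq> s" for r s
      using \<chi>_g[of s r] \<chi>_nonzero[of r "g s"] g_closed[of s] that by simp
  qed (rule sq grp_skew_matrix skew_skew_matrix; assumption)+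
qed

end

theorem theorem3p13:
  fixes G :: "'g monoid"
    and \<theta> t :: nat
    and g :: "nat \<Rightarrow> 'g"
    and \<chi> :: "nat \<Rightarrow> 'g \<Rightarrow> 'k::{alg_closed_field, field_char_0}"
    and p :: "nat \<Rightarrow> nat \<Rightarrow> 'k"
    and B :: "('k, ('g bos_symbol list \<Rightarrow> 'k) set) hopf"
    and act :: "('g bos_symbol list \<Rightarrow> 'k) set \<Rightarrow> (nat list \<Rightarrow> 'k) set \<Rightarrow> (nat list \<Rightarrow> 'k) set"
  assumes "qls_datum G \<theta> g \<chi>"
    and "is_bosonization G \<theta> g \<chi> B"
    and "t \<ge> 2"
    and "quantum_params t p"
    and "\<And>i j. i < t \<Longrightarrow> j < t \<Longrightarrow> i \<noteq> j \<Longrightarrow> \<exists>n>0. p i j ^ n = 1"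
    and "module_algebra B (quantum_affine_space t p) act"
    and "linear_action G \<theta> g \<chi> t p act"
    and "inner_faithful B (quantum_affine_space t p) act"
    and "\<And>i. i < \<theta> \<Longrightarrow> qls_order g \<chi> i \<ge> 3"
    and "\<And>i j. i < t \<Longrightarrow> j < t \<Longrightarrow> i \<noteq> j \<Longrightarrow> mult_ord (p i j) \<ge> 3"
  shows "\<theta> \<le> 2 * (t - 1)"
proof -
  interpret quantum_action G \<theta> g \<chi> B t p act
    by (intro quantum_action.intro bosonization.intro quantum_affine.intro
        quantum_action_axioms.intro) (fact assms)+
  show ?thesis by (rule rank_le) (fact assms)+
qed

end
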